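(* Let $T=T_{a,b,c,d}:(\mathbb{P}^2)^{\mathbb{Z}}\dashrightarrow(\mathbb{P}^2)^{\mathbb{Z}}$ be an equal-length skew pentagram map over $\mathbb{C}$ (that is, $a,b,c,d\in\mathbb{Z}$ are distinct and $|b-a|=|d-c|$). Then the degree sequence $(\deg T^m)_{m\ge 0}$ has at most polynomial growth in $m$, so $\lambda_1(T)=1$.
   Context: Work over $\mathbb{C}$; $\operatorname{Ind}$ denotes the indeterminacy locus of a rational map. A local rule on $(\mathbb{P}^N)^{\mathbb{Z}}$ is a finite nonempty set $S\subset\mathbb{Z}$ (a neighborhood) with a rational map $\varphi:(\mathbb{P}^N)^S\dashrightarrow\mathbb{P}^N$. The associated lattice map is the partially defined map $T_\varphi:(\mathbb{P}^N)^{\mathbb{Z}}\dashrightarrow(\mathbb{P}^N)^{\mathbb{Z}}$, $(v_i)_{i}\mapsto(\varphi(v_{i+s}:s\in S))_{i}$. For finite nonempty $A\subset\mathbb{Z}$, the regional map $\varphi_A:(\mathbb{P}^N)^{A+S}\dashrightarrow(\mathbb{P}^N)^A$ is $v\mapsto(\varphi(v_{i+s}:s\in S))_{i\in A}$, where $A+S$ is the Minkowski sum. If $T,T'$ have local rules $(S,\varphi),(S',\varphi')$ and the image of $\varphi_{S'}$ is not contained in $\operatorname{Ind}\varphi'$, then $T'$ and $T$ are composable and $T'\circ T$ is the lattice map with local rule $\varphi'\circ\varphi_{S'}$ on $S+S'$. Iterates are $T^0=\mathrm{Id}$, $T^m=T\circ T^{m-1}$; $T$ is iterable if all iterates exist.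 The degree $\deg T$ of a lattice map is the total degree of the multihomogeneous polynomials giving a local rule $\varphi$ of $T$ when written without common factors. The dynamical degree of an iterable lattice map is $\lambda_1(T)=\lim_{m\to\infty}(\deg T^m)^{1/m}$ (the limit exists). For distinct $a,b,c,d\in\mathbb{Z}$, the skew pentagram map $T_{a,b,c,d}$ is the lattice map on $(\mathbb{P}^2)^{\mathbb{Z}}$ with $S=\{a,b,c,d\}$ sending $(v_i)$ to $(v_i')$ with $v_i'=\overline{v_{i+a}v_{i+b}}\cap\overline{v_{i+c}v_{i+d}}$, where $\overline{pq}$ is the line through distinct points $p,q$. It is iterable. *)

theory Defs
  imports
    "HOL-Analysis.Analysis"
    "HOL-Library.Poly_Mapping"
    "HOL-Library.Set_Algebras"
    "HOL-Library.Landau_Symbols"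
begin

section \<open>Complex projective space\<close>

definition proportional :: "complex^'n \<Rightarrow> complex^'n \<Rightarrow> bool" where
  "proportional x y \<longleftrightarrow> x \<noteq> 0 \<and> y \<noteq> 0 \<and> (\<exists>c. y = c *s x)"

lemma part_equivp_proportional: "part_equivp (proportional :: complex^'n \<Rightarrow> complex^'n \<Rightarrow> bool)"
proof (rule part_equivpI)
  show "\<exists>x::complex^'n. proportional x x"
    by (rule exI[of _ "vec 1"]) (auto simp: proportional_def vec_eq_iff intro!: exI[of _ 1])
  show "symp (proportional :: complex^'n \<Rightarrow> complex^'n \<Rightarrow> bool)"
  proof (rule sympI)
    fix x y :: "complex^'n"
    assume "proportional x y"
    then obtain c where c: "x \<noteq> 0" "y \<noteq> 0" "y = c *s x"
      by (auto simp: proportional_def)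
    then have "c \<noteq> 0" by auto
    with c have "x = inverse c *s y" by (simp add: vector_smult_assoc)
    with c show "proportional y x" unfolding proportional_def by blast
  qed
  show "transp (proportional :: complex^'n \<Rightarrow> complex^'n \<Rightarrow> bool)"
    by (rule transpI) (auto simp: proportional_def vector_smult_assoc)
qed

text \<open>The projective space of dimension \<open>CARD('n) - 1\<close>; in particular \<open>3 proj\<close> is the
  projective plane.  Below, \<open>rep_proj p\<close> is a choice of homogeneous coordinates of \<open>p\<close>, and
  \<open>abs_proj x\<close> is the point with homogeneous coordinates \<open>x\<close>, for \<open>x \<noteq> 0\<close>.\<close>

quotient_type 'n proj = "complex^'n" / partial: "proportional :: complex^'n \<Rightarrow> complex^'n \<Rightarrow> bool"
  by (rule part_equivp_proportional)

definition proj_line :: "'n::finite proj \<Rightarrow> 'n proj \<Rightarrow> 'n proj set" where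
  "proj_line p q = {r. rep_proj r \<in> vec.span {rep_proj p, rep_proj q}}"


section \<open>Rational maps between products of projective spaces\<close>

text \<open>A configuration assigns a point to every site in \<open>\<int>\<close>.  A point of the product indexed by
  \<open>S \<subseteq> \<int>\<close> is given by a configuration of which only the entries at sites in \<open>S\<close> matter.\<close>

type_synonym 'n config = "int \<Rightarrow> 'n proj"

text \<open>Polynomials in the variables \<open>x\<^bsub>i,k\<^esub>\<close>, the \<open>k\<close>-th homogeneous coordinate at site \<open>i\<close>.
  The product on this type is the polynomial one (convolution).\<close>

type_synonym 'n monom = "(int \<times> 'n) \<Rightarrow>\<^sub>0 nat"
type_synonym 'n mpoly = "'n monom \<Rightarrow>\<^sub>0 complex"

definition monom_degree_at :: "int \<Rightarrow> 'n::finite monom \<Rightarrow> nat" where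
  "monom_degree_at i m = (\<Sum>k\<in>UNIV. Poly_Mapping.lookup m (i, k))"

definition monom_total_degree :: "'n::finite monom \<Rightarrow> nat" where
  "monom_total_degree m = (\<Sum>v\<in>Poly_Mapping.keys m. Poly_Mapping.lookup m v)"

definition eval_mpoly :: "(int \<Rightarrow> complex^'n) \<Rightarrow> 'n::finite mpoly \<Rightarrow> complex" where
  "eval_mpoly x p =
     (\<Sum>m\<in>Poly_Mapping.keys p. Poly_Mapping.lookup p m *
        (\<Prod>v\<in>Poly_Mapping.keys m. (x (fst v) $ snd v) ^ Poly_Mapping.lookup m v))"

definition eval_forms :: "('n \<Rightarrow> 'n mpoly) \<Rightarrow> 'n::finite config \<Rightarrow> complex^'n" where
  "eval_forms F v = (\<chi> k. eval_mpoly (\<lambda>i. rep_proj (v i)) (F k))"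

text \<open>Tuples of multihomogeneous polynomials, all of the same multidegree and not all zero, in the
  variables at the sites in \<open>S\<close>.\<close>

definition forms_on :: "int set \<Rightarrow> ('n::finite \<Rightarrow> 'n mpoly) set" where
  "forms_on S = {F.
     (\<exists>k. F k \<noteq> 0) \<and>
     (\<forall>k. \<forall>m\<in>Poly_Mapping.keys (F k). Poly_Mapping.keys m \<subseteq> S \<times> UNIV) \<and>
     (\<exists>d. \<forall>k. \<forall>m\<in>Poly_Mapping.keys (F k). \<forall>i. monom_degree_at i m = d i)}"

text \<open>A rational map from the product of projective spaces indexed by \<open>S\<close> to projective space is
  a class of such tuples, two tuples being equivalent if they are proportional over the field of
  rational functions.\<close>

type_synonym 'n ratmap = "('n \<Rightarrow> 'n mpoly) set"

definition rational_maps :: "int set \<Rightarrow> 'n::finite ratmap set" where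
  "rational_maps S =
     {{G \<in> forms_on S. \<forall>j k. F j * G k = F k * G j} | F. F \<in> forms_on S}"

definition Ind :: "'n::finite ratmap \<Rightarrow> 'n config set" where
  "Ind \<phi> = {v. \<forall>F\<in>\<phi>. eval_forms F v = 0}"

definition rat_apply :: "'n::finite ratmap \<Rightarrow> 'n config \<Rightarrow> 'n proj" where
  "rat_apply \<phi> v = (THE p. \<exists>F\<in>\<phi>. eval_forms F v \<noteq> 0 \<and> p = abs_proj (eval_forms F v))"

definition no_common_factor :: "('n::finite \<Rightarrow> 'n mpoly) \<Rightarrow> bool" where
  "no_common_factor F \<longleftrightarrow> (\<forall>g. (\<forall>k. g dvd F k) \<longrightarrow> g dvd 1)"

definition ratmap_degree :: "'n::finite ratmap \<Rightarrow> nat" where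
  "ratmap_degree \<phi> = (THE n. \<exists>F\<in>\<phi>. no_common_factor F \<and>
     (\<forall>k. \<forall>m\<in>Poly_Mapping.keys (F k). monom_total_degree m = n))"


section \<open>Lattice maps\<close>

definition local_rule :: "int set \<Rightarrow> 'n::finite ratmap \<Rightarrow> bool" where
  "local_rule S \<phi> \<longleftrightarrow> finite S \<and> S \<noteq> {} \<and> \<phi> \<in> rational_maps S"

text \<open>The configuration \<open>\<lambda>s. v (i + s)\<close> is the window of \<open>v\<close> seen by the local rule at site \<open>i\<close>.\<close>

definition regional_map :: "'n::finite ratmap \<Rightarrow> int set \<Rightarrow> 'n config \<rightharpoonup> 'n config" where
  "regional_map \<phi> A v =
     (if \<forall>i\<in>A. (\<lambda>s. v (i + s)) \<notin> Ind \<phi>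
      then Some (\<lambda>i\<in>A. rat_apply \<phi> (\<lambda>s. v (i + s))) else None)"

type_synonym 'n lattice_map = "'n config \<rightharpoonup> 'n config"

definition lattice_map :: "'n::finite ratmap \<Rightarrow> 'n lattice_map" where
  "lattice_map \<phi> v =
     (if \<forall>i. (\<lambda>s. v (i + s)) \<notin> Ind \<phi>
      then Some (\<lambda>i. rat_apply \<phi> (\<lambda>s. v (i + s))) else None)"

definition has_local_rule :: "'n::finite lattice_map \<Rightarrow> int set \<Rightarrow> 'n ratmap \<Rightarrow> bool" where
  "has_local_rule T S \<phi> \<longleftrightarrow> local_rule S \<phi> \<and> T = lattice_map \<phi>"

definition composable_rules :: "int set \<Rightarrow> 'n::finite ratmap \<Rightarrow> 'n ratmap \<Rightarrow> bool" where
  "composable_rules S' \<phi>' \<phi> \<longleftrightarrow> \<not> ran (regional_map \<phi> S') \<subseteq> Ind \<phi>'"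

text \<open>For composable rules, the rational map \<open>\<phi>' \<circ> \<phi>\<^bsub>S'\<^esub>\<close> on \<open>S + S'\<close> (Minkowski sum): the only
  rational map that extends the pointwise composition.\<close>

definition rule_comp ::
    "int set \<Rightarrow> 'n::finite ratmap \<Rightarrow> int set \<Rightarrow> 'n ratmap \<Rightarrow> 'n ratmap" where
  "rule_comp S' \<phi>' S \<phi> = (THE \<psi>. \<psi> \<in> rational_maps (S + S') \<and>
     (\<forall>v w. regional_map \<phi> S' v = Some w \<and> w \<notin> Ind \<phi>' \<longrightarrow>
        v \<notin> Ind \<psi> \<and> rat_apply \<psi> v = rat_apply \<phi>' w))"

definition composable :: "'n::finite lattice_map \<Rightarrow> 'n lattice_map \<Rightarrow> bool" where
  "composable T' T \<longleftrightarrow> (\<exists>S \<phi> S' \<phi>'. has_local_rule T S \<phi> \<and> has_local_rule T' S' \<phi>' \<and>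
     composable_rules S' \<phi>' \<phi>)"

text \<open>The result does not depend on the local rules used.  Its domain may be larger than
  that of the composition of partial functions.\<close>

definition lattice_comp ::
    "'n::finite lattice_map \<Rightarrow> 'n lattice_map \<Rightarrow> 'n lattice_map" where
  "lattice_comp T' T = (THE T''. \<exists>S \<phi> S' \<phi>'. has_local_rule T S \<phi> \<and> has_local_rule T' S' \<phi>' \<and>
     composable_rules S' \<phi>' \<phi> \<and> T'' = lattice_map (rule_comp S' \<phi>' S \<phi>))"

primrec lattice_iter :: "'n::finite lattice_map \<Rightarrow> nat \<Rightarrow> 'n lattice_map" where
  "lattice_iter T 0 = Some"
| "lattice_iter T (Suc m) = lattice_comp T (lattice_iter T m)"

definition iterable :: "'n::finite lattice_map \<Rightarrow> bool" where
  "iterable T \<longleftrightarrow> (\<forall>m. composable T (lattice_iter T m))"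

definition lattice_degree :: "'n::finite lattice_map \<Rightarrow> nat" where
  "lattice_degree T = (THE n. \<exists>S \<phi>. has_local_rule T S \<phi> \<and> n = ratmap_degree \<phi>)"

definition degree_root :: "'n::finite lattice_map \<Rightarrow> nat \<Rightarrow> real" where
  "degree_root T m = root m (real (lattice_degree (lattice_iter T m)))"

definition dynamical_degree :: "'n::finite lattice_map \<Rightarrow> real" where
  "dynamical_degree T = lim (degree_root T)"


section \<open>Skew pentagram maps\<close>

text \<open>The value is undefined exactly when at some site one of the two lines, or their point of
  intersection, is not determined.  For distinct \<open>a, b, c, d\<close> these are the configurations for
  which some window lies in the indeterminacy locus of the corresponding rational map.\<close>

definition skew_pentagram :: "int \<Rightarrow> int \<Rightarrow> int \<Rightarrow> int \<Rightarrow> 3 lattice_map" where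
  "skew_pentagram a b c d v =
     (if \<forall>i. v (i + a) \<noteq> v (i + b) \<and> v (i + c) \<noteq> v (i + d) \<and>
             proj_line (v (i + a)) (v (i + b)) \<noteq> proj_line (v (i + c)) (v (i + d))
      then Some (\<lambda>i. THE p. p \<in> proj_line (v (i + a)) (v (i + b)) \<inter>
                             proj_line (v (i + c)) (v (i + d)))
      else None)"

end

theory Submission
  imports Defs "HOL-Computational_Algebra.Factorial_Ring" "Jordan_Normal_Form.Determinant"
begin

text \<open>\<^bold>\<open>Reaching an iterate in one step.\<close>
The line through two points does not depend on their order, so \<open>c\<close> and \<open>d\<close> may be exchanged and
it can be assumed that \<open>b = a + p\<close> and \<open>d = c + p\<close>.  Choose homogeneous coordinates \<open>v\<^sub>i\<close>.  Four
vectors of a three-dimensional space are dependent,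
\<open>\<alpha>\<^sub>i v(i + a) + \<beta>\<^sub>i v(i + a + p) = \<gamma>\<^sub>i v(i + c) + \<delta>\<^sub>i v(i + c + p)\<close>,
the coefficients are 3x3 determinants, and both sides are coordinates of the \<open>i\<close>-th point of the
image.  With the difference operators \<open>A\<close> and \<open>C\<close> on the two sides, the map sends \<open>v\<close> to
\<open>A v = C v\<close>.  There are operators \<open>A'\<close>, \<open>C'\<close> of the same two shapes with \<open>A' C = C' A\<close>, and then
\<open>A' (A v) = A' (C v) = C' (A v)\<close> is the relation for the image.  Composing these formulas gives
expressions of exponential degree.  Instead consider operators \<open>Q\<^sub>0, ..., Q\<^sub>n\<close>, each with \<open>n + 1\<close>
coefficients, such that \<open>Q\<^sub>j C = Q\<^sub>j\<^sub>+\<^sub>1 A\<close> for all \<open>j\<close>.  At a fixed site this is a homogeneous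
linear system of \<open>n (n + 2)\<close> equations for \<open>(n + 1)\<^sup>2\<close> unknowns with cubic coefficients, so minors
provide a nonzero solution of degree at most \<open>3 n (n + 2)\<close> (\<open>bounded_degree_kernel\<close>).  If \<open>v\<close> is
generic then every solution is of the form \<open>Q\<^sub>j = R\<^sub>j A'\<close>, \<open>Q\<^sub>j\<^sub>+\<^sub>1 = R\<^sub>j C'\<close>, and the \<open>R\<^sub>j\<close> solve the
system of the image with \<open>n - 1\<close> in place of \<open>n\<close>.  By induction \<open>Q\<^sub>0 A v\<close> is a nonzero multiple of
the iterate number \<open>n + 1\<close> (\<open>array_solution\<close>).  So the iterate number \<open>m\<close> is given by polynomials
whose degree is at most quadratic in \<open>m\<close> (\<open>iterate_bounded_forms\<close>).

\<^bold>\<open>From polynomials to degrees.\<close>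
The degree is that of a form without common factors, and the polynomials just found may have
common factors.  Polynomial rings have unique factorisation, so a tuple proportional to a form
without common factors is a polynomial multiple of it (\<open>reduced_dvd\<close>) and has at least its degree.
The same fact shows that a form without common factors has the indeterminacy locus of the map as
its zero set, and is determined by the lattice map up to a constant, which makes degrees and
compositions computable on forms (\<open>lattice_degree_form_map\<close>, \<open>lattice_comp_form_map\<close>).

\<^bold>\<open>Generic orbits exist.\<close>
The points \<open>(1, i, i\<^sup>2)\<close> lie on a conic.  The map sends them to the points of parameters
\<open>i + s\<close> of another conic, with constant \<open>s\<close>, so at every time any three of the points are
independent.  Hence all iterates exist, and the countably many polynomials that express general
position along an orbit are nonzero and have a common non-root (\<open>generic_orbit_exists\<close>).  The
iterates of these points are not constant either, so all degrees are at least one, and the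
\<open>m\<close>-th roots of the degrees tend to one.\<close>

alias keys = Poly_Mapping.keys
alias lookup = Poly_Mapping.lookup
alias single = Poly_Mapping.single

no_notation Matrix.vec_index (infixl \<open>$\<close> 100)

lemmas vector_eq_iff = Finite_Cartesian_Product.vec_eq_iff

section \<open>Evaluation homomorphisms\<close>

definition ring_hom_fun :: "('a::comm_semiring_1 \<Rightarrow> 'b::comm_semiring_1) \<Rightarrow> bool" where
  "ring_hom_fun h \<longleftrightarrow> h 0 = 0 \<and> h 1 = 1 \<and> (\<forall>x y. h (x + y) = h x + h y) \<and> (\<forall>x y. h (x * y) = h x * h y)"

lemma ring_hom_funD:
  assumes "ring_hom_fun h"
  shows "h 0 = 0" "h 1 = 1" "h (x + y) = h x + h y" "h (x * y) = h x * h y"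
  using assms by (auto simp: ring_hom_fun_def)

lemma ring_hom_fun_sum: "ring_hom_fun h \<Longrightarrow> h (sum f A) = (\<Sum>x\<in>A. h (f x))"
  by (induction A rule: infinite_finite_induct) (auto simp: ring_hom_funD)

lemma ring_hom_fun_prod: "ring_hom_fun h \<Longrightarrow> h (prod f A) = (\<Prod>x\<in>A. h (f x))"
  by (induction A rule: infinite_finite_induct) (auto simp: ring_hom_funD)

lemma ring_hom_fun_power: "ring_hom_fun h \<Longrightarrow> h (x ^ n) = h x ^ n"
  by (induction n) (auto simp: ring_hom_funD)

lemma ring_hom_fun_diff:
  fixes h :: "'a::comm_ring_1 \<Rightarrow> 'b::comm_ring_1"
  assumes "ring_hom_fun h" shows "h (x - y) = h x - h y"
proof -
  have "h (x - y) + h y = h x" using ring_hom_funD(3)[OF assms, of "x - y" y] by simp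
  then show ?thesis by (simp add: eq_diff_eq)
qed

lemma ring_hom_fun_comp: "ring_hom_fun g \<Longrightarrow> ring_hom_fun h \<Longrightarrow> ring_hom_fun (\<lambda>x. g (h x))"
  by (simp add: ring_hom_fun_def)

lemma ring_hom_fun_id: "ring_hom_fun (\<lambda>x. x)"
  by (simp add: ring_hom_fun_def)

type_synonym 'v cpoly = "('v \<Rightarrow>\<^sub>0 nat) \<Rightarrow>\<^sub>0 complex"

definition mono_val :: "('v \<Rightarrow> 'b::comm_semiring_1) \<Rightarrow> ('v \<Rightarrow>\<^sub>0 nat) \<Rightarrow> 'b" where
  "mono_val \<phi> m = (\<Prod>v\<in>keys m. \<phi> v ^ lookup m v)"

text \<open>Evaluation of a polynomial in an arbitrary commutative semiring.  Numerical values,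
  substitution, renaming of variables, gradings and the passage to univariate polynomials are all
  instances, and identities between them are checked on constants and variables (\<open>hom_eqI\<close>).\<close>

definition pval :: "(complex \<Rightarrow> 'b::comm_semiring_1) \<Rightarrow> ('v \<Rightarrow> 'b) \<Rightarrow> 'v cpoly \<Rightarrow> 'b" where
  "pval c \<phi> p = (\<Sum>m\<in>keys p. c (lookup p m) * mono_val \<phi> m)"

lemma mono_val_superset:
  assumes "finite A" "keys m \<subseteq> A"
  shows "mono_val \<phi> m = (\<Prod>v\<in>A. \<phi> v ^ lookup m v)"
  unfolding mono_val_def using assms
  by (intro prod.mono_neutral_left) (auto simp: in_keys_iff)

lemma mono_val_0 [simp]: "mono_val \<phi> 0 = 1"
  by (simp add: mono_val_def)

lemma mono_val_add: "mono_val \<phi> (m + n) = mono_val \<phi> m * mono_val \<phi> n"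
proof -
  let ?A = "keys m \<union> keys n"
  have "keys (m + n) \<subseteq> ?A" by (rule Poly_Mapping.keys_add)
  then show ?thesis
    by (simp add: mono_val_superset[of ?A] lookup_add power_add prod.distrib)
qed

lemma mono_val_single [simp]: "mono_val \<phi> (single v n) = \<phi> v ^ n"
  by (cases "n = 0") (auto simp: mono_val_def)

lemma pval_superset:
  assumes "finite A" "keys p \<subseteq> A" "c 0 = 0"
  shows "pval c \<phi> p = (\<Sum>m\<in>A. c (lookup p m) * mono_val \<phi> m)"
  unfolding pval_def using assms
  by (intro sum.mono_neutral_left) (auto simp: in_keys_iff)

lemma pval_single [simp]: "c 0 = 0 \<Longrightarrow> pval c \<phi> (single m a) = c a * mono_val \<phi> m"
  by (cases "a = 0") (auto simp: pval_def)

lemma pval_0 [simp]: "pval c \<phi> 0 = 0"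
  by (simp add: pval_def)

lemma pval_add:
  assumes "ring_hom_fun c" shows "pval c \<phi> (p + q) = pval c \<phi> p + pval c \<phi> q"
proof -
  let ?A = "keys p \<union> keys q"
  have "keys (p + q) \<subseteq> ?A" by (rule Poly_Mapping.keys_add)
  then show ?thesis
    using assms
    by (simp add: pval_superset[of ?A] lookup_add sum.distrib ring_hom_funD algebra_simps)
qed

lemma pval_sum: "ring_hom_fun c \<Longrightarrow> pval c \<phi> (sum f A) = (\<Sum>x\<in>A. pval c \<phi> (f x))"
  by (induction A rule: infinite_finite_induct) (auto simp: pval_add)

lemma cpoly_sum_monomials:
  "(p :: 'a \<Rightarrow>\<^sub>0 'b::comm_monoid_add) = (\<Sum>m\<in>keys p. single m (lookup p m))"
proof (rule poly_mapping_eqI)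
  fix k
  have "(\<Sum>m\<in>keys p. lookup (single m (lookup p m)) k)
     = (\<Sum>m\<in>keys p. if m = k then lookup p k else 0)"
    by (intro sum.cong) (auto simp: lookup_single when_def)
  also have "\<dots> = lookup p k"
    by (auto simp: in_keys_iff)
  finally show "lookup p k = lookup (\<Sum>m\<in>keys p. single m (lookup p m)) k"
    by (simp add: lookup_sum)
qed

lemma pval_mult:
  assumes c: "ring_hom_fun c" shows "pval c \<phi> (p * q) = pval c \<phi> p * pval c \<phi> q"
proof -
  let ?s = "\<lambda>p m. single m (lookup p m)"
  have "p * q = (\<Sum>m\<in>keys p. ?s p m) * (\<Sum>n\<in>keys q. ?s q n)"
    by (simp only: cpoly_sum_monomials[symmetric])
  then have "p * q = (\<Sum>m\<in>keys p. \<Sum>n\<in>keys q. ?s p m * ?s q n)"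
    by (simp only: sum_product)
  then have "pval c \<phi> (p * q) = (\<Sum>m\<in>keys p. \<Sum>n\<in>keys q.
      (c (lookup p m) * mono_val \<phi> m) * (c (lookup q n) * mono_val \<phi> n))"
    using c by (simp add: pval_sum mult_single mono_val_add ring_hom_funD ac_simps)
  then show ?thesis by (simp add: pval_def sum_product)
qed

lemma ring_hom_pval: "ring_hom_fun c \<Longrightarrow> ring_hom_fun (pval c \<phi>)"
  using pval_single[of c \<phi> 0 1]
  by (auto simp: ring_hom_fun_def pval_add pval_mult)

definition Con :: "complex \<Rightarrow> 'v cpoly" where "Con z = single 0 z"
definition Var :: "'v \<Rightarrow> 'v cpoly" where "Var v = single (single v 1) 1"

lemma ring_hom_Con: "ring_hom_fun (Con :: complex \<Rightarrow> 'v cpoly)"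
  by (simp add: ring_hom_fun_def Con_def single_add mult_single)

lemma pval_Con [simp]: "c 0 = 0 \<Longrightarrow> pval c \<phi> (Con z) = c z"
  by (simp add: Con_def)

lemma pval_Var [simp]: "ring_hom_fun c \<Longrightarrow> pval c \<phi> (Var v) = \<phi> v"
  by (simp add: Var_def ring_hom_funD)

lemma mono_val_Var: "mono_val Var m = single m 1"
proof -
  have *: "(Var v :: 'a cpoly) ^ n = single (single v n) 1" for v :: 'a and n
    by (induction n) (simp_all add: Var_def mult_single flip: single_add)
  have "(\<Prod>v\<in>A. single (single v (lookup m v)) (1::complex))
      = single (\<Sum>v\<in>A. single v (lookup m v)) 1" if "finite A" for A
    using that by (induction A) (auto simp: mult_single)
  then show ?thesis
    using cpoly_sum_monomials[of m, symmetric] by (simp add: mono_val_def *)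
qed

lemma pval_Con_Var [simp]: "pval Con Var p = p"
  using cpoly_sum_monomials[of p, symmetric] by (simp add: pval_def mono_val_Var Con_def mult_single)

lemma hom_mono_val: "ring_hom_fun h \<Longrightarrow> h (mono_val \<phi> m) = mono_val (\<lambda>v. h (\<phi> v)) m"
  by (simp add: mono_val_def ring_hom_fun_prod ring_hom_fun_power)

lemma hom_pval: "ring_hom_fun h \<Longrightarrow> h (pval c \<phi> p) = pval (\<lambda>z. h (c z)) (\<lambda>v. h (\<phi> v)) p"
  by (simp add: pval_def ring_hom_fun_sum ring_hom_funD hom_mono_val)

lemma hom_eq_pval: "ring_hom_fun h \<Longrightarrow> h p = pval (\<lambda>z. h (Con z)) (\<lambda>v. h (Var v)) p"
  using hom_pval[of h Con Var p] by simp

lemma hom_eqI: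
  assumes "ring_hom_fun g" "ring_hom_fun h" "\<And>z. g (Con z) = h (Con z)" "\<And>v. g (Var v) = h (Var v)"
  shows "g p = h p"
  using hom_eq_pval[OF assms(1), of p] hom_eq_pval[OF assms(2), of p] by (simp add: assms(3,4))

definition vars :: "'v cpoly \<Rightarrow> 'v set" where
  "vars p = (\<Union>m\<in>keys p. keys m)"

lemma finite_vars [simp]: "finite (vars p)" by (simp add: vars_def)

lemma pval_cong:
  assumes "\<And>v. v \<in> vars p \<Longrightarrow> \<phi> v = \<psi> v"
  shows "pval c \<phi> p = pval c \<psi> p"
proof -
  have "\<phi> v = \<psi> v" if "m \<in> keys p" "v \<in> keys m" for m v
    using assms that by (auto simp: vars_def)
  then show ?thesis unfolding pval_def mono_val_def by simp
qed

lemma vars_add: "vars (p + q) \<subseteq> vars p \<union> vars q"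
  unfolding vars_def using Poly_Mapping.keys_add[of p q] by blast

lemma vars_mult: "vars (p * q) \<subseteq> vars p \<union> vars q"
proof
  fix v assume "v \<in> vars (p * q)"
  then obtain m where m: "m \<in> keys (p * q)" "v \<in> keys m" by (auto simp: vars_def)
  then obtain a b where ab: "a \<in> keys p" "b \<in> keys q" "m = a + b"
    using keys_mult[of p q] by auto
  then have "v \<in> keys a \<or> v \<in> keys b"
    using m Poly_Mapping.keys_add[of a b] by auto
  then show "v \<in> vars p \<union> vars q" using ab by (auto simp: vars_def)
qed

lemma vars_uminus [simp]: "vars (- p) = vars p"
  by (auto simp: vars_def in_keys_iff)

lemma vars_Con [simp]: "vars (Con z) = {}"
  by (auto simp: vars_def Con_def)

lemma vars_Var [simp]: "vars (Var v) = {v}"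
  by (auto simp: vars_def Var_def)

lemma vars_0 [simp]: "vars 0 = {}" and vars_1 [simp]: "vars 1 = {}"
  by (auto simp: vars_def)

lemma vars_sum: "(\<And>x. x \<in> A \<Longrightarrow> vars (f x) \<subseteq> V) \<Longrightarrow> vars (sum f A) \<subseteq> V"
proof (induction A rule: infinite_finite_induct)
  case (insert x F) then show ?case using vars_add[of "f x" "sum f F"] by auto
qed auto

lemma vars_power: "vars (p ^ n) \<subseteq> vars p"
proof (induction n)
  case (Suc n) then show ?case using vars_mult[of p "p ^ n"] by auto
qed simp

lemma pval_closed:
  assumes "0 \<in> R" "1 \<in> R" "\<And>x y. x \<in> R \<Longrightarrow> y \<in> R \<Longrightarrow> x + y \<in> R"
    "\<And>x y. x \<in> R \<Longrightarrow> y \<in> R \<Longrightarrow> x * y \<in> R" "\<And>z. c z \<in> R" "\<And>v. v \<in> vars p \<Longrightarrow> \<phi> v \<in> R"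
  shows "pval c \<phi> p \<in> R"
proof -
  have pow: "x ^ n \<in> R" if "x \<in> R" for x n using that by (induction n) (auto intro: assms)
  have prod: "prod f A \<in> R" if "\<And>x. x \<in> A \<Longrightarrow> f x \<in> R" for f and A :: "'b set"
    using that by (induction A rule: infinite_finite_induct) (auto intro: assms)
  have sum: "sum f A \<in> R" if "\<And>x. x \<in> A \<Longrightarrow> f x \<in> R" for f and A :: "('b \<Rightarrow>\<^sub>0 nat) set"
    using that by (induction A rule: infinite_finite_induct) (auto intro: assms)
  have "mono_val \<phi> m \<in> R" if "m \<in> keys p" for m
    unfolding mono_val_def using that by (intro prod pow assms(6)) (auto simp: vars_def)
  then show ?thesis unfolding pval_def by (intro sum assms(4,5))
qed

lemma vars_subst:
  assumes "\<And>v. v \<in> vars p \<Longrightarrow> vars (\<phi> v) \<subseteq> V"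
  shows "vars (pval Con \<phi> p) \<subseteq> V"
proof -
  have "pval Con \<phi> p \<in> {q. vars q \<subseteq> V}"
  proof (rule pval_closed)
    fix x y :: "'b cpoly" assume "x \<in> {q. vars q \<subseteq> V}" "y \<in> {q. vars q \<subseteq> V}"
    then show "x + y \<in> {q. vars q \<subseteq> V}" "x * y \<in> {q. vars q \<subseteq> V}"
      using vars_add[of x y] vars_mult[of x y] by auto
  qed (use assms in auto)
  then show ?thesis by simp
qed

lemma vars_empty_Con: "vars p = {} \<Longrightarrow> p = Con (lookup p 0)"
proof -
  assume "vars p = {}"
  then have "keys p \<subseteq> {0}" by (auto simp: vars_def)
  then show ?thesis
    by (intro poly_mapping_eqI) (auto simp: Con_def lookup_single when_def in_keys_iff)
qed

lemma Con_eq_0_iff [simp]: "Con z = 0 \<longleftrightarrow> z = 0"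
  by (metis Con_def inj_single injD single_zero)

lemma Con_eq_iff [simp]: "Con y = Con z \<longleftrightarrow> y = z"
  by (metis Con_def lookup_single_eq)

lemma Con_dvd_1: "z \<noteq> 0 \<Longrightarrow> Con z dvd 1"
  by (rule dvdI[of _ _ "Con (1 / z)"]) (simp add: ring_hom_funD(4)[OF ring_hom_Con, symmetric] ring_hom_funD(2)[OF ring_hom_Con])

section \<open>Renaming of variables\<close>

definition rename :: "('v \<Rightarrow> 'w) \<Rightarrow> 'v cpoly \<Rightarrow> 'w cpoly" where
  "rename e = pval Con (\<lambda>v. Var (e v))"

lemma ring_hom_rename: "ring_hom_fun (rename e)"
  unfolding rename_def by (intro ring_hom_pval ring_hom_Con)

lemma rename_rename: "rename f (rename e p) = rename (\<lambda>v. f (e v)) p"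
  by (rule hom_eqI[OF ring_hom_fun_comp[OF ring_hom_rename ring_hom_rename] ring_hom_rename])
    (simp_all add: rename_def ring_hom_Con ring_hom_funD)

lemma rename_cong_id: "(\<And>v. v \<in> vars p \<Longrightarrow> e v = v) \<Longrightarrow> rename e p = p"
  unfolding rename_def using pval_cong[of p "\<lambda>v. Var (e v)" Var Con] by simp

lemma rename_inv: "inj e \<Longrightarrow> rename (inv_into UNIV e) (rename e p) = p"
  by (simp add: rename_rename rename_cong_id)

lemma rename_eq_0_iff: "inj e \<Longrightarrow> rename e p = 0 \<longleftrightarrow> p = 0"
  using rename_inv[of e p] by (auto simp: ring_hom_funD[OF ring_hom_rename])

lemma rename_surj_on:
  assumes "inj e" "vars q \<subseteq> range e"
  shows "rename e (rename (inv_into UNIV e) q) = q"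
  using assms by (auto simp: rename_rename f_inv_into_f intro!: rename_cong_id)

lemma vars_rename: "vars (rename e p) \<subseteq> range e"
  unfolding rename_def by (rule vars_subst) auto

text \<open>Polynomials form a domain when the exponent vectors carry a compatible linear order, as
  they do for variables numbered by \<open>nat\<close>: leading terms cannot cancel.  Renaming carries this over
  to every countable type of variables, in particular to the pairs of a site and a coordinate.\<close>

lemma cpoly_no_zero_divisors:
  fixes p q :: "'v::countable cpoly"
  assumes "p * q = 0" shows "p = 0 \<or> q = 0"
proof -
  have "rename to_nat p * rename to_nat q = 0"
    using assms by (simp flip: ring_hom_funD(4)[OF ring_hom_rename] add: ring_hom_funD(1)[OF ring_hom_rename])
  then show ?thesis by (simp add: rename_eq_0_iff)
qed

lemma cpoly_mult_left_cancel:
  fixes p q r :: "'v::countable cpoly"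
  assumes "p \<noteq> 0" "p * q = p * r" shows "q = r"
proof -
  have "p * (q - r) = 0" using assms by (simp add: algebra_simps)
  then show ?thesis using assms(1) cpoly_no_zero_divisors by fastforce
qed

section \<open>Gradings\<close>

definition weight :: "('v \<Rightarrow> nat) \<Rightarrow> ('v \<Rightarrow>\<^sub>0 nat) \<Rightarrow> nat" where
  "weight w m = (\<Sum>v\<in>keys m. w v * lookup m v)"

text \<open>The variable \<open>v\<close> goes to \<open>X\<^sub>v t\<^bsup>w v\<^esup>\<close>, so the coefficient of \<open>t\<^bsup>d\<^esup>\<close> is the part of
  weight \<open>d\<close>.  Variables are numbered along the way because the target has to be a domain.\<close>

definition grade :: "('v::countable \<Rightarrow> nat) \<Rightarrow> 'v cpoly \<Rightarrow> nat cpoly poly" where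
  "grade w = pval (\<lambda>z. [:Con z:]) (\<lambda>v. monom (Var (to_nat v)) (w v))"

lemma ring_hom_poly_Con: "ring_hom_fun (\<lambda>z. [:Con z :: 'v cpoly:])"
  using ring_hom_Con[where 'v='v] by (simp add: ring_hom_fun_def)

lemma ring_hom_grade: "ring_hom_fun (grade w)"
  unfolding grade_def by (intro ring_hom_pval ring_hom_poly_Con)

lemma mono_val_monom:
  "mono_val (\<lambda>v. monom (f v) (w v)) m = monom (mono_val f m) (weight w m)"
proof -
  have "(\<Prod>v\<in>A. monom (f v) (w v) ^ g v) = monom (\<Prod>v\<in>A. f v ^ g v) (\<Sum>v\<in>A. w v * g v)"
    if "finite A" for A g
    using that by (induction A) (auto simp: monom_power mult_monom mult.commute one_pCons monom_0)
  then show ?thesis by (simp add: mono_val_def weight_def)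
qed

definition component :: "('v \<Rightarrow> nat) \<Rightarrow> nat \<Rightarrow> 'v cpoly \<Rightarrow> 'v cpoly" where
  "component w d p = (\<Sum>m\<in>{m \<in> keys p. weight w m = d}. single m (lookup p m))"

lemma lookup_component: "lookup (component w d p) m = (if weight w m = d then lookup p m else 0)"
proof -
  have "lookup (component w d p) m
      = (\<Sum>n\<in>{n \<in> keys p. weight w n = d}. if n = m then lookup p m else 0)"
    unfolding component_def lookup_sum by (intro sum.cong) (auto simp: lookup_single when_def)
  also have "\<dots> = (if weight w m = d then lookup p m else 0)"
    by (subst sum.delta) (auto simp: in_keys_iff)
  finally show ?thesis .
qed

lemma coeff_grade: "coeff (grade w p) d = rename to_nat (component w d p)"
proof -
  have "coeff (grade w p) d = (\<Sum>m\<in>keys p. if weight w m = d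
      then Con (lookup p m) * mono_val (\<lambda>v. Var (to_nat v)) m else 0)"
    unfolding grade_def pval_def mono_val_monom by (simp add: coeff_sum smult_monom if_distrib cong: if_cong)
  also have "\<dots> = (\<Sum>m\<in>{m \<in> keys p. weight w m = d}.
      Con (lookup p m) * mono_val (\<lambda>v. Var (to_nat v)) m)"
    by (subst sum.inter_filter) auto
  also have "\<dots> = rename to_nat (component w d p)"
    by (simp add: rename_def component_def pval_sum ring_hom_Con ring_hom_funD)
  finally show ?thesis .
qed

lemma coeff_grade_eq_0_iff: "coeff (grade w p) d = 0 \<longleftrightarrow> (\<forall>m\<in>keys p. weight w m \<noteq> d)"
proof -
  have "component w d p = 0 \<longleftrightarrow> (\<forall>m. weight w m = d \<longrightarrow> lookup p m = 0)"
    by (auto simp: poly_mapping_eq_iff fun_eq_iff lookup_component)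
  then show ?thesis by (auto simp: coeff_grade rename_eq_0_iff in_keys_iff)
qed

lemma grade_eq_0_iff: "grade w p = 0 \<longleftrightarrow> p = 0"
proof
  assume "grade w p = 0"
  then have "\<forall>m\<in>keys p. weight w m \<noteq> d" for d using coeff_grade_eq_0_iff[of w p d] by simp
  then have "keys p = {}" by blast
  then show "p = 0" by simp
qed (simp add: ring_hom_funD[OF ring_hom_grade])

definition homogeneous :: "('v \<Rightarrow> nat) \<Rightarrow> nat \<Rightarrow> 'v cpoly \<Rightarrow> bool" where
  "homogeneous w d p \<longleftrightarrow> (\<forall>m\<in>keys p. weight w m = d)"

lemma homogeneous_grade: "homogeneous w d p \<longleftrightarrow> (\<forall>i. i \<noteq> d \<longrightarrow> coeff (grade w p) i = 0)"
  unfolding homogeneous_def coeff_grade_eq_0_iff by auto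

text \<open>After grading, the product is a single power of \<open>t\<close>.  In a domain the lowest and the
  highest terms of the factors multiply to the lowest and the highest term of the product, so in
  each factor they coincide.\<close>

lemma homogeneous_factor:
  fixes p q :: "'v::countable cpoly"
  assumes "homogeneous w d (p * q)" "p * q \<noteq> 0"
  shows "\<exists>d1 d2. d1 + d2 = d \<and> homogeneous w d1 p \<and> homogeneous w d2 q"
proof -
  define f g where "f = grade w p" and "g = grade w q"
  have fg: "f * g = grade w (p * q)" by (simp add: f_def g_def ring_hom_funD(4)[OF ring_hom_grade])
  have nz: "f \<noteq> 0" "g \<noteq> 0" using assms(2) by (auto simp: f_def g_def grade_eq_0_iff)
  \<comment> \<open>Lowest terms; \<open>degree f\<close> and \<open>degree g\<close> give the highest ones.\<close>
  define k l where "k = (LEAST i. coeff f i \<noteq> 0)" and "l = (LEAST i. coeff g i \<noteq> 0)"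
  have ex: "\<exists>i. coeff f i \<noteq> 0" "\<exists>i. coeff g i \<noteq> 0" using nz by (auto simp: poly_eq_iff)
  have k: "coeff f k \<noteq> 0" "\<And>i. i < k \<Longrightarrow> coeff f i = 0"
    unfolding k_def using LeastI_ex[OF ex(1)] not_less_Least by blast+
  have l: "coeff g l \<noteq> 0" "\<And>i. i < l \<Longrightarrow> coeff g i = 0"
    unfolding l_def using LeastI_ex[OF ex(2)] not_less_Least by blast+
  have "coeff (f * g) (k + l) = (\<Sum>i\<le>k + l. coeff f i * coeff g (k + l - i))" by (rule coeff_mult)
  also have "\<dots> = (\<Sum>i\<le>k + l. if i = k then coeff f k * coeff g l else 0)"
  proof (rule sum.cong[OF refl])
    fix i assume "i \<in> {..k + l}"
    then have "k < i \<Longrightarrow> k + l - i < l" by auto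
    then     show "coeff f i * coeff g (k + l - i) = (if i = k then coeff f k * coeff g l else 0)"
      using k(2)[of i] l(2)[of "k + l - i"] by (cases i k rule: linorder_cases) simp_all
  qed
  also have "\<dots> = coeff f k * coeff g l" by simp
  finally have "coeff (f * g) (k + l) \<noteq> 0" using k l by simp
  then have "k + l = d" using assms(1) unfolding fg homogeneous_grade by blast
  moreover have "coeff (f * g) (degree f + degree g) \<noteq> 0" using nz by (simp add: coeff_mult_degree_sum)
  then have "degree f + degree g = d" using assms(1) unfolding fg homogeneous_grade by blast
  moreover have "k \<le> degree f" "l \<le> degree g" using k(1) l(1) by (simp_all add: le_degree)
  ultimately have "k = degree f" "l = degree g" "k + l = d" by linarith+
  then have "coeff f i = 0" if "i \<noteq> k" for i using k(2)[of i] that coeff_eq_0[of f i] by (cases "i < k") auto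
  moreover have "coeff g i = 0" if "i \<noteq> l" for i
    using l(2)[of i] that coeff_eq_0[of g i] \<open>l = degree g\<close> by (cases "i < l") auto
  ultimately show ?thesis using \<open>k + l = d\<close> unfolding homogeneous_grade f_def g_def by blast
qed

lemma homogeneous_add: "homogeneous w d p \<Longrightarrow> homogeneous w d q \<Longrightarrow> homogeneous w d (p + q)"
  unfolding homogeneous_def using Poly_Mapping.keys_add[of p q] by blast

lemma homogeneous_0 [simp]: "homogeneous w d 0"
  by (simp add: homogeneous_def)

lemma weight_add: "weight w (m + n) = weight w m + weight w n"
proof -
  let ?A = "keys m \<union> keys n"
  have *: "weight w x = (\<Sum>v\<in>?A. w v * lookup x v)" if "keys x \<subseteq> ?A" for x
    unfolding weight_def using that by (intro sum.mono_neutral_left) (auto simp: in_keys_iff)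
  show ?thesis
    using Poly_Mapping.keys_add[of m n] by (simp add: * lookup_add sum.distrib algebra_simps)
qed

lemma homogeneous_mult: "homogeneous w d p \<Longrightarrow> homogeneous w e q \<Longrightarrow> homogeneous w (d + e) (p * q)"
  unfolding homogeneous_def using keys_mult[of p q] by (force simp: weight_add)

lemma homogeneous_Con [simp]: "homogeneous w 0 (Con z)"
  by (auto simp: homogeneous_def Con_def weight_def)

lemma homogeneous_1 [simp]: "homogeneous w 0 1"
  by (auto simp: homogeneous_def weight_def)

lemma homogeneous_uminus [simp]: "homogeneous w d (- p) \<longleftrightarrow> homogeneous w d p"
  by (auto simp: homogeneous_def in_keys_iff)

lemma homogeneous_Var [simp]: "homogeneous w (w v) (Var v)"
  by (auto simp: homogeneous_def Var_def weight_def)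

lemma homogeneous_sum: "(\<And>x. x \<in> A \<Longrightarrow> homogeneous w d (f x)) \<Longrightarrow> homogeneous w d (sum f A)"
  by (induction A rule: infinite_finite_induct) (auto simp: homogeneous_add)

lemma homogeneous_prod:
  "(\<And>x. x \<in> A \<Longrightarrow> homogeneous w (d x) (f x)) \<Longrightarrow> homogeneous w (sum d A) (prod f A)"
  by (induction A rule: infinite_finite_induct) (auto simp: homogeneous_mult)

lemma homogeneous_power: "homogeneous w d p \<Longrightarrow> homogeneous w (n * d) (p ^ n)"
  by (induction n) (auto simp: homogeneous_mult)

lemma homogeneous_subst:
  assumes "\<And>v. v \<in> vars p \<Longrightarrow> homogeneous w (D v) (\<phi> v)" "homogeneous D d p"
  shows "homogeneous w d (pval Con \<phi> p)"
  unfolding pval_def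
proof (rule homogeneous_sum)
  fix m assume m: "m \<in> keys p"
  have "homogeneous w (\<Sum>v\<in>keys m. lookup m v * D v) (mono_val \<phi> m)"
    unfolding mono_val_def using m by (intro homogeneous_prod homogeneous_power assms(1)) (auto simp: vars_def)
  moreover have "(\<Sum>v\<in>keys m. lookup m v * D v) = d"
    using assms(2) m by (auto simp: homogeneous_def weight_def mult.commute)
  ultimately show "homogeneous w d (Con (lookup p m) * mono_val \<phi> m)"
    using homogeneous_mult[OF homogeneous_Con] by fastforce
qed

definition tdeg :: "'v::countable cpoly \<Rightarrow> nat" where "tdeg p = degree (grade (\<lambda>_. 1) p)"

lemma tdeg_mult: "p \<noteq> 0 \<Longrightarrow> q \<noteq> 0 \<Longrightarrow> tdeg (p * q) = tdeg p + tdeg q"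
  by (simp add: tdeg_def ring_hom_funD(4)[OF ring_hom_grade] degree_mult_eq grade_eq_0_iff)

lemma weight_le_tdeg: "m \<in> keys p \<Longrightarrow> weight (\<lambda>_. 1) m \<le> tdeg p"
  unfolding tdeg_def using coeff_grade_eq_0_iff by (intro le_degree) blast

lemma tdeg_le_iff: "tdeg p \<le> n \<longleftrightarrow> (\<forall>m\<in>keys p. weight (\<lambda>_. 1) m \<le> n)"
proof
  assume *: "\<forall>m\<in>keys p. weight (\<lambda>_. 1) m \<le> n"
  show "tdeg p \<le> n" unfolding tdeg_def
    by (rule degree_le) (use * in \<open>auto simp: coeff_grade_eq_0_iff\<close>)
qed (use weight_le_tdeg le_trans in blast)

lemma tdeg_add_le: "tdeg p \<le> n \<Longrightarrow> tdeg q \<le> n \<Longrightarrow> tdeg (p + q) \<le> n"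
  unfolding tdeg_def by (simp add: ring_hom_funD(3)[OF ring_hom_grade] degree_add_le)

lemma tdeg_mult_le: "tdeg p \<le> n \<Longrightarrow> tdeg q \<le> k \<Longrightarrow> tdeg (p * q) \<le> n + k"
  unfolding tdeg_def ring_hom_funD(4)[OF ring_hom_grade] 
  by (rule order_trans[OF degree_mult_le]) simp

lemma tdeg_0 [simp]: "tdeg 0 = 0" and tdeg_1 [simp]: "tdeg 1 = 0"
  by (simp_all add: tdeg_def ring_hom_funD(1,2)[OF ring_hom_grade])

lemma tdeg_uminus [simp]: "tdeg (- p) = tdeg p"
proof -
  have "keys (- p) = keys p" by (auto simp: in_keys_iff)
  then show ?thesis using tdeg_le_iff[of p] tdeg_le_iff[of "- p"] by (metis le_antisym le_refl)
qed

lemma tdeg_Var [simp]: "tdeg (Var v) = 1"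
proof -
  have "Var (to_nat v) \<noteq> (0 :: nat cpoly)" by (metis Var_def lookup_single_eq lookup_zero zero_neq_one)
  then show ?thesis by (simp add: tdeg_def grade_def ring_hom_poly_Con degree_monom_eq)
qed

lemma tdeg_sum_le: "(\<And>x. x \<in> A \<Longrightarrow> tdeg (f x) \<le> n) \<Longrightarrow> tdeg (sum f A) \<le> n"
  by (induction A rule: infinite_finite_induct) (auto simp: tdeg_add_le)

lemma tdeg_prod_le: "(\<And>x. x \<in> A \<Longrightarrow> tdeg (f x) \<le> n) \<Longrightarrow> tdeg (prod f A) \<le> card A * n"
  by (induction A rule: infinite_finite_induct) (auto simp: tdeg_mult_le)

lemma weight_eq_0_iff: "weight (\<lambda>_. 1) m = 0 \<longleftrightarrow> m = 0"
  unfolding weight_def by (auto simp: in_keys_iff poly_mapping_eq_iff fun_eq_iff)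

lemma tdeg_0_Con: "tdeg p = 0 \<Longrightarrow> p = Con (lookup p 0)"
proof -
  assume "tdeg p = 0"
  then have "m = 0" if "m \<in> keys p" for m
    using weight_le_tdeg[OF that] by (metis le_zero_eq weight_eq_0_iff)
  then show ?thesis by (intro vars_empty_Con) (auto simp: vars_def)
qed

lemma tdeg_0_dvd_1: "tdeg p = 0 \<Longrightarrow> p \<noteq> 0 \<Longrightarrow> p dvd 1"
  using tdeg_0_Con[of p] Con_dvd_1 by (metis Con_eq_0_iff)

lemma dvd_1_tdeg_0: "p dvd 1 \<Longrightarrow> tdeg p = 0"
proof -
  assume "p dvd 1"
  then obtain q where q: "1 = p * q" by (auto elim: dvdE)
  then have "p \<noteq> 0" "q \<noteq> 0" by auto
  then show ?thesis using tdeg_mult[of p q] q by simp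
qed

text \<open>Give weight one to the variable in question and weight zero to all others: if the
  product has weight zero then so have its factors.\<close>

lemma vars_factor:
  fixes p q :: "'v::countable cpoly"
  assumes "p * q \<noteq> 0" shows "vars p \<subseteq> vars (p * q)"
proof
  fix v assume v: "v \<in> vars p"
  show "v \<in> vars (p * q)"
  proof (rule ccontr)
    assume nv: "v \<notin> vars (p * q)"
    let ?w = "\<lambda>u. if u = v then 1 else 0"
    have "homogeneous ?w 0 (p * q)" using nv by (auto simp: homogeneous_def weight_def vars_def)
    then have "homogeneous ?w 0 p" using homogeneous_factor[OF _ assms] by fastforce
    moreover obtain m where m: "m \<in> keys p" "v \<in> keys m" using v by (auto simp: vars_def)
    ultimately have "weight ?w m = 0" by (simp add: homogeneous_def)
    then have "?w v * lookup m v = 0" unfolding weight_def using m(2) by (subst (asm) sum_eq_0_iff) auto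
    then show False using m(2) by (simp add: in_keys_iff)
  qed
qed

section \<open>Unique factorisation\<close>

text \<open>A polynomial regarded as a univariate polynomial in the variable number \<open>n\<close>, with
  coefficients that are polynomials in the remaining variables.\<close>

definition sepv :: "nat \<Rightarrow> nat cpoly \<Rightarrow> nat cpoly poly" where
  "sepv n = pval (\<lambda>z. [:Con z:]) (\<lambda>v. if v = n then [:0, 1:] else [:Var v:])"

lemma ring_hom_sepv: "ring_hom_fun (sepv n)"
  unfolding sepv_def by (intro ring_hom_pval ring_hom_poly_Con)

lemma poly_sepv: "poly (sepv n p) (Var n) = p"
proof -
  have "ring_hom_fun (\<lambda>f. poly f (Var n :: nat cpoly))" by (simp add: ring_hom_fun_def)
  from hom_eqI[OF ring_hom_fun_comp[OF this ring_hom_sepv] ring_hom_fun_id]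
  show ?thesis by (simp add: sepv_def ring_hom_poly_Con)
qed

lemma sepv_eq_0_iff: "sepv n p = 0 \<longleftrightarrow> p = 0"
  using poly_sepv[of n p] by (auto simp: ring_hom_funD[OF ring_hom_sepv])

lemma vars_coeff_sepv: "vars (coeff (sepv n p) i) \<subseteq> vars p - {n}"
proof -
  let ?R = "{f. \<forall>i. vars (coeff f i) \<subseteq> vars p - {n}}"
  have "sepv n p \<in> ?R" unfolding sepv_def
  proof (rule pval_closed)
    fix f g :: "nat cpoly poly" assume *: "f \<in> ?R" "g \<in> ?R"
    then show "f + g \<in> ?R" using vars_add by fastforce
    have "vars (coeff f j * coeff g k) \<subseteq> vars p - {n}" for j k
      using vars_mult[of "coeff f j" "coeff g k"] * by blast
    then show "f * g \<in> ?R" by (auto simp: coeff_mult intro!: vars_sum)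
  next
    fix v assume "v \<in> vars p"
    then show "(if v = n then [:0, 1:] else [:Var v:]) \<in> ?R"
      by (auto simp: coeff_pCons split: nat.splits if_splits)
  qed (auto simp: coeff_pCons split: nat.splits)
  then show ?thesis by auto
qed

lemma sepv_const: "n \<notin> vars p \<Longrightarrow> sepv n p = [:p:]"
proof -
  assume n: "n \<notin> vars p"
  have *: "ring_hom_fun (\<lambda>a :: nat cpoly. [:a:])" by (simp add: ring_hom_fun_def one_pCons)
  have "sepv n p = pval (\<lambda>z. [:Con z:]) (\<lambda>v. [:Var v:]) p"
    unfolding sepv_def using n by (intro pval_cong) auto
  also have "\<dots> = [:p:]" using hom_pval[OF *, of Con Var p] by simp
  finally show ?thesis .
qed

definition pols_below :: "nat \<Rightarrow> nat cpoly set" where "pols_below n = {p. vars p \<subseteq> {..<n}}"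

definition vdeg :: "nat \<Rightarrow> nat cpoly \<Rightarrow> nat" where "vdeg n p = degree (sepv n p)"

lemma pols_below_closed:
  assumes "p \<in> pols_below n" "q \<in> pols_below n"
  shows "p + q \<in> pols_below n" "p * q \<in> pols_below n" "p - q \<in> pols_below n" "p ^ k \<in> pols_below n"
  using assms vars_add[of p q] vars_mult[of p q] vars_add[of p "- q"] vars_power[of p k]
  by (auto simp: pols_below_def)

lemma pols_below_factor: "p * q \<in> pols_below n \<Longrightarrow> p * q \<noteq> 0 \<Longrightarrow> p \<in> pols_below n"
  "p * q \<in> pols_below n \<Longrightarrow> p * q \<noteq> 0 \<Longrightarrow> q \<in> pols_below n"
  using vars_factor[of p q] vars_factor[of q p] by (auto simp: pols_below_def mult.commute)

lemma pols_below_Suc: "p \<in> pols_below n \<Longrightarrow> p \<in> pols_below (Suc n)"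
  by (auto simp: pols_below_def)

lemma coeff_sepv_below: "p \<in> pols_below (Suc n) \<Longrightarrow> coeff (sepv n p) i \<in> pols_below n"
proof -
  have "{..<Suc n} - {n} = {..<n}" by auto
  then show "p \<in> pols_below (Suc n) \<Longrightarrow> ?thesis"
    using vars_coeff_sepv[of n p i] unfolding pols_below_def mem_Collect_eq by blast
qed

lemma vdeg_0_below: "p \<in> pols_below (Suc n) \<Longrightarrow> vdeg n p = 0 \<Longrightarrow> p \<in> pols_below n"
proof -
  assume p: "p \<in> pols_below (Suc n)" "vdeg n p = 0"
  then obtain a where a: "sepv n p = [:a:]" unfolding vdeg_def by (auto elim: degree_eq_zeroE)
  then have "p = a" using poly_sepv[of n p] by simp
  then show ?thesis using coeff_sepv_below[OF p(1), of 0] a by simp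
qed

lemma vdeg_below: "p \<in> pols_below n \<Longrightarrow> vdeg n p = 0"
  by (auto simp: vdeg_def pols_below_def intro: sepv_const[THEN arg_cong[where f=degree], THEN trans])

lemma vdeg_mult: "p \<noteq> 0 \<Longrightarrow> q \<noteq> 0 \<Longrightarrow> vdeg n (p * q) = vdeg n p + vdeg n q"
  by (simp add: vdeg_def ring_hom_funD[OF ring_hom_sepv] degree_mult_eq sepv_eq_0_iff)

lemma below_dvd_iff:
  assumes "c \<in> pols_below n" shows "c dvd p \<longleftrightarrow> (\<forall>i. c dvd coeff (sepv n p) i)"
proof -
  have c: "sepv n c = [:c:]" using assms by (intro sepv_const) (auto simp: pols_below_def)
  have "c dvd p \<longleftrightarrow> [:c:] dvd sepv n p"
  proof
    assume "c dvd p"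
    then obtain q where "p = c * q" by (auto elim: dvdE)
    then show "[:c:] dvd sepv n p" by (intro dvdI[of _ _ "sepv n q"]) (simp add: ring_hom_funD[OF ring_hom_sepv] c)
  next
    assume "[:c:] dvd sepv n p"
    then obtain f where "sepv n p = [:c:] * f" by (auto elim: dvdE)
    then have "p = c * poly f (Var n)" using poly_sepv[of n p] by simp
    then show "c dvd p" by simp
  qed
  then show ?thesis by (simp add: const_poly_dvd_iff)
qed

lemma irreducible_divisor_exists:
  fixes u :: "'v::countable cpoly"
  assumes "u \<noteq> 0" "\<not> u dvd 1"
  shows "\<exists>q r. irreducible q \<and> u = q * r \<and> tdeg r < tdeg u"
  using assms
proof (induction "tdeg u" arbitrary: u rule: less_induct)
  case less
  have pos: "0 < tdeg x" if "x \<noteq> 0" "\<not> x dvd 1" for x :: "'v cpoly" using that tdeg_0_dvd_1[of x] by auto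
  show ?case
  proof (cases "irreducible u")
    case True
    then show ?thesis using pos[OF less.prems] by (intro exI[of _ u] exI[of _ 1]) auto
  next
    case False
    then obtain a b where ab: "u = a * b" "\<not> a dvd 1" "\<not> b dvd 1" using less.prems by (auto simp: irreducible_def)
    then have nz: "a \<noteq> 0" "b \<noteq> 0" using less.prems by auto
    then have lt: "tdeg a < tdeg u" using pos[of b] ab tdeg_mult[of a b] by auto
    obtain q r where qr: "irreducible q" "a = q * r" "tdeg r < tdeg a" using less.hyps[OF lt nz(1) ab(2)] by blast
    then have "r \<noteq> 0" using nz by auto
    then have "u = q * (r * b)" "tdeg (r * b) < tdeg u"
      using qr ab nz tdeg_mult[of r b] tdeg_mult[of a b] by (auto simp: mult.assoc)
    then show ?thesis using qr(1) by blast
  qed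
qed

text \<open>Primality is restricted to polynomials in the first \<open>n\<close> variables because the induction on
  \<open>n\<close> adds the variables one at a time.\<close>

definition primes_below :: "nat \<Rightarrow> bool" where
  "primes_below n \<longleftrightarrow> (\<forall>p f g. irreducible p \<longrightarrow> p \<in> pols_below n \<longrightarrow> f \<in> pols_below n \<longrightarrow> g \<in> pols_below n \<longrightarrow>
     p dvd f * g \<longrightarrow> p dvd f \<or> p dvd g)"

text \<open>Gauss's lemma: if \<open>p\<close>, free of the new variable, divides neither \<open>f\<close> nor \<open>g\<close>, take the
  lowest coefficients of \<open>f\<close> and \<open>g\<close> that it does not divide.  All other terms of the corresponding
  coefficient of \<open>f * g\<close> are divisible by \<open>p\<close>.\<close>

lemma below_prime_lift:
  assumes "primes_below n" "irreducible p" "p \<in> pols_below n"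
    "f \<in> pols_below (Suc n)" "g \<in> pols_below (Suc n)" "p dvd f * g"
  shows "p dvd f \<or> p dvd g"
proof (rule ccontr)
  assume "\<not> ?thesis"
  then have ex: "\<exists>i. \<not> p dvd coeff (sepv n f) i" "\<exists>i. \<not> p dvd coeff (sepv n g) i"
    using below_dvd_iff[OF assms(3), of f] below_dvd_iff[OF assms(3), of g] by blast+
  define i where "i = (LEAST i. \<not> p dvd coeff (sepv n f) i)"
  define j where "j = (LEAST i. \<not> p dvd coeff (sepv n g) i)"
  have i: "\<not> p dvd coeff (sepv n f) i" "\<And>k. k < i \<Longrightarrow> p dvd coeff (sepv n f) k"
    unfolding i_def using LeastI_ex[OF ex(1)] not_less_Least by blast+
  have j: "\<not> p dvd coeff (sepv n g) j" "\<And>k. k < j \<Longrightarrow> p dvd coeff (sepv n g) k"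
    unfolding j_def using LeastI_ex[OF ex(2)] not_less_Least by blast+
  let ?t = "\<lambda>k. coeff (sepv n f) k * coeff (sepv n g) (i + j - k)"
  have "p dvd coeff (sepv n f * sepv n g) (i + j)"
    using assms(6) below_dvd_iff[OF assms(3), of "f * g"] ring_hom_funD(4)[OF ring_hom_sepv, of n f g] by metis
  then have "p dvd (\<Sum>k\<le>i + j. ?t k)" by (simp add: coeff_mult)
  also have "(\<Sum>k\<le>i + j. ?t k) = ?t i + (\<Sum>k\<in>{..i + j} - {i}. ?t k)"
    by (rule sum.remove) auto
  finally have "p dvd ?t i + (\<Sum>k\<in>{..i + j} - {i}. ?t k)" .
  moreover have "p dvd (\<Sum>k\<in>{..i + j} - {i}. ?t k)"
  proof (rule dvd_sum)
    fix k assume k: "k \<in> {..i + j} - {i}"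
    show "p dvd ?t k"
    proof (cases "k < i")
      case True then show ?thesis using i(2) by simp
    next
      case False then have "i + j - k < j" using k by auto
      then show ?thesis using j(2) by simp
    qed
  qed
  ultimately have "p dvd coeff (sepv n f) i * coeff (sepv n g) j" by (simp add: dvd_add_left_iff)
  then show False using assms(1-5) i(1) j(1) coeff_sepv_below unfolding primes_below_def by blast
qed

text \<open>The prime factors of \<open>c\<close> stay prime in the larger ring and cannot divide \<open>p\<close>, which is
  irreducible and involves the new variable.  So they can be cancelled one by one.\<close>

lemma below_cancel:
  assumes "primes_below n" "irreducible p" "p \<in> pols_below (Suc n)" "0 < vdeg n p"
    "c \<in> pols_below n" "c \<noteq> 0" "h \<in> pols_below (Suc n)" "p dvd c * h"
  shows "p dvd h"
  using assms(5-8)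
proof (induction "tdeg c" arbitrary: c h rule: less_induct)
  case less
  show ?case
  proof (cases "c dvd 1")
    case True
    then obtain b where "1 = c * b" by (auto elim: dvdE)
    then have "h = (c * h) * b" by (metis mult.assoc mult.commute mult.right_neutral)
    then show ?thesis using less.prems(4) by (metis dvd_mult2)
  next
    case False
    obtain q r where qr: "irreducible q" "c = q * r" "tdeg r < tdeg c"
      using irreducible_divisor_exists[OF less.prems(2) False] by blast
    have r: "r \<noteq> 0" "r \<in> pols_below n" and q: "q \<in> pols_below n" "q \<noteq> 0"
      using less.prems qr pols_below_factor[of q r n] by auto
    show ?thesis
    proof (cases "h = 0")
      case False
      obtain k where k: "c * h = p * k" using less.prems by (auto elim: dvdE)
      then have "p * k \<in> pols_below (Suc n)" "p * k \<noteq> 0"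
        using less.prems False pols_below_closed(2)[of c "Suc n" h] pols_below_Suc by auto
      then have kb: "k \<in> pols_below (Suc n)" using pols_below_factor by blast
      have "q dvd p * k" using k qr(2) by (metis dvd_triv_left mult.assoc)
      then consider "q dvd p" | "q dvd k" using below_prime_lift[OF assms(1) qr(1) q(1) assms(3) kb] by blast
      then show ?thesis
      proof cases
        case 1
        then obtain u where u: "p = q * u" by (auto elim: dvdE)
        have "\<not> q dvd 1" using qr(1) by (simp add: irreducible_def)
        then have "u dvd 1" using u assms(2) by (auto simp: irreducible_def)
        then have "tdeg u = 0" by (rule dvd_1_tdeg_0)
        then have "u \<in> pols_below n" using tdeg_0_Con[of u] by (metis pols_below_def mem_Collect_eq vars_Con empty_subsetI)
        then have "p \<in> pols_below n" using u q pols_below_closed(2) by blast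
        then show ?thesis using vdeg_below assms(4) by simp
      next
        case 2
        then obtain k' where "k = q * k'" by (auto elim: dvdE)
        then have "q * (r * h) = q * (p * k')" using k qr(2) by (simp add: ac_simps)
        then have "p dvd r * h" using q(2) by simp
        then show ?thesis using less.hyps[OF qr(3) r(2,1) less.prems(3)] by blast
      qed
    qed simp
  qed
qed

text \<open>Again the prime factors of \<open>c\<close> are cancelled, each against \<open>r\<close> or against \<open>s\<close>.  What
  remains is a factorisation of the irreducible \<open>p\<close>.\<close>

lemma below_split:
  assumes "primes_below n" "irreducible p" "p \<in> pols_below (Suc n)" "0 < vdeg n p"
    "c \<in> pols_below n" "c \<noteq> 0" "r * s = c * p"
  shows "vdeg n r = 0 \<or> p dvd r"
  using assms(5-7)
proof (induction "tdeg c" arbitrary: c r s rule: less_induct)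
  case less
  have p0: "p \<noteq> 0" using assms(2) by auto
  have nz: "r \<noteq> 0" "s \<noteq> 0" using less.prems p0 by auto
  have "c * p \<in> pols_below (Suc n)" using less.prems assms(3) pols_below_closed(2) pols_below_Suc by blast
  then have rs: "r \<in> pols_below (Suc n)" "s \<in> pols_below (Suc n)"
    using less.prems nz p0 pols_below_factor[of r s "Suc n"] by auto
  show ?case
  proof (cases "c dvd 1")
    case True
    then obtain b where b: "1 = c * b" by (auto elim: dvdE)
    have "r * (s * b) = (r * s) * b" by (simp add: ac_simps)
    also have "\<dots> = (c * b) * p" using less.prems(3) by (simp add: ac_simps)
    finally have pr: "p = r * (s * b)" using b by simp
    then consider "r dvd 1" | "s * b dvd 1" using assms(2) unfolding irreducible_def by blast
    then show ?thesis
    proof cases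
      case 1
      then have "tdeg r = 0" by (rule dvd_1_tdeg_0)
      then have "r \<in> pols_below n" using tdeg_0_Con[of r] by (metis pols_below_def mem_Collect_eq vars_Con empty_subsetI)
      then show ?thesis using vdeg_below by simp
    next
      case 2
      then obtain e where "1 = (s * b) * e" unfolding dvd_def by blast
      then have "r = p * e" using pr by (metis mult.assoc mult.right_neutral)
      then show ?thesis by simp
    qed
  next
    case False
    obtain q c' where qr: "irreducible q" "c = q * c'" "tdeg c' < tdeg c"
      using irreducible_divisor_exists[OF less.prems(2) False] by blast
    have r: "c' \<noteq> 0" "c' \<in> pols_below n" and q: "q \<in> pols_below n" "q \<noteq> 0"
      using less.prems qr pols_below_factor[of q c' n] by auto
    have "q dvd r * s" using less.prems(3) qr(2) by (simp add: mult.assoc)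
    then consider "q dvd r" | "q dvd s" using below_prime_lift[OF assms(1) qr(1) q(1) rs] by blast
    then show ?thesis
    proof cases
      case 1
      then obtain r' where r': "r = q * r'" by (auto elim: dvdE)
      then have "q * (r' * s) = q * (c' * p)" using less.prems(3) qr(2) by (simp add: ac_simps)
      then have "r' * s = c' * p" using q(2) by simp
      from less.hyps[OF qr(3) r(2,1) this] have "vdeg n r' = 0 \<or> p dvd r'" .
      moreover have "vdeg n r = vdeg n r'" using r' nz q vdeg_mult[of q r' n] vdeg_below[of q n] by auto
      ultimately show ?thesis using r' by auto
    next
      case 2
      then obtain s' where "s = q * s'" by (auto elim: dvdE)
      then have "q * (r * s') = q * (c' * p)" using less.prems(3) qr(2) by (simp add: ac_simps)
      then have "r * s' = c' * p" using q(2) by simp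
      from less.hyps[OF qr(3) r(2,1) this] show ?thesis .
    qed
  qed
qed

lemma pseudo_remainder:
  assumes "u \<in> pols_below (Suc n)" "r \<in> pols_below (Suc n)" "r \<noteq> 0" "vdeg n r \<le> vdeg n u"
  defines "a \<equiv> lead_coeff (sepv n r)" and "b \<equiv> lead_coeff (sepv n u) * Var n ^ (vdeg n u - vdeg n r)"
  shows "a \<in> pols_below n" "a \<noteq> 0" "b \<in> pols_below (Suc n)" "a * u - b * r = 0 \<or> vdeg n (a * u - b * r) < vdeg n u"
proof -
  show a: "a \<in> pols_below n" "a \<noteq> 0" unfolding a_def using assms coeff_sepv_below by (auto simp: sepv_eq_0_iff)
  have l: "lead_coeff (sepv n u) \<in> pols_below n" using assms coeff_sepv_below by auto
  moreover have "Var n \<in> pols_below (Suc n)" by (simp add: pols_below_def)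
  ultimately show b: "b \<in> pols_below (Suc n)" unfolding b_def
    by (intro pols_below_closed(2,4)[of _ "Suc n"]) (auto intro: pols_below_Suc)
  let ?k = "vdeg n u - vdeg n r"
  let ?l = "lead_coeff (sepv n u)"
  have c: "sepv n x = [:x:]" if "x \<in> pols_below n" for x using that by (intro sepv_const) (auto simp: pols_below_def)
  have "sepv n (Var n) = monom 1 1" by (simp add: sepv_def ring_hom_poly_Con monom_altdef)
  then have sb: "sepv n b = monom ?l ?k"
    unfolding b_def by (simp add: ring_hom_funD[OF ring_hom_sepv] ring_hom_fun_power[OF ring_hom_sepv] c[OF l] monom_power smult_monom)
  let ?w = "sepv n (a * u - b * r)"
  have w: "?w = Polynomial.smult a (sepv n u) - monom ?l ?k * sepv n r"
    by (simp add: ring_hom_fun_diff[OF ring_hom_sepv] ring_hom_funD[OF ring_hom_sepv] sb c[OF a(1)])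
  have "degree (monom ?l ?k * sepv n r) \<le> degree (monom ?l ?k) + degree (sepv n r)" by (rule degree_mult_le)
  also have "\<dots> \<le> vdeg n u" using degree_monom_le[of ?l ?k] assms(4) by (simp add: vdeg_def)
  finally have "degree ?w \<le> vdeg n u" unfolding w
    by (intro degree_diff_le) (auto simp: vdeg_def intro: degree_smult_le)
  moreover have cm: "coeff (monom ?l ?k * sepv n r) (vdeg n u) = lead_coeff (sepv n r) * ?l"
    using assms(4) by (simp only: coeff_monom_mult) (simp add: vdeg_def)
  have "coeff ?w (vdeg n u) = 0"
    unfolding w coeff_diff cm by (simp add: a_def vdeg_def)
  ultimately have "?w = 0 \<or> degree ?w < vdeg n u"
    using le_neq_implies_less leading_coeff_0_iff by metis
  then show "a * u - b * r = 0 \<or> vdeg n (a * u - b * r) < vdeg n u" by (simp add: vdeg_def sepv_eq_0_iff)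
qed

text \<open>If \<open>p\<close> involves the new variable, let \<open>r\<close> be a nonzero combination of \<open>p\<close> and \<open>f\<close> of least
  degree in this variable.  By pseudo-division \<open>r\<close> divides \<open>p\<close> and \<open>f\<close> up to factors free of the new
  variable.  As \<open>p\<close> is irreducible, either \<open>p\<close> divides \<open>r\<close>, hence \<open>f\<close>, or \<open>r\<close> itself is free of the new
  variable, and then \<open>p\<close> divides \<open>r * g\<close>, hence \<open>g\<close>.\<close>

lemma primes_below_Suc:
  assumes P: "primes_below n" shows "primes_below (Suc n)"
  unfolding primes_below_def
proof (intro allI impI)
  fix p f g assume p: "irreducible p" "p \<in> pols_below (Suc n)"
    and fg: "f \<in> pols_below (Suc n)" "g \<in> pols_below (Suc n)" "p dvd f * g"
  show "p dvd f \<or> p dvd g"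
  proof (cases "vdeg n p = 0")
    case True
    then show ?thesis using below_prime_lift[OF P p(1) vdeg_0_below[OF p(2)] fg] by blast
  next
    case False
    then have pos: "0 < vdeg n p" by simp
    have p0: "p \<noteq> 0" using p(1) by auto
    \<comment> \<open>The ideal generated by \<open>p\<close> and \<open>f\<close> among the polynomials in \<open>n + 1\<close> variables.\<close>
    define I where "I = {u. \<exists>a\<in>pols_below (Suc n). \<exists>b\<in>pols_below (Suc n). u = a * p + b * f}"
    have one: "1 \<in> pols_below (Suc n)" and zero: "0 \<in> pols_below (Suc n)" by (auto simp: pols_below_def)
    have pI: "p \<in> I" unfolding I_def
      by (rule CollectI, rule bexI[OF _ one], rule bexI[OF _ zero], simp)
    have fI: "f \<in> I" unfolding I_def
      by (rule CollectI, rule bexI[OF _ zero], rule bexI[OF _ one], simp)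
    have I_below: "u \<in> pols_below (Suc n)" if "u \<in> I" for u
      using that p(2) fg(1) unfolding I_def by (auto intro!: pols_below_closed)
    have I_comb: "x * u - y * v \<in> I" if uv: "u \<in> I" "v \<in> I" and xy: "x \<in> pols_below (Suc n)" "y \<in> pols_below (Suc n)" for x y u v
    proof -
      obtain a b a' b' where *: "a \<in> pols_below (Suc n)" "b \<in> pols_below (Suc n)" "a' \<in> pols_below (Suc n)" "b' \<in> pols_below (Suc n)"
        and e: "u = a * p + b * f" "v = a' * p + b' * f" using uv unfolding I_def by auto
      have "x * u - y * v = (x * a - y * a') * p + (x * b - y * b') * f" unfolding e by (simp add: algebra_simps)
      moreover have "x * a - y * a' \<in> pols_below (Suc n)" "x * b - y * b' \<in> pols_below (Suc n)"
        using * xy by (simp_all add: pols_below_closed)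
      ultimately show ?thesis unfolding I_def by blast
    qed
    obtain r where r: "r \<in> I" "r \<noteq> 0" and min: "\<And>u. u \<in> I \<Longrightarrow> u \<noteq> 0 \<Longrightarrow> vdeg n r \<le> vdeg n u"
      using ex_has_least_nat[of "\<lambda>u. u \<in> I \<and> u \<noteq> 0" p "vdeg n"] pI p0 by blast
    have mult: "\<exists>c s. c \<in> pols_below n \<and> c \<noteq> 0 \<and> c * u = r * s" if "u \<in> I" for u
      using that
    proof (induction "vdeg n u" arbitrary: u rule: less_induct)
      case less
      show ?case
      proof (cases "u = 0")
        case True then show ?thesis by (intro exI[of _ 1] exI[of _ 0]) (auto simp: pols_below_def)
      next
        case False
        define a where "a = lead_coeff (sepv n r)"
        define b where "b = lead_coeff (sepv n u) * Var n ^ (vdeg n u - vdeg n r)"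
        note ps = pseudo_remainder[OF I_below[OF less.prems] I_below[OF r(1)] r(2) min[OF less.prems False],
            folded a_def b_def]
        let ?u = "a * u - b * r"
        have uI: "?u \<in> I" using I_comb[OF less.prems r(1)] ps pols_below_Suc by blast
        obtain c s where cs: "c \<in> pols_below n" "c \<noteq> 0" "c * ?u = r * s"
        proof (cases "?u = 0")
          case True then show ?thesis using that[of 1 0] by (auto simp: pols_below_def)
        next
          case False then show ?thesis using less.hyps[OF _ uI] ps(4) that by blast
        qed
        have "(c * a) * u = r * (s + c * b)" using cs(3) by (simp add: algebra_simps)
        then show ?thesis using cs ps pols_below_closed(2) by (intro exI[of _ "c * a"] exI[of _ "s + c * b"]) auto
      qed
    qed
    obtain c s where cs: "c \<in> pols_below n" "c \<noteq> 0" "c * p = r * s" using mult[OF pI] by blast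
    then have "vdeg n r = 0 \<or> p dvd r" using below_split[OF P p pos cs(1,2)] by metis
    then show ?thesis
    proof
      assume "p dvd r"
      moreover obtain d t where dt: "d \<in> pols_below n" "d \<noteq> 0" "d * f = r * t" using mult[OF fI] by blast
      ultimately have "p dvd d * f" by simp
      then show ?thesis using below_cancel[OF P p pos dt(1,2) fg(1)] by blast
    next
      assume "vdeg n r = 0"
      then have rb: "r \<in> pols_below n" using vdeg_0_below I_below r(1) by blast
      obtain a b where "r = a * p + b * f" using r(1) unfolding I_def by auto
      then have "r * g = (a * g) * p + b * (f * g)" by (simp add: algebra_simps)
      then have "p dvd r * g" using fg(3) by simp
      then show ?thesis using below_cancel[OF P p pos rb r(2) fg(2)] by blast
    qed
  qed
qed

lemma primes_below_all: "primes_below n"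
proof (induction n)
  case 0
  have False if "irreducible p" "p \<in> pols_below 0" for p
  proof -
    have "p = Con (lookup p 0)" using that(2) by (intro vars_empty_Con) (auto simp: pols_below_def)
    moreover have "p \<noteq> 0" using that(1) by auto
    ultimately have "p dvd 1" using Con_dvd_1 by (metis Con_eq_0_iff)
    then show False using that(1) by (simp add: irreducible_def)
  qed
  then show ?case by (auto simp: primes_below_def)
qed (rule primes_below_Suc)

lemma irreducible_imp_prime:
  fixes p f g :: "nat cpoly"
  assumes "irreducible p" "p dvd f * g" shows "p dvd f \<or> p dvd g"
proof -
  have "finite (vars p \<union> vars f \<union> vars g)" by simp
  then obtain n where "vars p \<union> vars f \<union> vars g \<subseteq> {..<n}" using finite_nat_iff_bounded by blast
  then show ?thesis using primes_below_all[of n] assms unfolding primes_below_def pols_below_def by blast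
qed

text \<open>Each prime factor of \<open>u\<close> misses some \<open>F j\<close>, hence divides \<open>w\<close>, and can be cancelled.\<close>

lemma coprime_family_dvd_nat:
  fixes F :: "'n \<Rightarrow> nat cpoly"
  assumes "\<And>g. (\<And>j. g dvd F j) \<Longrightarrow> g dvd 1" "u \<noteq> 0" "\<And>j. u dvd F j * w"
  shows "u dvd w"
  using assms(2,3)
proof (induction "tdeg u" arbitrary: u w rule: less_induct)
  case less
  show ?case
  proof (cases "u dvd 1")
    case True then show ?thesis using dvd_trans one_dvd by blast
  next
    case False
    obtain q r where qr: "irreducible q" "u = q * r" "tdeg r < tdeg u"
      using irreducible_divisor_exists[OF less.prems(1) False] by blast
    have "\<not> q dvd 1" "q \<noteq> 0" using qr(1) by (auto simp: irreducible_def)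
    then obtain j where "\<not> q dvd F j" using assms(1) by blast
    moreover have "q dvd F j * w" using less.prems(2)[of j] qr(2) dvd_mult_left by blast
    ultimately have "q dvd w" using irreducible_imp_prime[OF qr(1)] by blast
    then obtain w' where w': "w = q * w'" by (auto elim: dvdE)
    have "r dvd F j * w'" for j
    proof -
      obtain k where "F j * w = u * k" using less.prems(2)[of j] by (auto elim: dvdE)
      then have "q * (F j * w') = q * (r * k)" using w' qr(2) by (simp add: ac_simps)
      then show ?thesis using \<open>q \<noteq> 0\<close> by simp
    qed
    moreover have "r \<noteq> 0" using less.prems(1) qr(2) by auto
    ultimately have "r dvd w'" using less.hyps[OF qr(3)] by blast
    then show ?thesis using w' qr(2) by simp
  qed
qed

lemma coprime_family_dvd:
  fixes F :: "'n \<Rightarrow> 'v::countable cpoly"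
  assumes "\<And>g. (\<And>j. g dvd F j) \<Longrightarrow> g dvd 1" "u \<noteq> 0" "\<And>j. u dvd F j * w"
  shows "u dvd w"
proof -
  let ?e = "rename (to_nat :: 'v \<Rightarrow> nat)" and ?i = "rename (inv_into UNIV (to_nat :: 'v \<Rightarrow> nat))"
  have dvd: "?e a dvd ?e b" if "a dvd b" for a b using that by (auto simp: ring_hom_funD[OF ring_hom_rename] elim!: dvdE)
  have dvd': "a dvd b" if ab: "?e a dvd ?e b" for a b
  proof -
    obtain k where "?e b = ?e a * k" using ab by (auto elim: dvdE)
    then have "?i (?e b) = ?i (?e a) * ?i k" by (simp add: ring_hom_funD[OF ring_hom_rename])
    then show ?thesis by (simp add: rename_inv)
  qed
  have nz: "\<exists>j. F j \<noteq> 0"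
  proof (rule ccontr)
    assume "\<nexists>j. F j \<noteq> 0"
    then have "(0 :: 'v cpoly) dvd 1" using assms(1)[of 0] by simp
    then show False by simp
  qed
  have "?e u dvd ?e w"
  proof (rule coprime_family_dvd_nat[of "\<lambda>j. ?e (F j)"])
    fix g assume g: "\<And>j. g dvd ?e (F j)"
    obtain j where j: "F j \<noteq> 0" using nz by blast
    obtain k where k: "?e (F j) = g * k" using g[of j] by (auto elim: dvdE)
    have "?e (F j) \<noteq> 0" using j by (simp add: rename_eq_0_iff)
    then have "vars g \<subseteq> vars (?e (F j))" using vars_factor[of g k] k by metis
    then have "vars g \<subseteq> range (to_nat :: 'v \<Rightarrow> nat)" using vars_rename by (rule order_trans)
    then have "?e (?i g) = g" by (intro rename_surj_on) auto
    then have "?i g dvd F j" for j using g[of j] dvd'[of "?i g" "F j"] by simp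
    then have "?i g dvd 1" by (rule assms(1))
    then show "g dvd 1" using dvd[of "?i g" 1] \<open>?e (?i g) = g\<close> by (simp add: ring_hom_funD[OF ring_hom_rename])
  next
    fix j show "?e u dvd ?e (F j) * ?e w"
      using dvd[OF assms(3)[of j]] by (simp add: ring_hom_funD[OF ring_hom_rename])
  qed (use assms(2) in \<open>simp add: rename_eq_0_iff\<close>)
  then show ?thesis by (rule dvd')
qed

section \<open>Generic points\<close>

abbreviation evl :: "('v \<Rightarrow> complex) \<Rightarrow> 'v cpoly \<Rightarrow> complex" where
  "evl \<equiv> pval (\<lambda>z. z)"

lemmas ring_hom_evl = ring_hom_pval[OF ring_hom_fun_id]

definition partial_eval :: "nat \<Rightarrow> (nat \<Rightarrow> complex) \<Rightarrow> nat cpoly \<Rightarrow> nat cpoly" where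
  "partial_eval n x = pval Con (\<lambda>v. if v < n then Con (x v) else Var v)"

lemma partial_eval_Suc:
  "partial_eval (Suc n) (x(n := z)) p = poly (sepv n (partial_eval n x p)) (Con z)"
proof -
  have h: "ring_hom_fun (\<lambda>f. poly f (Con z :: nat cpoly))" by (simp add: ring_hom_fun_def)
  have r: "ring_hom_fun (partial_eval k y)" for k y
    unfolding partial_eval_def by (intro ring_hom_pval ring_hom_Con)
  have "ring_hom_fun (\<lambda>p. poly (sepv n (partial_eval n x p)) (Con z))"
    using ring_hom_fun_comp[OF h ring_hom_fun_comp[OF ring_hom_sepv r]] .
  then show ?thesis
    by (rule hom_eqI[OF r])
      (auto simp: partial_eval_def ring_hom_Con ring_hom_funD[OF ring_hom_Con] sepv_def ring_hom_poly_Con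
        ring_hom_funD[OF ring_hom_poly_Con] less_Suc_eq)
qed

lemma partial_eval_all: "vars p \<subseteq> {..<n} \<Longrightarrow> partial_eval n x p = Con (evl x p)"
proof -
  assume "vars p \<subseteq> {..<n}"
  then have "partial_eval n x p = pval Con (\<lambda>v. Con (x v)) p"
    unfolding partial_eval_def by (intro pval_cong) auto
  then show ?thesis by (simp add: hom_pval[OF ring_hom_Con])
qed

text \<open>The values of the variables are chosen one after the other.  A polynomial that is still
  nonzero after substituting the first \<open>n\<close> values has finitely many roots in the next variable, so
  countably many polynomials exclude only countably many values.  Every polynomial is exhausted
  after finitely many steps.\<close>

lemma generic_point_nat:
  fixes F :: "nat cpoly set"
  assumes "countable F" "0 \<notin> F"
  shows "\<exists>x. \<forall>p\<in>F. evl x p \<noteq> 0"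
proof -
  have "\<exists>X. \<forall>n. (\<forall>p\<in>F. partial_eval n (X n) p \<noteq> 0) \<and> (\<exists>z. X (Suc n) = (X n)(n := z))"
  proof (rule dependent_nat_choice)
    have "partial_eval 0 x p = p" for x p by (simp add: partial_eval_def)
    then show "\<exists>x. \<forall>p\<in>F. partial_eval 0 x p \<noteq> 0" using assms(2) by auto
  next
    fix x n assume x: "\<forall>p\<in>F. partial_eval n x p \<noteq> 0"
    \<comment> \<open>Real values suffice, and the real numbers are uncountable.\<close>
    let ?B = "\<lambda>p. {r::real. poly (sepv n (partial_eval n x p)) (Con (of_real r)) = 0}"
    have "finite (?B p)" if "p \<in> F" for p
    proof -
      have "finite {a. poly (sepv n (partial_eval n x p)) a = 0}"
        using x that by (intro poly_roots_finite) (simp add: sepv_eq_0_iff)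
      then have "finite ((\<lambda>r::real. Con (of_real r)) -` {a. poly (sepv n (partial_eval n x p)) a = 0})"
        by (rule finite_vimageI) (auto simp: inj_def)
      then show ?thesis by (simp add: vimage_def)
    qed
    then have "countable (\<Union>p\<in>F. ?B p)" using assms(1) by (intro countable_UN) (auto intro: countable_finite)
    then have "(\<Union>p\<in>F. ?B p) \<noteq> UNIV" using uncountable_UNIV_real by metis
    then obtain r where "\<forall>p\<in>F. poly (sepv n (partial_eval n x p)) (Con (of_real r)) \<noteq> 0" by auto
    then have "\<forall>p\<in>F. partial_eval (Suc n) (x(n := of_real r)) p \<noteq> 0" by (simp add: partial_eval_Suc)
    then show "\<exists>y. (\<forall>p\<in>F. partial_eval (Suc n) y p \<noteq> 0) \<and> (\<exists>z. y = x(n := z))" by blast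
  qed
  then obtain X where X: "\<And>n p. p \<in> F \<Longrightarrow> partial_eval n (X n) p \<noteq> 0" "\<And>n. \<exists>z. X (Suc n) = (X n)(n := z)"
    by blast
  define x where "x v = X (Suc v) v" for v
  have Xx: "v < n \<Longrightarrow> X n v = x v" for n v
  proof (induction n)
    case (Suc n)
    obtain z where "X (Suc n) = (X n)(n := z)" using X(2) by blast
    then show ?case using Suc by (cases "v = n") (auto simp: x_def)
  qed simp
  have "evl x p \<noteq> 0" if "p \<in> F" for p
  proof -
    obtain n where n: "vars p \<subseteq> {..<n}" using finite_vars[of p] finite_nat_iff_bounded by blast
    have "evl (X n) p = evl x p" using n Xx by (intro pval_cong) auto
    then show ?thesis using X(1)[OF that, of n] partial_eval_all[OF n, of "X n"] by simp
  qed
  then show ?thesis by blast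
qed

lemma generic_point:
  fixes F :: "'v::countable cpoly set"
  assumes "countable F" "0 \<notin> F"
  shows "\<exists>x. \<forall>p\<in>F. evl x p \<noteq> 0"
proof -
  have "0 \<notin> rename to_nat ` F" using assms(2) by (auto simp: rename_eq_0_iff)
  then obtain y :: "nat \<Rightarrow> complex" where y: "\<forall>p\<in>rename to_nat ` F. evl y p \<noteq> 0"
    using generic_point_nat[of "rename to_nat ` F"] assms(1) by blast
  have "evl y (rename to_nat p) = evl (\<lambda>v. y (to_nat v)) p" for p :: "'v cpoly"
    unfolding rename_def by (simp add: hom_pval[OF ring_hom_evl] ring_hom_fun_id)
  then show ?thesis using y by (intro exI[of _ "\<lambda>v. y (to_nat v)"]) auto
qed

lemma cpoly_eq_0I:
  fixes p :: "'v::countable cpoly"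
  assumes "\<And>x. evl x p = 0" shows "p = 0"
  using generic_point[of "{p}"] assms by auto

section \<open>Homogeneous linear systems with polynomial coefficients\<close>

lemma tdeg_det_le:
  fixes A :: "nat \<Rightarrow> nat \<Rightarrow> 'v::countable cpoly"
  assumes "\<And>i j. i < n \<Longrightarrow> j < n \<Longrightarrow> tdeg (A i j) \<le> k"
  shows "tdeg (Determinant.det (mat n n (\<lambda>(i, j). A i j))) \<le> n * k"
proof -
  have "tdeg (signof p * (\<Prod>i = 0..<n. mat n n (\<lambda>(i, j). A i j) $$ (i, p i))) \<le> 0 + card {0..<n} * k"
    if p: "p permutes {0..<n}" for p
  proof (intro tdeg_mult_le tdeg_prod_le)
    fix i assume i: "i \<in> {0..<n}"
    then have "p i < n" using permutes_in_image[OF p, of i] by simp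
    then show "tdeg (mat n n (\<lambda>(i, j). A i j) $$ (i, p i)) \<le> k" using i assms by simp
  qed (simp add: sign_def)
  then show ?thesis by (subst det_def'[of _ n]) (auto intro!: tdeg_sum_le)
qed

text \<open>Border a nonvanishing minor of largest size by one more column \<open>c\<close>; such a column exists
  because there are more unknowns than equations.  The cofactors along an additional row solve every
  equation, since the bordered determinant vanishes by maximality, and the cofactor belonging to \<open>c\<close>
  is the given minor.  As the solution consists of determinants, its degree is linear in the number
  of equations; eliminating the unknowns one by one would double the degrees in each step.\<close>

lemma bounded_degree_kernel:
  fixes M :: "'e \<Rightarrow> 'u \<Rightarrow> 'v::countable cpoly"
  assumes fin: "finite E" "finite U" and card: "card E < card U"
    and deg: "\<And>e u. e \<in> E \<Longrightarrow> u \<in> U \<Longrightarrow> tdeg (M e u) \<le> k"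
  shows "\<exists>q. (\<exists>u\<in>U. q u \<noteq> 0) \<and> (\<forall>u. u \<notin> U \<longrightarrow> q u = 0) \<and>
    (\<forall>e\<in>E. (\<Sum>u\<in>U. M e u * q u) = 0) \<and> (\<forall>u. tdeg (q u) \<le> card E * k)"
proof -
  define minor where "minor r f g = Determinant.det (mat r r (\<lambda>(i, j). M (f i) (g j)))" for r f g
  define R where "R = {r. \<exists>f g. (\<forall>i<r. f i \<in> E \<and> g i \<in> U) \<and> minor r f g \<noteq> 0}"
  have R_le: "r \<le> card E" if rR: "r \<in> R" for r
  proof -
    obtain f g where fg: "\<forall>i<r. f i \<in> E \<and> g i \<in> U" "minor r f g \<noteq> 0" using rR by (auto simp: R_def)
    have "inj_on f {..<r}"
    proof (rule inj_onI, rule ccontr)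
      fix i j assume ij: "i \<in> {..<r}" "j \<in> {..<r}" "f i = f j" "i \<noteq> j"
      have "minor r f g = 0" unfolding minor_def
        by (rule det_identical_rows[of _ r i j]) (use ij in \<open>auto intro!: eq_vecI\<close>)
      then show False using fg by simp
    qed
    then show ?thesis using card_inj_on_le[of f "{..<r}" E] fg fin by auto
  qed
  have "0 \<in> R" by (simp add: R_def minor_def)
  moreover have "finite R" using R_le finite_subset[of R "{..card E}"] by auto
  ultimately have maxR: "Max R \<in> R" "\<And>s. s \<in> R \<Longrightarrow> s \<le> Max R" by (auto intro: Max_in)
  define r where "r = Max R"
  obtain f g where fg: "\<forall>i<r. f i \<in> E \<and> g i \<in> U" "minor r f g \<noteq> 0" using maxR(1) by (auto simp: R_def r_def)
  have rE: "r \<le> card E" using R_le maxR(1) by (simp add: r_def)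
  have "card (g ` {..<r}) \<le> r" using card_image_le[of "{..<r}" g] by simp
  then have "\<not> U \<subseteq> g ` {..<r}" using card rE card_mono[of "g ` {..<r}" U] by auto
  then obtain c where c: "c \<in> U" "c \<notin> g ` {..<r}" by blast
  define h where "h = g(r := c)"
  have hU: "h j \<in> U" if "j < Suc r" for j using that fg c by (auto simp: h_def less_Suc_eq)
  define C where "C j = (- 1) ^ (r + j) * minor r f (\<lambda>j'. h (if j' < j then j' else Suc j'))" for j
  define q where "q u = (\<Sum>j<Suc r. if h j = u then C j else 0)" for u
  have "q c = (\<Sum>j<Suc r. if j = r then C j else 0)"
    unfolding q_def using c by (intro sum.cong) (auto simp: h_def less_Suc_eq)
  also have "\<dots> = C r" by simp
  also have "C r = minor r f g"
  proof -
    have "mat r r (\<lambda>(i, j). M (f i) (h (if j < r then j else Suc j))) = mat r r (\<lambda>(i, j). M (f i) (g j))"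
      by (intro eq_matI) (auto simp: h_def)
    then show ?thesis by (simp add: C_def minor_def)
  qed
  finally have "q c \<noteq> 0" using fg by simp
  moreover have "q u = 0" if "u \<notin> U" for u
    unfolding q_def using that hU by (intro sum.neutral) auto
  moreover have "(\<Sum>u\<in>U. M e u * q u) = 0" if e: "e \<in> E" for e
  proof -
    let ?B = "mat (Suc r) (Suc r) (\<lambda>(i, j). M ((f(r := e)) i) (h j))"
    have "Determinant.det ?B = 0"
    proof (rule ccontr)
      assume "Determinant.det ?B \<noteq> 0"
      moreover have "\<forall>i<Suc r. (f(r := e)) i \<in> E \<and> h i \<in> U" using fg e hU by (auto simp: less_Suc_eq)
      ultimately have "Suc r \<in> R" unfolding R_def minor_def by blast
      then show False using maxR(2)[of "Suc r"] by (simp add: r_def)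
    qed
    moreover have "Determinant.det ?B = (\<Sum>j<Suc r. ?B $$ (r, j) * cofactor ?B r j)"
      by (rule laplace_expansion_row) auto
    moreover have "cofactor ?B r j = C j" if "j < Suc r" for j
    proof -
      have "mat_delete ?B r j = mat r r (\<lambda>(i, j'). M (f i) (h (if j' < j then j' else Suc j')))"
        by (intro eq_matI) (auto simp: mat_delete_def)
      then show ?thesis by (simp add: cofactor_def C_def minor_def)
    qed
    ultimately have 0: "(\<Sum>j<Suc r. M e (h j) * C j) = 0" by simp
    have "(\<Sum>u\<in>U. M e u * q u) = (\<Sum>j<Suc r. \<Sum>u\<in>U. if h j = u then M e u * C j else 0)"
      unfolding q_def sum_distrib_left by (subst sum.swap) (auto intro!: sum.cong)
    also have "\<dots> = (\<Sum>j<Suc r. M e (h j) * C j)"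
      using hU fin by (intro sum.cong refl) (subst sum.delta', auto)
    finally show ?thesis using 0 by simp
  qed
  moreover have "tdeg (q u) \<le> card E * k" for u
  proof -
    have "tdeg (C j) \<le> card E * k" if "j < Suc r" for j
    proof -
      have "tdeg ((- 1) ^ n :: 'v cpoly) = 0" for n by (cases "even n") auto
      moreover have "tdeg (minor r f (\<lambda>j'. h (if j' < j then j' else Suc j'))) \<le> r * k"
        unfolding minor_def using that fg hU by (intro tdeg_det_le deg) auto
      ultimately have "tdeg (C j) \<le> 0 + r * k" unfolding C_def by (intro tdeg_mult_le) auto
      also have "\<dots> \<le> card E * k" using rE by simp
      finally show ?thesis .
    qed
    then show ?thesis unfolding q_def by (intro tdeg_sum_le) auto
  qed
  ultimately show ?thesis using c by blast
qed


section \<open>Points of projective space\<close>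

lemma rep_proj_nonzero [simp]: "rep_proj p \<noteq> 0"
  using Quotient3_rep_reflp[OF Quotient3_proj, of p] by (simp add: proportional_def)

lemma abs_rep_proj [simp]: "abs_proj (rep_proj p) = p"
  by (rule Quotient3_abs_rep[OF Quotient3_proj])

definition parallel :: "complex^'n \<Rightarrow> complex^'n \<Rightarrow> bool" where
  "parallel u w \<longleftrightarrow> (\<forall>j k. u $ j * w $ k = u $ k * w $ j)"

lemma parallel_iff: "u \<noteq> 0 \<Longrightarrow> parallel u w \<longleftrightarrow> (\<exists>c. w = c *s u)"
proof
  assume u: "u \<noteq> 0" and p: "parallel u w"
  then obtain j where j: "u $ j \<noteq> 0" by (auto simp: vector_eq_iff)
  have wk: "w $ k = w $ j / u $ j * u $ k" for k
    using p[unfolded parallel_def, rule_format, of j k] j by (simp add: field_simps)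
  have "w = (w $ j / u $ j) *s u"
    unfolding vector_eq_iff vector_smult_component by (intro allI wk)
  then show "\<exists>c. w = c *s u" ..
qed (auto simp: parallel_def)

lemma parallel_scale: "a \<noteq> 0 \<Longrightarrow> b \<noteq> 0 \<Longrightarrow> parallel (a *s u) (b *s w) \<longleftrightarrow> parallel u w"
  by (simp add: parallel_def)

lemma abs_proj_eq_iff: "u \<noteq> 0 \<Longrightarrow> w \<noteq> 0 \<Longrightarrow> abs_proj u = abs_proj w \<longleftrightarrow> parallel u w"
proof -
  assume uw: "u \<noteq> 0" "w \<noteq> 0"
  then have "proportional u u" "proportional w w" by (auto simp: proportional_def intro!: exI[of _ 1])
  then have "abs_proj u = abs_proj w \<longleftrightarrow> proportional u w"
    using Quotient3_rel[OF Quotient3_proj, of u w] by simp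
  also have "\<dots> \<longleftrightarrow> parallel u w" using uw by (simp add: proportional_def parallel_iff)
  finally show ?thesis .
qed

lemma rep_abs_proj: "u \<noteq> 0 \<Longrightarrow> \<exists>c. c \<noteq> 0 \<and> rep_proj (abs_proj u) = c *s u"
proof -
  assume u: "u \<noteq> 0"
  then have "parallel u (rep_proj (abs_proj u))" using abs_proj_eq_iff[of u "rep_proj (abs_proj u)"] by simp
  then obtain c where c: "rep_proj (abs_proj u) = c *s u" using parallel_iff[OF u] by blast
  moreover have "c \<noteq> 0" using c rep_proj_nonzero[of "abs_proj u"] by (metis vector_smult_lzero)
  ultimately show ?thesis by blast
qed

lemma abs_proj_scale: "u \<noteq> 0 \<Longrightarrow> c \<noteq> 0 \<Longrightarrow> abs_proj (c *s u) = abs_proj u"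
  by (subst abs_proj_eq_iff) (auto simp: parallel_def)

section \<open>Multihomogeneous forms\<close>

lemma monom_total_degree_weight: "monom_total_degree m = weight (\<lambda>_. 1) m"
  by (simp add: monom_total_degree_def weight_def)

definition site :: "int \<Rightarrow> int \<times> 'n \<Rightarrow> nat" where "site i v = (if fst v = i then 1 else 0)"

lemma monom_degree_at_weight: "monom_degree_at i m = weight (site i) m"
proof -
  let ?A = "keys m \<union> Pair i ` UNIV"
  have "weight (site i) m = (\<Sum>v\<in>?A. site i v * lookup m v)"
    unfolding weight_def by (intro sum.mono_neutral_left) (auto simp: in_keys_iff)
  also have "\<dots> = (\<Sum>v\<in>Pair i ` UNIV. lookup m v)"
    by (intro sum.mono_neutral_cong_right) (auto simp: site_def)
  also have "\<dots> = monom_degree_at i m"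
    unfolding monom_degree_at_def by (subst sum.reindex) (auto simp: inj_on_def)
  finally show ?thesis ..
qed

lemma eval_mpoly_evl: "eval_mpoly x p = evl (\<lambda>v. x (fst v) $ snd v) p"
  by (simp add: eval_mpoly_def pval_def mono_val_def)

lemma weight_by_site:
  fixes m :: "'n::finite monom"
  assumes "finite S" "keys m \<subseteq> S \<times> UNIV"
  shows "weight (\<lambda>v. f (fst v)) m = (\<Sum>i\<in>S. f i * weight (site i) m)"
proof -
  have "f (fst v) * n = (\<Sum>i\<in>S. f i * (site i v * n))" if "v \<in> keys m" for v n
  proof -
    have "(\<Sum>i\<in>S. f i * (site i v * n)) = (\<Sum>i\<in>S. if i = fst v then f i * n else 0)"
      by (intro sum.cong) (auto simp: site_def)
    then show ?thesis using that assms by (auto simp: sum.delta)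
  qed
  then have "weight (\<lambda>v. f (fst v)) m = (\<Sum>v\<in>keys m. \<Sum>i\<in>S. f i * (site i v * lookup m v))"
    by (simp add: weight_def)
  also have "\<dots> = (\<Sum>i\<in>S. f i * weight (site i) m)"
    by (subst sum.swap) (simp add: weight_def sum_distrib_left)
  finally show ?thesis .
qed

lemma forms_on_iff:
  "F \<in> forms_on S \<longleftrightarrow> (\<exists>k. F k \<noteq> 0) \<and> (\<forall>k. vars (F k) \<subseteq> S \<times> UNIV) \<and>
     (\<exists>d. \<forall>k i. homogeneous (site i) (d i) (F k))"
  unfolding forms_on_def homogeneous_def vars_def monom_degree_at_weight by fastforce

lemma forms_on_vars: "F \<in> forms_on S \<Longrightarrow> v \<in> vars (F k) \<Longrightarrow> fst v \<in> S"
  using subsetD[of "vars (F k)" "S \<times> UNIV" v] by (simp add: forms_on_iff mem_Times_iff)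

definition form_val :: "('n::finite \<Rightarrow> 'n mpoly) \<Rightarrow> (int \<Rightarrow> complex^'n) \<Rightarrow> complex^'n" where
  "form_val F x = (\<chi> k. eval_mpoly x (F k))"

lemma eval_forms_form_val: "eval_forms F v = form_val F (\<lambda>i. rep_proj (v i))"
  by (simp add: eval_forms_def form_val_def)

lemma form_val_cong:
  assumes "F \<in> forms_on S" "\<And>i. i \<in> S \<Longrightarrow> x i = y i"
  shows "form_val F x = form_val F y"
proof -
  have "eval_mpoly x (F k) = eval_mpoly y (F k)" for k
    unfolding eval_mpoly_evl
  proof (rule pval_cong)
    fix v assume "v \<in> vars (F k)"
    then have "fst v \<in> S" using forms_on_vars[OF assms(1)] by simp
    then show "x (fst v) $ snd v = y (fst v) $ snd v" using assms(2) by simp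
  qed
  then show ?thesis by (simp add: form_val_def)
qed

text \<open>All components are homogeneous of the same degree at each site, so rescaling the vector
  at a site multiplies the value by a power of the factor.\<close>

lemma form_val_scale:
  assumes "finite S" "F \<in> forms_on S"
  shows "\<exists>d. \<forall>c x. form_val F (\<lambda>i. c i *s x i) = (\<Prod>i\<in>S. c i ^ d i) *s form_val F x"
proof -
  obtain d where d: "\<And>k i. homogeneous (site i) (d i) (F k)" using assms(2) by (auto simp: forms_on_iff)
  have "form_val F (\<lambda>i. c i *s x i) = (\<Prod>i\<in>S. c i ^ d i) *s form_val F x" for c x
  proof -
    have "evl (\<lambda>v. (c (fst v) *s x (fst v)) $ snd v) (F k) = (\<Prod>i\<in>S. c i ^ d i) * evl (\<lambda>v. x (fst v) $ snd v) (F k)" for k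
      unfolding pval_def sum_distrib_left
    proof (rule sum.cong[OF refl])
      fix m assume m: "m \<in> keys (F k)"
      have keys: "keys m \<subseteq> S \<times> UNIV"
      proof -
        have "keys m \<subseteq> vars (F k)" using m by (auto simp: vars_def)
        also have "\<dots> \<subseteq> S \<times> UNIV" using assms(2) by (simp add: forms_on_iff)
        finally show ?thesis .
      qed
      have "(\<Prod>v\<in>keys m. c (fst v) ^ lookup m v)
          = (\<Prod>v\<in>keys m. \<Prod>i\<in>S. c i ^ (site i v * lookup m v))"
      proof (rule prod.cong[OF refl])
        fix v assume "v \<in> keys m"
        then have "fst v \<in> S" using keys by auto
        have "(\<Prod>i\<in>S. c i ^ (site i v * lookup m v)) = (\<Prod>i\<in>S. if i = fst v then c i ^ lookup m v else 1)"
          by (intro prod.cong) (auto simp: site_def)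
        then show "c (fst v) ^ lookup m v = (\<Prod>i\<in>S. c i ^ (site i v * lookup m v))"
          using \<open>fst v \<in> S\<close> assms(1) by (simp add: prod.delta)
      qed
      also have "\<dots> = (\<Prod>i\<in>S. c i ^ weight (site i) m)"
        by (subst prod.swap) (simp add: weight_def power_sum)
      also have "\<dots> = (\<Prod>i\<in>S. c i ^ d i)" using d m by (simp add: homogeneous_def)
      finally have "mono_val (\<lambda>v. (c (fst v) *s x (fst v)) $ snd v) m
          = (\<Prod>i\<in>S. c i ^ d i) * mono_val (\<lambda>v. x (fst v) $ snd v) m"
        by (simp add: mono_val_def power_mult_distrib prod.distrib)
      then show "lookup (F k) m * mono_val (\<lambda>v. (c (fst v) *s x (fst v)) $ snd v) m =
          (\<Prod>i\<in>S. c i ^ d i) * (lookup (F k) m * mono_val (\<lambda>v. x (fst v) $ snd v) m)"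
        by simp
    qed
    then show ?thesis by (simp add: form_val_def eval_mpoly_evl vector_eq_iff)
  qed
  then show ?thesis by blast
qed

lemma form_val_rescale:
  assumes "finite S" "F \<in> forms_on S" "\<And>i. i \<in> S \<Longrightarrow> c i \<noteq> 0 \<and> y i = c i *s x i"
  shows "\<exists>l. l \<noteq> 0 \<and> form_val F y = l *s form_val F x"
proof -
  obtain d where d: "\<And>c x. form_val F (\<lambda>i. c i *s x i) = (\<Prod>i\<in>S. c i ^ d i) *s form_val F x"
    using form_val_scale[OF assms(1,2)] by blast
  have "form_val F y = form_val F (\<lambda>i. c i *s x i)" using assms by (intro form_val_cong) auto
  moreover have "(\<Prod>i\<in>S. c i ^ d i) \<noteq> 0" using assms by auto
  ultimately show ?thesis by (intro exI[of _ "\<Prod>i\<in>S. c i ^ d i"]) (simp only: d[of c x] simp_thms)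
qed

definition shift :: "int \<Rightarrow> 'n mpoly \<Rightarrow> 'n mpoly" where
  "shift i = rename (\<lambda>v. (i + fst v, snd v))"

lemma eval_shift: "eval_mpoly x (shift i p) = eval_mpoly (\<lambda>s. x (i + s)) p"
  by (simp add: eval_mpoly_evl shift_def rename_def hom_pval[OF ring_hom_evl] ring_hom_fun_id)

lemma shift_eq_0_iff: "shift i p = 0 \<longleftrightarrow> p = 0"
  unfolding shift_def by (rule rename_eq_0_iff) (auto simp: inj_def)

text \<open>Proportionality over the field of rational functions, expressed without fractions.\<close>

definition same_ratio :: "('n \<Rightarrow> 'n mpoly) \<Rightarrow> ('n \<Rightarrow> 'n mpoly) \<Rightarrow> bool" where
  "same_ratio F G \<longleftrightarrow> (\<forall>j k. F j * G k = F k * G j)"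

lemma same_ratio_refl: "same_ratio F F" by (simp add: same_ratio_def mult.commute)

lemma same_ratio_sym: "same_ratio F G \<Longrightarrow> same_ratio G F"
  unfolding same_ratio_def by (metis mult.commute)

lemma same_ratio_trans:
  fixes F G H :: "'n::finite \<Rightarrow> 'n mpoly"
  assumes "same_ratio F G" "same_ratio G H" "G l \<noteq> 0" shows "same_ratio F H"
  unfolding same_ratio_def
proof (intro allI)
  fix j k
  have e: "F j * G l = F l * G j" "F l * G k = F k * G l" "G j * H k = G k * H j"
    using assms(1,2) by (auto simp: same_ratio_def)
  have "G l * (F j * H k) = (F j * G l) * H k" by (simp add: ac_simps)
  also have "\<dots> = F l * (G j * H k)" by (simp add: e(1) mult.assoc)
  also have "\<dots> = (F l * G k) * H j" by (simp add: e(3) mult.assoc)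
  also have "\<dots> = G l * (F k * H j)" by (simp add: e(2) ac_simps)
  finally show "F j * H k = F k * H j" using cpoly_mult_left_cancel[OF assms(3)] by blast
qed

lemma form_val_same_ratio: "same_ratio F G \<Longrightarrow> parallel (form_val F x) (form_val G x)"
  unfolding same_ratio_def parallel_def form_val_def eval_mpoly_evl
  by (simp flip: ring_hom_funD(4)[OF ring_hom_evl])

lemma eval_cross:
  "eval_mpoly x (F j * G k - F k * G j) = form_val F x $ j * form_val G x $ k - form_val F x $ k * form_val G x $ j"
  by (simp add: form_val_def eval_mpoly_evl ring_hom_fun_diff[OF ring_hom_evl] ring_hom_funD(4)[OF ring_hom_evl])

lemma eval_ext:
  fixes p :: "'n::finite mpoly"
  assumes "\<And>x. eval_mpoly x p = 0" shows "p = 0"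
proof (rule cpoly_eq_0I)
  fix y show "evl y p = 0" using assms[of "\<lambda>i. \<chi> k. y (i, k)"] by (simp add: eval_mpoly_evl)
qed

lemma same_ratioI:
  fixes F G :: "'n::finite \<Rightarrow> 'n mpoly"
  assumes "\<And>x. parallel (form_val F x) (form_val G x)" shows "same_ratio F G"
proof -
  have "F j * G k - F k * G j = 0" for j k
    using assms by (intro eval_ext) (simp add: eval_cross parallel_def)
  then show ?thesis by (simp add: same_ratio_def)
qed

text \<open>Every \<open>R j * G k\<close> is a multiple of \<open>R k\<close> and the \<open>R j\<close> have no common factor, so \<open>R k\<close>
  divides \<open>G k\<close>.\<close>

lemma reduced_dvd:
  fixes R G :: "'n::finite \<Rightarrow> 'n mpoly"
  assumes "no_common_factor R" "same_ratio R G" "R k \<noteq> 0"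
  shows "\<exists>h. \<forall>j. G j = h * R j"
proof -
  have "R k dvd G k"
  proof (rule coprime_family_dvd[OF _ assms(3)])
    show "g dvd 1" if "\<And>j. g dvd R j" for g using assms(1) that by (auto simp: no_common_factor_def)
    show "R k dvd R j * G k" for j
      using assms(2) unfolding same_ratio_def by (metis dvd_triv_left)
  qed
  then obtain h where h: "G k = R k * h" by (auto elim: dvdE)
  have "R k * G j = R k * (h * R j)" for j
    using assms(2) h unfolding same_ratio_def by (metis mult.assoc mult.commute)
  then have "G j = h * R j" for j using cpoly_mult_left_cancel[OF assms(3)] by blast
  then show ?thesis by blast
qed

text \<open>Divide by a common factor of largest total degree.  The quotients are again
  multihomogeneous, with common degrees, because factors of homogeneous polynomials are homogeneous
  and the degree of the common factor does not depend on the component.\<close>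

lemma reduced_exists:
  fixes F :: "'n::finite \<Rightarrow> 'n mpoly"
  assumes F: "F \<in> forms_on S"
  shows "\<exists>R\<in>forms_on S. no_common_factor R \<and> same_ratio R F"
proof -
  obtain k0 where k0: "F k0 \<noteq> 0" using F by (auto simp: forms_on_iff)
  obtain d where d: "\<And>k i. homogeneous (site i) (d i) (F k)" using F by (auto simp: forms_on_iff)
  define P where "P g \<longleftrightarrow> (\<forall>k. g dvd F k)" for g
  have "P 1" by (simp add: P_def)
  moreover have bnd: "tdeg g < Suc (tdeg (F k0))" if Pg: "P g" for g
  proof -
    obtain r where "F k0 = g * r" using Pg unfolding P_def dvd_def by blast
    moreover from this have "g \<noteq> 0" "r \<noteq> 0" using k0 by auto
    ultimately show ?thesis using tdeg_mult[of g r] by simp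
  qed
  ultimately obtain g where g: "P g" "\<And>h. P h \<Longrightarrow> tdeg h \<le> tdeg g"
    using ex_has_greatest_nat[of P 1 tdeg "Suc (tdeg (F k0))"] by blast
  have "\<forall>k. \<exists>r. F k = g * r" using g(1) unfolding P_def dvd_def by blast
  then obtain R where R: "\<And>k. F k = g * R k" by metis
  have g0: "g \<noteq> 0" using R[of k0] k0 by auto
  have R0: "R k \<noteq> 0" if "F k \<noteq> 0" for k using R[of k] that by auto
  have "no_common_factor R" unfolding no_common_factor_def
  proof (intro allI impI)
    fix h assume h: "\<forall>k. h dvd R k"
    then have "P (g * h)" unfolding P_def R by (auto intro: mult_dvd_mono)
    moreover have h0: "h \<noteq> 0" using h R0[OF k0] by auto
    ultimately have "tdeg g + tdeg h \<le> tdeg g" using g(2)[of "g * h"] tdeg_mult[OF g0 h0] by simp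
    then show "h dvd 1" using tdeg_0_dvd_1 h0 by simp
  qed
  moreover have "R \<in> forms_on S" unfolding forms_on_iff
  proof (intro conjI allI)
    show "\<exists>k. R k \<noteq> 0" using R0[OF k0] by blast
    show "vars (R k) \<subseteq> S \<times> UNIV" for k
    proof (cases "F k = 0")
      case True then have "R k = 0" using R[of k] g0 cpoly_no_zero_divisors[of g "R k"] by auto
      then show ?thesis by simp
    next
      case False
      then have "vars (R k) \<subseteq> vars (F k)" using vars_factor[of "R k" g] R[of k] by (simp add: mult.commute)
      then show ?thesis using F by (auto simp: forms_on_iff)
    qed
    have "\<exists>e. homogeneous (site i) e g \<and> (\<forall>k. homogeneous (site i) (d i - e) (R k))" for i
    proof -
      have split: "\<exists>e f. e + f = d i \<and> homogeneous (site i) e g \<and> homogeneous (site i) f (R k)" if "F k \<noteq> 0" for k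
        using homogeneous_factor[of "site i" "d i" g "R k"] d[of i k] that R[of k] by auto
      obtain e f where ef: "e + f = d i" "homogeneous (site i) e g" using split[OF k0] by blast
      obtain m where "m \<in> keys g" using g0 by fastforce
      then have uniq: "e' = e" if "homogeneous (site i) e' g" for e' using that ef(2) by (auto simp: homogeneous_def)
      have "homogeneous (site i) (d i - e) (R k)" for k
      proof (cases "F k = 0")
        case True then have "R k = 0" using R[of k] g0 cpoly_no_zero_divisors[of g "R k"] by auto
        then show ?thesis by simp
      next
        case False
        then obtain e' f' where e': "e' + f' = d i" "homogeneous (site i) e' g" "homogeneous (site i) f' (R k)"
          using split by blast
        then have "f' = d i - e" using uniq by fastforce
        then show ?thesis using e'(3) by simp
      qed
      then show ?thesis using ef by blast
    qed
    then have "\<forall>i. \<exists>f. \<forall>k. homogeneous (site i) f (R k)" by blast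
    then show "\<exists>d. \<forall>k i. homogeneous (site i) (d i) (R k)" by metis
  qed
  moreover have "same_ratio R F" unfolding same_ratio_def R by (simp add: ac_simps)
  ultimately show ?thesis by blast
qed

text \<open>The coordinates themselves are added to the family, so that the vectors represent points
  of the projective space.\<close>

lemma generic_vectors:
  fixes P :: "'n::finite mpoly set"
  assumes "countable P" "0 \<notin> P"
  shows "\<exists>x. (\<forall>i. x i \<noteq> 0) \<and> (\<forall>p\<in>P. eval_mpoly x p \<noteq> 0)"
proof -
  have "countable (P \<union> range Var)" using assms(1) by auto
  moreover have "0 \<notin> P \<union> range Var" using assms(2) by (auto dest: arg_cong[of _ _ vars])
  ultimately obtain y where y: "\<forall>p\<in>P \<union> range Var. evl y p \<noteq> 0" using generic_point by blast
  let ?x = "\<lambda>i. \<chi> k. y (i, k)"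
  have "evl y (Var (i, undefined)) \<noteq> 0" for i using y by blast
  then have a: "?x i \<noteq> 0" for i by (auto simp: vector_eq_iff ring_hom_fun_id)
  have b: "eval_mpoly ?x p \<noteq> 0" if "p \<in> P" for p using y that by (simp add: eval_mpoly_evl)
  show ?thesis by (intro exI[of _ ?x] conjI allI ballI a b)
qed

text \<open>The chosen coordinates of a point differ from the given ones by a factor only, so neither
  the vanishing nor the direction of a value is affected.\<close>

lemma form_val_points:
  assumes "finite S" "F \<in> forms_on S" "\<And>i. x i \<noteq> 0"
  shows "\<exists>l. l \<noteq> 0 \<and> eval_forms F (\<lambda>i. abs_proj (x (g i))) = l *s form_val F (\<lambda>i. x (g i))"
proof -
  have "\<forall>i. \<exists>c. c \<noteq> 0 \<and> rep_proj (abs_proj (x i)) = c *s x i" using rep_abs_proj assms(3) by blast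
  then obtain c where "\<And>i. c i \<noteq> 0 \<and> rep_proj (abs_proj (x i)) = c i *s x i" by metis
  then show ?thesis unfolding eval_forms_form_val by (intro form_val_rescale[OF assms(1,2), of "\<lambda>i. c (g i)"]) auto
qed

section \<open>Rational maps and local rules\<close>

definition ratio_class :: "int set \<Rightarrow> ('n::finite \<Rightarrow> 'n mpoly) \<Rightarrow> 'n ratmap" where
  "ratio_class S F = {G \<in> forms_on S. same_ratio F G}"

lemma rational_maps_eq: "rational_maps S = ratio_class S ` forms_on S"
  unfolding rational_maps_def ratio_class_def same_ratio_def by auto

lemma forms_on_nonzero: "F \<in> forms_on S \<Longrightarrow> \<exists>k. F k \<noteq> 0"
  by (simp add: forms_on_iff)

lemma ratio_class_self: "F \<in> forms_on S \<Longrightarrow> F \<in> ratio_class S F"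
  by (simp add: ratio_class_def same_ratio_refl)

lemma ratio_class_eqI:
  assumes "F \<in> forms_on S" "G \<in> forms_on S" "same_ratio F G"
  shows "ratio_class S F = ratio_class S G"
proof -
  obtain k l where kl: "F k \<noteq> 0" "G l \<noteq> 0" using assms(1,2) forms_on_nonzero by metis
  have "same_ratio F H \<longleftrightarrow> same_ratio G H" for H
    using same_ratio_trans[OF assms(3), of H l] same_ratio_trans[OF same_ratio_sym[OF assms(3)], of H k] kl by blast
  then show ?thesis by (simp add: ratio_class_def)
qed

text \<open>Forms without common factors are the normal form in which rational maps are handled below:
  the zero set of such a form is the indeterminacy locus of its class.\<close>

definition reduced :: "int set \<Rightarrow> ('n::finite \<Rightarrow> 'n mpoly) \<Rightarrow> bool" where
  "reduced S R \<longleftrightarrow> finite S \<and> S \<noteq> {} \<and> R \<in> forms_on S \<and> no_common_factor R"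

lemma reducedD: "reduced S R \<Longrightarrow> finite S" "reduced S R \<Longrightarrow> S \<noteq> {}" "reduced S R \<Longrightarrow> R \<in> forms_on S"
  "reduced S R \<Longrightarrow> no_common_factor R"
  by (simp_all add: reduced_def)

lemma local_rule_iff: "local_rule S \<phi> \<longleftrightarrow> (\<exists>R. reduced S R \<and> \<phi> = ratio_class S R)"
proof
  assume "local_rule S \<phi>"
  then obtain F where F: "finite S" "S \<noteq> {}" "F \<in> forms_on S" "\<phi> = ratio_class S F"
    by (auto simp: local_rule_def rational_maps_eq)
  obtain R where R: "R \<in> forms_on S" "no_common_factor R" "same_ratio R F" using reduced_exists[OF F(3)] by blast
  then show "\<exists>R. reduced S R \<and> \<phi> = ratio_class S R"
    using F ratio_class_eqI[OF R(1) F(3) R(3)] by (intro exI[of _ R]) (simp add: reduced_def)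
qed (auto simp: local_rule_def rational_maps_eq reduced_def)

lemma eval_forms_multiple:
  assumes "\<And>k. G k = h * F k"
  shows "eval_forms G v = eval_mpoly (\<lambda>i. rep_proj (v i)) h *s eval_forms F v"
  by (simp add: eval_forms_def vector_eq_iff assms eval_mpoly_evl ring_hom_funD(4)[OF ring_hom_evl])

lemma eval_forms_same_ratio: "same_ratio F G \<Longrightarrow> parallel (eval_forms F v) (eval_forms G v)"
  unfolding eval_forms_form_val by (rule form_val_same_ratio)

lemma not_Ind: "F \<in> forms_on S \<Longrightarrow> eval_forms F v \<noteq> 0 \<Longrightarrow> v \<notin> Ind (ratio_class S F)"
  unfolding Ind_def using ratio_class_self by blast

lemma Ind_reduced:
  assumes "reduced S R" shows "v \<in> Ind (ratio_class S R) \<longleftrightarrow> eval_forms R v = 0"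
proof
  assume 0: "eval_forms R v = 0"
  obtain k where k: "R k \<noteq> 0" using forms_on_nonzero[OF reducedD(3)[OF assms]] by blast
  have "eval_forms G v = 0" if G: "G \<in> ratio_class S R" for G
  proof -
    obtain h where "\<And>j. G j = h * R j"
      using reduced_dvd[OF reducedD(4)[OF assms] _ k, of G] G by (auto simp: ratio_class_def)
    then show ?thesis using eval_forms_multiple[of G h R v] 0 by simp
  qed
  then show "v \<in> Ind (ratio_class S R)" by (simp add: Ind_def)
qed (use not_Ind[OF reducedD(3)[OF assms]] in blast)

lemma rat_apply_eq:
  assumes "F \<in> forms_on S" "eval_forms F v \<noteq> 0"
  shows "rat_apply (ratio_class S F) v = abs_proj (eval_forms F v)"
  unfolding rat_apply_def
proof (rule the_equality)
  show "\<exists>G\<in>ratio_class S F. eval_forms G v \<noteq> 0 \<and> abs_proj (eval_forms F v) = abs_proj (eval_forms G v)"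
    using ratio_class_self[OF assms(1)] assms(2) by blast
next
  fix p assume "\<exists>G\<in>ratio_class S F. eval_forms G v \<noteq> 0 \<and> p = abs_proj (eval_forms G v)"
  then obtain G where G: "same_ratio F G" "eval_forms G v \<noteq> 0" "p = abs_proj (eval_forms G v)"
    by (auto simp: ratio_class_def)
  then show "p = abs_proj (eval_forms F v)"
    using abs_proj_eq_iff[OF assms(2) G(2)] eval_forms_same_ratio[OF G(1)] by simp
qed

text \<open>The lattice map computed from one single form.  It agrees with the lattice map of the class
  exactly because the form is reduced; a form with a common factor vanishes too often.\<close>

definition form_map :: "('n::finite \<Rightarrow> 'n mpoly) \<Rightarrow> 'n lattice_map" where
  "form_map R v = (if \<forall>i. eval_forms R (\<lambda>s. v (i + s)) \<noteq> 0
     then Some (\<lambda>i. abs_proj (eval_forms R (\<lambda>s. v (i + s)))) else None)"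

lemma lattice_map_reduced:
  assumes "reduced S R" shows "lattice_map (ratio_class S R) = form_map R"
proof
  fix v
  show "lattice_map (ratio_class S R) v = form_map R v"
    unfolding lattice_map_def form_map_def Ind_reduced[OF assms]
    using rat_apply_eq[OF reducedD(3)[OF assms]] by auto
qed

lemma has_local_rule_iff:
  "has_local_rule T S \<phi> \<longleftrightarrow> (\<exists>R. reduced S R \<and> \<phi> = ratio_class S R \<and> T = form_map R)"
  unfolding has_local_rule_def local_rule_iff using lattice_map_reduced by auto

lemma reduced_unique:
  assumes "reduced S R" "reduced S' R'" "same_ratio R R'"
  shows "\<exists>c. c \<noteq> 0 \<and> (\<forall>k. R' k = Con c * R k)"
proof -
  obtain k l where kl: "R k \<noteq> 0" "R' l \<noteq> 0" using assms(1,2) reducedD(3) forms_on_nonzero by metis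
  obtain h where h: "\<And>j. R' j = h * R j" using reduced_dvd[OF reducedD(4)[OF assms(1)] assms(3) kl(1)] by blast
  obtain h' where h': "\<And>j. R j = h' * R' j"
    using reduced_dvd[OF reducedD(4)[OF assms(2)] same_ratio_sym[OF assms(3)] kl(2)] by blast
  have "R k * 1 = R k * (h' * h)" using h[of k] h'[of k] by (simp add: ac_simps)
  then have one: "1 = h' * h" using cpoly_mult_left_cancel[OF kl(1)] by blast
  then have "h dvd 1" by (metis dvd_triv_right)
  then have "h = Con (lookup h 0)" using tdeg_0_Con dvd_1_tdeg_0 by blast
  moreover have "h \<noteq> 0" using one by auto
  ultimately show ?thesis using h by (metis Con_eq_0_iff)
qed

lemma form_map_multiple:
  assumes "c \<noteq> 0" "\<And>k. R' k = Con c * R k" shows "form_map R' = form_map R"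
proof -
  have e: "eval_forms R' v = c *s eval_forms R v" for v
    using eval_forms_multiple[of R' "Con c" R v] assms(2) by (simp add: eval_mpoly_evl)
  have z: "c *s u = 0 \<longleftrightarrow> u = 0" for u :: "complex^'a" using assms(1) by (simp add: vector_mul_eq_0)
  show ?thesis by (rule ext) (auto simp: form_map_def e z abs_proj_scale assms(1))
qed

text \<open>A configuration can be chosen at which both forms are nonzero in all windows at once, since
  this amounts to countably many polynomials being nonzero.  There both maps are defined, and the
  windows at site zero show that the two forms are parallel at a generic point.\<close>

lemma form_map_eq_same_ratio:
  fixes R R' :: "'n::finite \<Rightarrow> 'n mpoly"
  assumes R: "reduced S R" and R': "reduced S' R'" and eq: "form_map R = form_map R'"
  shows "same_ratio R R'"
proof (rule ccontr)
  assume "\<not> same_ratio R R'"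
  then obtain j k where jk: "R j * R' k - R k * R' j \<noteq> 0" by (auto simp: same_ratio_def)
  obtain a b where ab: "R a \<noteq> 0" "R' b \<noteq> 0" using R R' reducedD(3) forms_on_nonzero by metis
  let ?P = "range (\<lambda>i. shift i (R a)) \<union> range (\<lambda>i. shift i (R' b)) \<union> {R j * R' k - R k * R' j}"
  have "countable ?P" by simp
  moreover have "0 \<notin> ?P" using ab jk shift_eq_0_iff by (metis (no_types, lifting) UnE imageE singletonD)
  ultimately obtain x where x: "\<And>i. x i \<noteq> 0" "\<And>p. p \<in> ?P \<Longrightarrow> eval_mpoly x p \<noteq> 0"
    using generic_vectors[of ?P] by blast
  define v where "v i = abs_proj (x i)" for i
  have fv: "\<exists>l. l \<noteq> 0 \<and> eval_forms Q (\<lambda>s. v (i + s)) = l *s form_val Q (\<lambda>s. x (i + s))"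
    if "reduced X Q" for X Q i
    unfolding v_def by (rule form_val_points[OF reducedD(1)[OF that] reducedD(3)[OF that] x(1)])
  have nz: "eval_forms Q (\<lambda>s. v (i + s)) \<noteq> 0" if Q: "reduced X Q" and c: "\<And>i. shift i (Q c) \<in> ?P" for X Q c i
  proof -
    obtain l where l: "l \<noteq> 0" "eval_forms Q (\<lambda>s. v (i + s)) = l *s form_val Q (\<lambda>s. x (i + s))" using fv[OF Q] by blast
    have "form_val Q (\<lambda>s. x (i + s)) $ c \<noteq> 0" using x(2)[OF c[of i]] by (simp add: form_val_def eval_shift)
    then have "eval_forms Q (\<lambda>s. v (i + s)) $ c \<noteq> 0" using l by simp
    then show ?thesis by (metis zero_index)
  qed
  have nzR: "eval_forms R (\<lambda>s. v (i + s)) \<noteq> 0" for i by (rule nz[OF R, of a]) simp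
  have nzR': "eval_forms R' (\<lambda>s. v (i + s)) \<noteq> 0" for i by (rule nz[OF R', of b]) simp
  have "form_map R v = form_map R' v" using eq by simp
  then have "(\<lambda>i. abs_proj (eval_forms R (\<lambda>s. v (i + s)))) = (\<lambda>i. abs_proj (eval_forms R' (\<lambda>s. v (i + s))))"
    unfolding form_map_def using nzR nzR' by simp
  then have "abs_proj (eval_forms R (\<lambda>s. v (0 + s))) = abs_proj (eval_forms R' (\<lambda>s. v (0 + s)))" by (rule fun_cong)
  then have par: "parallel (eval_forms R (\<lambda>s. v (0 + s))) (eval_forms R' (\<lambda>s. v (0 + s)))"
    using abs_proj_eq_iff[OF nzR nzR'] by blast
  obtain l l' where l: "l \<noteq> 0" "eval_forms R (\<lambda>s. v (0 + s)) = l *s form_val R (\<lambda>s. x (0 + s))"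
    "l' \<noteq> 0" "eval_forms R' (\<lambda>s. v (0 + s)) = l' *s form_val R' (\<lambda>s. x (0 + s))" using fv[OF R] fv[OF R'] by blast
  have "parallel (form_val R x) (form_val R' x)" using par l by (simp add: parallel_scale)
  then have "eval_mpoly x (R j * R' k - R k * R' j) = 0" by (simp add: eval_cross parallel_def)
  then show False using x(2)[of "R j * R' k - R k * R' j"] by simp
qed

lemma same_local_rule:
  assumes "reduced S R" "reduced S' R'" "form_map R = form_map R'"
  shows "\<exists>c. c \<noteq> 0 \<and> (\<forall>k. R' k = Con c * R k)"
  using reduced_unique[OF assms(1,2) form_map_eq_same_ratio[OF assms]] .

section \<open>The degree of a lattice map\<close>

lemma reduced_homogeneous:
  fixes R :: "'n::finite \<Rightarrow> 'n mpoly"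
  assumes "reduced S R" shows "\<exists>n. \<forall>k. homogeneous (\<lambda>_. 1) n (R k)"
proof -
  obtain d where d: "\<And>k i. homogeneous (site i) (d i) (R k)" using reducedD(3)[OF assms] by (auto simp: forms_on_iff)
  have "homogeneous (\<lambda>_. 1) (\<Sum>i\<in>S. d i) (R k)" for k
    unfolding homogeneous_def
  proof
    fix m assume m: "m \<in> keys (R k)"
    have "keys m \<subseteq> vars (R k)" using m by (auto simp: vars_def)
    also have "\<dots> \<subseteq> S \<times> UNIV" using reducedD(3)[OF assms] by (simp add: forms_on_iff)
    finally have "weight (\<lambda>_. 1) m = (\<Sum>i\<in>S. 1 * weight (site i) m)"
      using weight_by_site[OF reducedD(1)[OF assms], of m "\<lambda>_. 1"] by simp
    also have "\<dots> = (\<Sum>i\<in>S. d i)" using d m by (simp add: homogeneous_def)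
    finally show "weight (\<lambda>_. 1) m = (\<Sum>i\<in>S. d i)" .
  qed
  then show ?thesis by blast
qed

lemma homogeneous_unique: "homogeneous w n p \<Longrightarrow> homogeneous w n' p \<Longrightarrow> p \<noteq> 0 \<Longrightarrow> n = n'"
proof -
  assume a: "homogeneous w n p" "homogeneous w n' p" "p \<noteq> 0"
  then obtain m where "m \<in> keys p" by fastforce
  then show ?thesis using a unfolding homogeneous_def by metis
qed

lemma ratmap_degree_reduced:
  assumes R: "reduced S R" and n: "\<And>k. homogeneous (\<lambda>_. 1) n (R k)"
  shows "ratmap_degree (ratio_class S R) = n"
proof -
  have "ratmap_degree (ratio_class S R) = (THE n. \<exists>F\<in>ratio_class S R. no_common_factor F \<and> (\<forall>k. homogeneous (\<lambda>_. 1) n (F k)))"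
    by (simp add: ratmap_degree_def homogeneous_def monom_total_degree_weight)
  also have "\<dots> = n"
  proof (rule the_equality)
    show "\<exists>F\<in>ratio_class S R. no_common_factor F \<and> (\<forall>k. homogeneous (\<lambda>_. 1) n (F k))"
      using ratio_class_self[OF reducedD(3)[OF R]] reducedD(4)[OF R] n by blast
  next
    fix n' assume "\<exists>F\<in>ratio_class S R. no_common_factor F \<and> (\<forall>k. homogeneous (\<lambda>_. 1) n' (F k))"
    then obtain F where F: "F \<in> forms_on S" "same_ratio R F" "no_common_factor F" "\<And>k. homogeneous (\<lambda>_. 1) n' (F k)"
      by (auto simp: ratio_class_def)
    then have "reduced S F" using R by (simp add: reduced_def)
    then obtain c where c: "\<And>k. F k = Con c * R k" using reduced_unique[OF R _ F(2)] by blast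
    obtain k where k: "F k \<noteq> 0" using forms_on_nonzero[OF F(1)] by blast
    have "homogeneous (\<lambda>_. 1) (0 + n) (F k)" unfolding c by (intro homogeneous_mult n) simp
    then show "n' = n" using homogeneous_unique[OF F(4) _ k] by simp
  qed
  finally show ?thesis .
qed

lemma lattice_degree_form_map:
  assumes R: "reduced S R" and n: "\<And>k. homogeneous (\<lambda>_. 1) n (R k)"
  shows "lattice_degree (form_map R) = n"
  unfolding lattice_degree_def
proof (rule the_equality)
  show "\<exists>S \<phi>. has_local_rule (form_map R) S \<phi> \<and> n = ratmap_degree \<phi>"
    using ratmap_degree_reduced[OF R n] R unfolding has_local_rule_iff by metis
next
  fix n' assume "\<exists>S \<phi>. has_local_rule (form_map R) S \<phi> \<and> n' = ratmap_degree \<phi>"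
  then obtain S' R' where R': "reduced S' R'" "form_map R = form_map R'" "n' = ratmap_degree (ratio_class S' R')"
    unfolding has_local_rule_iff by auto
  obtain c where c: "\<And>k. R' k = Con c * R k" using same_local_rule[OF R R'(1,2)] by blast
  have "homogeneous (\<lambda>_. 1) (0 + n) (R' k)" for k unfolding c by (intro homogeneous_mult n) simp
  then show "n' = n" using ratmap_degree_reduced[OF R'(1)] R'(3) by simp
qed

section \<open>Composition\<close>

text \<open>Substitution of the shifted forms \<open>F\<close> into \<open>F'\<close>; the result may acquire common factors.\<close>

definition comp_form :: "('n::finite \<Rightarrow> 'n mpoly) \<Rightarrow> ('n \<Rightarrow> 'n mpoly) \<Rightarrow> 'n \<Rightarrow> 'n mpoly" where
  "comp_form F' F k = pval Con (\<lambda>v. shift (fst v) (F (snd v))) (F' k)"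

lemma form_val_comp: "form_val (comp_form F' F) x = form_val F' (\<lambda>i. form_val F (\<lambda>s. x (i + s)))"
proof -
  have "eval_mpoly x (comp_form F' F k) = eval_mpoly (\<lambda>i. form_val F (\<lambda>s. x (i + s))) (F' k)" for k
    unfolding comp_form_def eval_mpoly_evl hom_pval[OF ring_hom_evl]
    by (simp add: eval_mpoly_evl[symmetric] eval_shift form_val_def) (simp add: eval_mpoly_evl)
  then show ?thesis by (simp add: form_val_def)
qed

lemma comp_form_in_forms:
  fixes F F' :: "'n::finite \<Rightarrow> 'n mpoly"
  assumes F: "F \<in> forms_on S" and F': "F' \<in> forms_on S'" "finite S'" and nz: "comp_form F' F k0 \<noteq> 0"
  shows "comp_form F' F \<in> forms_on (S + S')"
  unfolding forms_on_iff
proof (intro conjI allI)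
  obtain d where d: "\<And>k i. homogeneous (site i) (d i) (F k)" using F by (auto simp: forms_on_iff)
  obtain d' where d': "\<And>k i. homogeneous (site i) (d' i) (F' k)" using F' by (auto simp: forms_on_iff)
  show "\<exists>k. comp_form F' F k \<noteq> 0" using nz by blast
  show "vars (comp_form F' F k) \<subseteq> (S + S') \<times> UNIV" for k
    unfolding comp_form_def
  proof (rule vars_subst)
    fix v assume "v \<in> vars (F' k)"
    then have v: "fst v \<in> S'" using forms_on_vars[OF F'(1)] by simp
    show "vars (shift (fst v) (F (snd v))) \<subseteq> (S + S') \<times> UNIV" unfolding shift_def rename_def
    proof (rule vars_subst)
      fix u assume "u \<in> vars (F (snd v))"
      then have "fst u \<in> S" using forms_on_vars[OF F] by simp
      then have "fst v + fst u \<in> S + S'" using v by (metis add.commute set_plus_intro)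
      then show "vars (Var (fst v + fst u, snd u)) \<subseteq> (S + S') \<times> UNIV" by simp
    qed
  qed
  have "homogeneous (site j) (\<Sum>i\<in>S'. d (j - i) * d' i) (comp_form F' F k)" for j k
    unfolding comp_form_def
  proof (rule homogeneous_subst)
    fix v assume "v \<in> vars (F' k)"
    show "homogeneous (site j) (d (j - fst v)) (shift (fst v) (F (snd v)))" unfolding shift_def rename_def
    proof (rule homogeneous_subst)
      show "homogeneous (site j) (site (j - fst v) u) (Var (fst v + fst u, snd u))" for u :: "int \<times> 'n"
        using homogeneous_Var[of "site j" "(fst v + fst u, snd u)"] by (auto simp: site_def algebra_simps)
      show "homogeneous (site (j - fst v)) (d (j - fst v)) (F (snd v))" by (rule d)
    qed
  next
    show "homogeneous (\<lambda>v. d (j - fst v)) (\<Sum>i\<in>S'. d (j - i) * d' i) (F' k)"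
      unfolding homogeneous_def
    proof
      fix m assume m: "m \<in> keys (F' k)"
      have "keys m \<subseteq> vars (F' k)" using m by (auto simp: vars_def)
      also have "\<dots> \<subseteq> S' \<times> UNIV" using F'(1) by (simp add: forms_on_iff)
      finally have "weight (\<lambda>v. d (j - fst v)) m = (\<Sum>i\<in>S'. d (j - i) * weight (site i) m)"
        by (rule weight_by_site[OF F'(2)])
      also have "\<dots> = (\<Sum>i\<in>S'. d (j - i) * d' i)" using d' m by (simp add: homogeneous_def)
      finally show "weight (\<lambda>v. d (j - fst v)) m = (\<Sum>i\<in>S'. d (j - i) * d' i)" .
    qed
  qed
  then show "\<exists>d. \<forall>k i. homogeneous (site i) (d i) (comp_form F' F k)"
    by (intro exI[of _ "\<lambda>j. \<Sum>i\<in>S'. d (j - i) * d' i"]) blast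
qed

lemma regional_map_reduced:
  assumes "reduced S R"
  shows "regional_map (ratio_class S R) A v = (if \<forall>i\<in>A. eval_forms R (\<lambda>s. v (i + s)) \<noteq> 0
    then Some (\<lambda>i\<in>A. abs_proj (eval_forms R (\<lambda>s. v (i + s)))) else None)"
  unfolding regional_map_def Ind_reduced[OF assms]
  using rat_apply_eq[OF reducedD(3)[OF assms]] by (auto simp: restrict_def)

lemma eval_forms_regional:
  assumes R: "reduced S R" and R': "reduced S' R'" and w: "regional_map (ratio_class S R) S' v = Some w"
  shows "\<exists>l. l \<noteq> 0 \<and> eval_forms R' w = l *s eval_forms (comp_form R' R) v"
proof -
  have nz: "\<And>i. i \<in> S' \<Longrightarrow> eval_forms R (\<lambda>s. v (i + s)) \<noteq> 0"
    and w': "w = (\<lambda>i\<in>S'. abs_proj (eval_forms R (\<lambda>s. v (i + s))))"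
    using w unfolding regional_map_reduced[OF R] by (auto split: if_splits)
  have "\<forall>i\<in>S'. \<exists>c. c \<noteq> 0 \<and> rep_proj (w i) = c *s eval_forms R (\<lambda>s. v (i + s))"
    using rep_abs_proj[OF nz] by (simp add: w')
  then obtain c where "\<And>i. i \<in> S' \<Longrightarrow> c i \<noteq> 0 \<and> rep_proj (w i) = c i *s eval_forms R (\<lambda>s. v (i + s))" by metis
  from form_val_rescale[OF reducedD(1,3)[OF R'] this]
  show ?thesis by (simp add: eval_forms_form_val form_val_comp)
qed

lemma generic_regional:
  fixes R R' :: "'n::finite \<Rightarrow> 'n mpoly"
  assumes R: "reduced S R" and R': "reduced S' R'" and nz: "comp_form R' R k \<noteq> 0" and h: "h \<noteq> 0"
  shows "\<exists>x v w. (\<forall>i. x i \<noteq> 0) \<and> v = (\<lambda>i. abs_proj (x i)) \<and> eval_mpoly x h \<noteq> 0 \<and>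
    regional_map (ratio_class S R) S' v = Some w \<and> eval_forms R' w \<noteq> 0 \<and> eval_forms (comp_form R' R) v \<noteq> 0"
proof -
  obtain a where a: "R a \<noteq> 0" using forms_on_nonzero[OF reducedD(3)[OF R]] by blast
  let ?P = "range (\<lambda>i. shift i (R a)) \<union> {comp_form R' R k, h}"
  have "countable ?P" by simp
  moreover have "0 \<notin> ?P" using a nz h shift_eq_0_iff[of _ "R a"] by auto
  ultimately obtain x where x: "\<And>i. x i \<noteq> 0" "\<And>p. p \<in> ?P \<Longrightarrow> eval_mpoly x p \<noteq> 0"
    using generic_vectors[of ?P] by blast
  define v where "v = (\<lambda>i. abs_proj (x i))"
  have C: "comp_form R' R \<in> forms_on (S + S')"
    by (rule comp_form_in_forms[OF reducedD(3)[OF R] reducedD(3,1)[OF R'] nz])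
  have fin: "finite (S + S')" using reducedD(1)[OF R] reducedD(1)[OF R'] by (rule finite_set_plus)
  have "eval_forms R (\<lambda>s. v (i + s)) \<noteq> 0" for i
  proof -
    obtain l where l: "l \<noteq> 0" "eval_forms R (\<lambda>s. v (i + s)) = l *s form_val R (\<lambda>s. x (i + s))"
      unfolding v_def using form_val_points[OF reducedD(1,3)[OF R], of x "\<lambda>s. i + s"] x(1) by blast
    have "form_val R (\<lambda>s. x (i + s)) $ a \<noteq> 0" using x(2)[of "shift i (R a)"] by (simp add: form_val_def eval_shift)
    then have "eval_forms R (\<lambda>s. v (i + s)) $ a \<noteq> 0" using l by simp
    then show ?thesis by (metis zero_index)
  qed
  then obtain w where w: "regional_map (ratio_class S R) S' v = Some w" by (simp add: regional_map_reduced[OF R])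
  obtain l where l: "l \<noteq> 0" "eval_forms (comp_form R' R) v = l *s form_val (comp_form R' R) x"
    unfolding v_def using form_val_points[OF fin C, of x "\<lambda>s. s"] x(1) by blast
  have "form_val (comp_form R' R) x $ k \<noteq> 0" using x(2)[of "comp_form R' R k"] by (simp add: form_val_def)
  then have "eval_forms (comp_form R' R) v $ k \<noteq> 0" using l by simp
  then have cnz: "eval_forms (comp_form R' R) v \<noteq> 0" by (metis zero_index)
  obtain m where "m \<noteq> 0" "eval_forms R' w = m *s eval_forms (comp_form R' R) v"
    using eval_forms_regional[OF R R' w] by blast
  then have "eval_forms R' w \<noteq> 0" using cnz by (simp add: vector_mul_eq_0)
  then show ?thesis using x w cnz v_def by (intro exI[of _ x] exI[of _ v] exI[of _ w]) simp
qed

lemma composable_rules_iff: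
  assumes R: "reduced S R" and R': "reduced S' R'"
  shows "composable_rules S' (ratio_class S' R') (ratio_class S R) \<longleftrightarrow> (\<exists>k. comp_form R' R k \<noteq> 0)"
proof
  assume "composable_rules S' (ratio_class S' R') (ratio_class S R)"
  then obtain v w where w: "regional_map (ratio_class S R) S' v = Some w" "eval_forms R' w \<noteq> 0"
    unfolding composable_rules_def ran_def using Ind_reduced[OF R'] by auto
  then have "eval_forms (comp_form R' R) v \<noteq> 0" using eval_forms_regional[OF R R' w(1)] by auto
  moreover have "eval_forms (comp_form R' R) v = 0" if "\<forall>k. comp_form R' R k = 0"
    using that by (simp add: eval_forms_def vector_eq_iff eval_mpoly_evl)
  ultimately show "\<exists>k. comp_form R' R k \<noteq> 0" by blast
next
  assume "\<exists>k. comp_form R' R k \<noteq> 0"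
  then obtain k where k: "comp_form R' R k \<noteq> 0" by blast
  obtain v w where "regional_map (ratio_class S R) S' v = Some w" "eval_forms R' w \<noteq> 0"
    using generic_regional[OF R R' k, of 1] by auto
  then show "composable_rules S' (ratio_class S' R') (ratio_class S R)"
    unfolding composable_rules_def ran_def using Ind_reduced[OF R'] by auto
qed

text \<open>The form obtained by substitution has the required values wherever the composition is
  defined, and two forms with these values are parallel at generic configurations, hence
  proportional.\<close>

lemma rule_comp_eq:
  fixes R R' :: "'n::finite \<Rightarrow> 'n mpoly"
  assumes R: "reduced S R" and R': "reduced S' R'" and nz: "comp_form R' R k \<noteq> 0"
  shows "rule_comp S' (ratio_class S' R') S (ratio_class S R) = ratio_class (S + S') (comp_form R' R)"
  unfolding rule_comp_def
proof (rule the_equality)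
  let ?C = "comp_form R' R"
  have C: "?C \<in> forms_on (S + S')"
    by (rule comp_form_in_forms[OF reducedD(3)[OF R] reducedD(3,1)[OF R'] nz])
  have val: "eval_forms ?C v \<noteq> 0 \<and> rat_apply (ratio_class S' R') w = abs_proj (eval_forms ?C v)"
    if w: "regional_map (ratio_class S R) S' v = Some w" "w \<notin> Ind (ratio_class S' R')" for v w
  proof -
    obtain l where l: "l \<noteq> 0" "eval_forms R' w = l *s eval_forms ?C v" using eval_forms_regional[OF R R' w(1)] by blast
    have "eval_forms R' w \<noteq> 0" using w(2) Ind_reduced[OF R'] by blast
    then show ?thesis using l rat_apply_eq[OF reducedD(3)[OF R'], of w] abs_proj_scale[of "eval_forms ?C v" l] by auto
  qed
  show "ratio_class (S + S') ?C \<in> rational_maps (S + S') \<and>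
    (\<forall>v w. regional_map (ratio_class S R) S' v = Some w \<and> w \<notin> Ind (ratio_class S' R') \<longrightarrow>
      v \<notin> Ind (ratio_class (S + S') ?C) \<and> rat_apply (ratio_class (S + S') ?C) v = rat_apply (ratio_class S' R') w)"
    using val C not_Ind[OF C] rat_apply_eq[OF C] by (auto simp: rational_maps_eq)
  fix \<psi> assume psi: "\<psi> \<in> rational_maps (S + S') \<and>
    (\<forall>v w. regional_map (ratio_class S R) S' v = Some w \<and> w \<notin> Ind (ratio_class S' R') \<longrightarrow>
      v \<notin> Ind \<psi> \<and> rat_apply \<psi> v = rat_apply (ratio_class S' R') w)"
  have fin: "finite (S + S')" "S + S' \<noteq> {}"
    using finite_set_plus[OF reducedD(1)[OF R] reducedD(1)[OF R']] reducedD(2)[OF R] reducedD(2)[OF R']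
    by (auto simp: set_plus_def)
  then obtain Q where Q: "reduced (S + S') Q" "\<psi> = ratio_class (S + S') Q"
    using psi local_rule_iff[of "S + S'" \<psi>] by (auto simp: local_rule_def)
  have "same_ratio Q ?C"
  proof (rule ccontr)
    assume "\<not> same_ratio Q ?C"
    then obtain j l where jl: "Q j * ?C l - Q l * ?C j \<noteq> 0" by (auto simp: same_ratio_def)
    obtain x v w where x: "\<And>i. x i \<noteq> 0" "v = (\<lambda>i. abs_proj (x i))" "eval_mpoly x (Q j * ?C l - Q l * ?C j) \<noteq> 0"
      and w: "regional_map (ratio_class S R) S' v = Some w" "eval_forms R' w \<noteq> 0" "eval_forms ?C v \<noteq> 0"
      using generic_regional[OF R R' nz jl] by blast
    have wI: "w \<notin> Ind (ratio_class S' R')" using w(2) Ind_reduced[OF R'] by blast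
    then have "v \<notin> Ind \<psi>" "rat_apply \<psi> v = rat_apply (ratio_class S' R') w" using psi w(1) by blast+
    then have q: "eval_forms Q v \<noteq> 0" "abs_proj (eval_forms Q v) = abs_proj (eval_forms ?C v)"
      using Ind_reduced[OF Q(1)] rat_apply_eq[OF reducedD(3)[OF Q(1)], of v] val[OF w(1) wI] Q(2) by auto
    then have par: "parallel (eval_forms Q v) (eval_forms ?C v)" using abs_proj_eq_iff[OF q(1) w(3)] by blast
    obtain a b where ab: "a \<noteq> 0" "eval_forms Q v = a *s form_val Q x" "b \<noteq> 0" "eval_forms ?C v = b *s form_val ?C x"
      unfolding x(2) using form_val_points[OF fin(1) reducedD(3)[OF Q(1)], of x "\<lambda>s. s"]
        form_val_points[OF fin(1) C, of x "\<lambda>s. s"] x(1) by blast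
    then have "parallel (form_val Q x) (form_val ?C x)" using par by (simp add: parallel_scale)
    then show False using x(3) by (simp add: eval_cross parallel_def)
  qed
  then show "\<psi> = ratio_class (S + S') ?C" using ratio_class_eqI[OF reducedD(3)[OF Q(1)] C] Q(2) by simp
qed

text \<open>By multihomogeneity a common factor of the inner form can be taken out of the composition,
  at the price of a product of powers of its shifts.\<close>

lemma form_val_comp_multiple:
  fixes F F' :: "'n::finite \<Rightarrow> 'n mpoly"
  assumes F': "finite S'" "F' \<in> forms_on S'" and G: "\<And>k. G k = g * F k" and G': "\<And>k. G' k = Con c * F' k"
  shows "\<exists>l. form_val (comp_form G' G) x = l *s form_val (comp_form F' F) x"
proof -
  have Gx: "form_val G y = eval_mpoly y g *s form_val F y" for y
    by (simp add: form_val_def vector_eq_iff G eval_mpoly_evl ring_hom_funD(4)[OF ring_hom_evl])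
  have G'x: "form_val G' y = c *s form_val F' y" for y
    by (simp add: form_val_def vector_eq_iff G' eval_mpoly_evl ring_hom_funD(4)[OF ring_hom_evl])
  obtain d where d: "\<And>c x. form_val F' (\<lambda>i. c i *s x i) = (\<Prod>i\<in>S'. c i ^ d i) *s form_val F' x"
    using form_val_scale[OF F'] by blast
  have "form_val (comp_form G' G) x = (c * (\<Prod>i\<in>S'. eval_mpoly (\<lambda>s. x (i + s)) g ^ d i)) *s form_val (comp_form F' F) x"
    unfolding form_val_comp G'x Gx d[of "\<lambda>i. eval_mpoly (\<lambda>s. x (i + s)) g" "\<lambda>i. form_val F (\<lambda>s. x (i + s))"]
    by (simp add: vector_smult_assoc)
  then show ?thesis ..
qed

lemma comp_form_same_ratio:
  fixes F F' :: "'n::finite \<Rightarrow> 'n mpoly"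
  assumes "finite S'" "F' \<in> forms_on S'" "\<And>k. G k = g * F k" "\<And>k. G' k = Con c * F' k"
  shows "same_ratio (comp_form F' F) (comp_form G' G)"
proof (rule same_ratioI)
  fix x :: "int \<Rightarrow> complex^'n"
  obtain l where "form_val (comp_form G' G) x = l *s form_val (comp_form F' F) x"
    using form_val_comp_multiple[OF assms(1,2), of G g F G' c x] assms(3,4) by blast
  then show "parallel (form_val (comp_form F' F) x) (form_val (comp_form G' G) x)"
    by (simp add: parallel_def)
qed

lemma reduced_comp_exists:
  fixes R R' :: "'n::finite \<Rightarrow> 'n mpoly"
  assumes R: "reduced S R" and R': "reduced S' R'" and nz: "comp_form R' R k \<noteq> 0"
  shows "\<exists>C. reduced (S + S') C \<and> same_ratio C (comp_form R' R) \<and>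
    lattice_map (rule_comp S' (ratio_class S' R') S (ratio_class S R)) = form_map C"
proof -
  have f: "comp_form R' R \<in> forms_on (S + S')"
    by (rule comp_form_in_forms[OF reducedD(3)[OF R] reducedD(3,1)[OF R'] nz])
  obtain C where C: "C \<in> forms_on (S + S')" "no_common_factor C" "same_ratio C (comp_form R' R)"
    using reduced_exists[OF f] by blast
  have "finite (S + S')" "S + S' \<noteq> {}"
    using finite_set_plus[OF reducedD(1)[OF R] reducedD(1)[OF R']] reducedD(2)[OF R] reducedD(2)[OF R']
    by (auto simp: set_plus_def)
  then have red: "reduced (S + S') C" using C by (simp add: reduced_def)
  then show ?thesis
    using C rule_comp_eq[OF R R' nz] ratio_class_eqI[OF C(1) f C(3)] lattice_map_reduced[OF red] by metis
qed

text \<open>Different local rules of the same lattice maps consist of forms that differ by constants,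
  so their compositions have proportional forms, and these have the same reduced form.\<close>

lemma lattice_comp_form_map:
  fixes R R' C :: "'n::finite \<Rightarrow> 'n mpoly"
  assumes R: "reduced S R" and R': "reduced S' R'" and nz: "comp_form R' R k \<noteq> 0"
    and C: "reduced X C" "same_ratio C (comp_form R' R)"
  shows "lattice_comp (form_map R') (form_map R) = form_map C"
proof -
  have unique: "form_map C1 = form_map C"
    if R1: "reduced S1 R1" "form_map R = form_map R1" and R1': "reduced S1' R1'" "form_map R' = form_map R1'"
      and k1: "comp_form R1' R1 k1 \<noteq> 0" and C1: "reduced X1 C1" "same_ratio C1 (comp_form R1' R1)"
    for S1 R1 S1' R1' k1 X1 C1
  proof -
    obtain c where c: "\<And>k. R1 k = Con c * R k" using same_local_rule[OF R R1] by blast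
    obtain c' where c': "\<And>k. R1' k = Con c' * R' k" using same_local_rule[OF R' R1'] by blast
    have "same_ratio (comp_form R' R) (comp_form R1' R1)"
      by (rule comp_form_same_ratio[OF reducedD(1,3)[OF R'] c c'])
    then have "same_ratio C (comp_form R1' R1)" using same_ratio_trans[OF C(2) _ nz] by blast
    then have "same_ratio C C1" using same_ratio_trans[OF _ same_ratio_sym[OF C1(2)] k1] by blast
    then obtain e where "e \<noteq> 0" "\<And>k. C1 k = Con e * C k" using reduced_unique[OF C(1) C1(1)] by blast
    then show ?thesis by (rule form_map_multiple)
  qed
  have ex: "\<exists>C1 X1. reduced X1 C1 \<and> same_ratio C1 (comp_form R1' R1) \<and>
      lattice_map (rule_comp S1' (ratio_class S1' R1') S1 (ratio_class S1 R1)) = form_map C1"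
    if "reduced S1 R1" "reduced S1' R1'" "comp_form R1' R1 k1 \<noteq> 0" for S1 S1' k1 and R1 R1' :: "'n \<Rightarrow> 'n mpoly"
    using reduced_comp_exists[OF that] by blast
  show ?thesis unfolding lattice_comp_def
  proof (rule the_equality)
    obtain C1 X1 where C1: "reduced X1 C1" "same_ratio C1 (comp_form R' R)"
      "lattice_map (rule_comp S' (ratio_class S' R') S (ratio_class S R)) = form_map C1" using ex[OF R R' nz] by blast
    have "form_map C = lattice_map (rule_comp S' (ratio_class S' R') S (ratio_class S R))"
      using unique[OF R refl R' refl nz C1(1,2)] C1(3) by simp
    moreover have "composable_rules S' (ratio_class S' R') (ratio_class S R)" using composable_rules_iff[OF R R'] nz by blast
    ultimately show "\<exists>S \<phi> S' \<phi>'. has_local_rule (form_map R) S \<phi> \<and> has_local_rule (form_map R') S' \<phi>' \<and>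
        composable_rules S' \<phi>' \<phi> \<and> form_map C = lattice_map (rule_comp S' \<phi>' S \<phi>)"
      using R R' unfolding has_local_rule_iff by metis
  next
    fix T assume "\<exists>S \<phi> S' \<phi>'. has_local_rule (form_map R) S \<phi> \<and> has_local_rule (form_map R') S' \<phi>' \<and>
        composable_rules S' \<phi>' \<phi> \<and> T = lattice_map (rule_comp S' \<phi>' S \<phi>)"
    then obtain S1 R1 S1' R1' where R1: "reduced S1 R1" "form_map R = form_map R1"
      and R1': "reduced S1' R1'" "form_map R' = form_map R1'"
      and comp: "composable_rules S1' (ratio_class S1' R1') (ratio_class S1 R1)"
      and T: "T = lattice_map (rule_comp S1' (ratio_class S1' R1') S1 (ratio_class S1 R1))"
      unfolding has_local_rule_iff by auto
    obtain k1 where k1: "comp_form R1' R1 k1 \<noteq> 0" using composable_rules_iff[OF R1(1) R1'(1)] comp by blast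
    obtain C1 X1 where C1: "reduced X1 C1" "same_ratio C1 (comp_form R1' R1)"
      "lattice_map (rule_comp S1' (ratio_class S1' R1') S1 (ratio_class S1 R1)) = form_map C1"
      using ex[OF R1(1) R1'(1) k1] by blast
    show "T = form_map C" using unique[OF R1 R1' k1 C1(1,2)] C1(3) T by simp
  qed
qed

section \<open>Iteration\<close>

text \<open>The composed forms are never divided by their common factors, so their degrees say
  little about the degrees of the iterates.  They serve to evaluate iterates at configurations.\<close>

primrec iter_form :: "('n::finite \<Rightarrow> 'n mpoly) \<Rightarrow> nat \<Rightarrow> 'n \<Rightarrow> 'n mpoly" where
  "iter_form R 0 = (\<lambda>k. Var (0, k))"
| "iter_form R (Suc m) = comp_form R (iter_form R m)"

lemma identity_reduced: "reduced {0} (\<lambda>k :: 3. Var (0, k))"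
proof -
  have nz: "Var (0, k) \<noteq> (0 :: 3 mpoly)" for k using vars_Var[of "(0 :: int, k)"] by (metis insert_not_empty vars_0)
  have "homogeneous (site i) (if i = 0 then 1 else 0) (Var (0, k) :: 3 mpoly)" for i k
    using homogeneous_Var[of "site i" "(0, k)"] by (simp add: site_def)
  then have "\<exists>d. \<forall>k i. homogeneous (site i) (d i) (Var (0, k) :: 3 mpoly)"
    by (intro exI[of _ "\<lambda>i. if i = 0 then 1 else 0"] allI)
  then have "(\<lambda>k :: 3. Var (0, k)) \<in> forms_on {0}" using nz by (auto simp: forms_on_iff)
  moreover have "no_common_factor (\<lambda>k :: 3. Var (0, k))" unfolding no_common_factor_def
  proof (intro allI impI)
    fix g :: "3 mpoly" assume g: "\<forall>k. g dvd Var (0, k)"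
    have v: "g \<noteq> 0 \<and> vars g \<subseteq> {(0, k)}" for k
    proof -
      obtain r where r: "Var (0, k) = g * r" using g unfolding dvd_def by blast
      then have "vars g \<subseteq> vars (Var (0, k) :: 3 mpoly)" using nz[of k] vars_factor[of g r] by metis
      moreover have "g \<noteq> 0" using r nz[of k] by auto
      ultimately show ?thesis by simp
    qed
    have "vars g = {}" using v[of 1] v[of 2] by auto
    then have "g = Con (lookup g 0)" by (rule vars_empty_Con)
    then show "g dvd 1" using v Con_dvd_1 by (metis Con_eq_0_iff)
  qed
  ultimately show ?thesis by (simp add: reduced_def)
qed

lemma form_map_identity: "form_map (\<lambda>k. Var (0, k)) = Some"
proof
  fix v :: "'n::finite config"
  have "eval_forms (\<lambda>k. Var (0, k)) (\<lambda>s. v (i + s)) = rep_proj (v i)" for i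
    by (simp add: eval_forms_def eval_mpoly_evl ring_hom_fun_id vector_eq_iff)
  then show "form_map (\<lambda>k. Var (0, k)) v = Some v" by (simp add: form_map_def)
qed

text \<open>In each step the reduced form \<open>C\<close> of the iterate takes the place of the composed form.  This
  only removes a common factor from the next composition (\<open>form_val_comp_multiple\<close>), which therefore
  remains nonzero and proportional to the composed form.\<close>

lemma lattice_iter_form_map:
  fixes R :: "3 \<Rightarrow> 3 mpoly"
  assumes R: "reduced S R" and nz: "\<And>m. \<exists>k. iter_form R m k \<noteq> 0"
  shows "\<exists>X C. reduced X C \<and> lattice_iter (form_map R) m = form_map C \<and> same_ratio C (iter_form R m) \<and>
    (\<exists>k. comp_form R C k \<noteq> 0)"
proof -
  have step: "\<exists>k. comp_form R C k \<noteq> 0" "same_ratio (comp_form R C) (iter_form R (Suc m))"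
    if C: "reduced X C" "same_ratio C (iter_form R m)" for X C m
  proof -
    obtain k where k: "C k \<noteq> 0" using forms_on_nonzero[OF reducedD(3)[OF C(1)]] by blast
    obtain g where g: "\<And>k. iter_form R m k = g * C k" using reduced_dvd[OF reducedD(4)[OF C(1)] C(2) k] by blast
    have one: "R k = Con 1 * R k" for k by (simp add: ring_hom_funD(2)[OF ring_hom_Con])
    have mult: "\<exists>l. form_val (iter_form R (Suc m)) x = l *s form_val (comp_form R C) x" for x
      unfolding iter_form.simps by (rule form_val_comp_multiple[OF reducedD(1,3)[OF R]]) (rule g, rule one)
    show "same_ratio (comp_form R C) (iter_form R (Suc m))"
      unfolding iter_form.simps by (rule comp_form_same_ratio[OF reducedD(1,3)[OF R]]) (rule g, rule one)
    show "\<exists>k. comp_form R C k \<noteq> 0"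
    proof (rule ccontr)
      assume "\<nexists>k. comp_form R C k \<noteq> 0"
      then have "form_val (comp_form R C) x = 0" for x
        by (simp add: form_val_def eval_mpoly_evl vector_eq_iff)
      then have z: "form_val (iter_form R (Suc m)) x = 0" for x using mult[of x] by auto
      have "iter_form R (Suc m) k = 0" for k
      proof (rule eval_ext)
        fix x have "form_val (iter_form R (Suc m)) x $ k = 0" unfolding z by simp
        then show "eval_mpoly x (iter_form R (Suc m) k) = 0" by (simp add: form_val_def)
      qed
      then show False using nz[of "Suc m"] by blast
    qed
  qed
  have "\<exists>X C. reduced X C \<and> lattice_iter (form_map R) m = form_map C \<and> same_ratio C (iter_form R m)"
  proof (induction m)
    case 0
    show ?case using identity_reduced same_ratio_refl[of "\<lambda>k :: 3. Var (0, k)"]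
      by (intro exI[of _ "{0}"] exI[of _ "\<lambda>k. Var (0, k)"]) (simp add: form_map_identity)
  next
    case (Suc m)
    then obtain X C where C: "reduced X C" "lattice_iter (form_map R) m = form_map C" "same_ratio C (iter_form R m)" by blast
    obtain k where k: "comp_form R C k \<noteq> 0" using step(1)[OF C(1,3)] by blast
    obtain D where D: "reduced (X + S) D" "same_ratio D (comp_form R C)" using reduced_comp_exists[OF C(1) R k] by blast
    have "lattice_iter (form_map R) (Suc m) = form_map D" using lattice_comp_form_map[OF C(1) R k D] C(2) by simp
    moreover have "same_ratio D (iter_form R (Suc m))" using same_ratio_trans[OF D(2) step(2)[OF C(1,3)] k] .
    ultimately show ?case using D(1) by blast
  qed
  then show ?thesis using step(1) by blast
qed

lemma iterable_form_map:
  fixes R :: "3 \<Rightarrow> 3 mpoly"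
  assumes R: "reduced S R" and nz: "\<And>m. \<exists>k. iter_form R m k \<noteq> 0"
  shows "iterable (form_map R)"
  unfolding iterable_def
proof
  fix m
  obtain X C where C: "reduced X C" "lattice_iter (form_map R) m = form_map C" "\<exists>k. comp_form R C k \<noteq> 0"
    using lattice_iter_form_map[OF R nz] by blast
  then show "composable (form_map R) (lattice_iter (form_map R) m)"
    unfolding composable_def C(2) has_local_rule_iff using R composable_rules_iff[OF C(1) R] by blast
qed

section \<open>Lines in the plane\<close>

text \<open>Adding one or two to an index of type \<open>3\<close> permutes the coordinates cyclically.\<close>

definition cross :: "(3 \<Rightarrow> 'a::comm_ring_1) \<Rightarrow> (3 \<Rightarrow> 'a) \<Rightarrow> 3 \<Rightarrow> 'a" where
  "cross u w k = u (k + 1) * w (k + 2) - u (k + 2) * w (k + 1)"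

definition det3 :: "(3 \<Rightarrow> 'a::comm_ring_1) \<Rightarrow> (3 \<Rightarrow> 'a) \<Rightarrow> (3 \<Rightarrow> 'a) \<Rightarrow> 'a" where
  "det3 u v w = (\<Sum>k\<in>UNIV. u k * cross v w k)"

definition vcross :: "complex^3 \<Rightarrow> complex^3 \<Rightarrow> complex^3" where
  "vcross u w = (\<chi> k. cross (\<lambda>k. u $ k) (\<lambda>k. w $ k) k)"

definition dot :: "complex^3 \<Rightarrow> complex^3 \<Rightarrow> complex" where
  "dot u w = (\<Sum>k\<in>UNIV. u $ k * w $ k)"

definition vdet :: "complex^3 \<Rightarrow> complex^3 \<Rightarrow> complex^3 \<Rightarrow> complex" where
  "vdet u v w = dot u (vcross v w)"

definition meet :: "complex^3 \<Rightarrow> complex^3 \<Rightarrow> complex^3 \<Rightarrow> complex^3 \<Rightarrow> complex^3" where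
  "meet p q r s = vcross (vcross p q) (vcross r s)"

lemma index_wraparound: "(4 :: 3) = 1" "(5 :: 3) = 2" "(6 :: 3) = 3" "(7 :: 3) = 1"
  by simp_all

lemmas coord_simps = index_wraparound vdet_def dot_def vcross_def cross_def meet_def sum_3 vector_eq_iff forall_3

lemma vcross_eq_0_iff: "vcross u w = 0 \<longleftrightarrow> parallel u w"
  by (auto simp: coord_simps parallel_def algebra_simps)

lemma vcross_scale: "vcross (a *s u) (b *s w) = (a * b) *s vcross u w"
  by (simp add: coord_simps algebra_simps)

lemma vcross_vcross: "vcross (vcross n m) z = dot n z *s m - dot m z *s n"
  by (simp add: coord_simps algebra_simps)

lemma dot_vcross [simp]: "dot (vcross u w) u = 0" "dot (vcross u w) w = 0" "dot u (vcross u w) = 0" "dot w (vcross u w) = 0"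
  by (simp_all add: coord_simps algebra_simps)

lemma dot_scale: "dot n (c *s z) = c * dot n z" "dot (c *s n) z = c * dot n z"
  by (simp_all add: coord_simps algebra_simps)

lemma dot_add: "dot n (y + z) = dot n y + dot n z"
  by (simp add: coord_simps algebra_simps)

text \<open>Cramer's rule for the coordinates of \<open>z\<close> with respect to \<open>x\<close>, \<open>y\<close> and a unit vector.  If
  \<open>z\<close> is orthogonal to the normal vector of the plane of \<open>x\<close> and \<open>y\<close>, it exhibits \<open>z\<close> in their
  span.\<close>

lemma vcross_expand: "vcross x y $ k *s z = vcross z y $ k *s x + vcross x z $ k *s y + dot (vcross x y) z *s axis k 1"
  using exhaust_3[of k] by (auto simp: coord_simps axis_def algebra_simps)

lemma meet_scale: "meet (a *s p) (b *s q) (c *s r) (d *s s) = (a * b * (c * d)) *s meet p q r s"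
  by (simp add: meet_def vcross_scale)

lemma mem_span_pair: "z \<in> vec.span {x, y} \<longleftrightarrow> (\<exists>s t. z = s *s x + t *s y)" for x y z :: "complex^'n"
proof -
  have "z \<in> vec.span {x, y} \<longleftrightarrow> (\<exists>s t. z - s *s x - t *s y = 0)"
    by (simp add: vec.span_breakdown_eq)
  then show ?thesis by (simp add: algebra_simps eq_diff_eq)
qed

lemma span_pair_iff:
  assumes "vcross x y \<noteq> 0" shows "z \<in> vec.span {x, y} \<longleftrightarrow> dot (vcross x y) z = 0"
proof
  assume "z \<in> vec.span {x, y}"
  then show "dot (vcross x y) z = 0" by (auto simp: mem_span_pair dot_add dot_scale)
next
  assume 0: "dot (vcross x y) z = 0"
  obtain k where k: "vcross x y $ k \<noteq> 0" using assms by (auto simp: vector_eq_iff)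
  define n where "n = vcross x y $ k"
  have e: "n *s z = vcross z y $ k *s x + vcross x z $ k *s y"
    unfolding n_def using vcross_expand[of x y k z] 0 by simp
  have "z = (1 / n) *s (n *s z)" using k by (simp add: n_def vector_smult_assoc)
  also have "\<dots> = (vcross z y $ k / n) *s x + (vcross x z $ k / n) *s y"
    unfolding e by (simp add: vector_eq_iff field_simps)
  finally show "z \<in> vec.span {x, y}" unfolding mem_span_pair by blast
qed

lemma proj_line_iff:
  "vcross (rep_proj p) (rep_proj q) \<noteq> 0 \<Longrightarrow> r \<in> proj_line p q \<longleftrightarrow> dot (vcross (rep_proj p) (rep_proj q)) (rep_proj r) = 0"
  by (simp add: proj_line_def span_pair_iff)

lemma proj_neq_iff: "p \<noteq> q \<longleftrightarrow> vcross (rep_proj p) (rep_proj q) \<noteq> 0" for p q :: "3 proj"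
  unfolding vcross_eq_0_iff using abs_proj_eq_iff[of "rep_proj p" "rep_proj q"] by simp

lemma proj_line_eq_iff:
  fixes p q r s :: "3 proj"
  assumes "p \<noteq> q" "r \<noteq> s"
  shows "proj_line p q = proj_line r s \<longleftrightarrow> meet (rep_proj p) (rep_proj q) (rep_proj r) (rep_proj s) = 0"
proof -
  define n m where "n = vcross (rep_proj p) (rep_proj q)" and "m = vcross (rep_proj r) (rep_proj s)"
  have nz: "n \<noteq> 0" "m \<noteq> 0" using assms proj_neq_iff unfolding n_def m_def by auto
  have L: "x \<in> proj_line p q \<longleftrightarrow> dot n (rep_proj x) = 0" "x \<in> proj_line r s \<longleftrightarrow> dot m (rep_proj x) = 0" for x
    using proj_line_iff nz unfolding n_def m_def by auto
  have "proj_line p q = proj_line r s \<longleftrightarrow> vcross n m = 0"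
  proof
    assume eq: "proj_line p q = proj_line r s"
    have "p \<in> proj_line p q" "q \<in> proj_line p q" unfolding L by (simp_all add: n_def)
    then have "dot m (rep_proj p) = 0" "dot m (rep_proj q) = 0" unfolding eq L by simp_all
    moreover have "dot m u = dot u m" for u by (simp add: dot_def mult.commute)
    ultimately show "vcross n m = 0" unfolding n_def vcross_vcross by simp
  next
    assume "vcross n m = 0"
    then obtain c where c: "m = c *s n" using vcross_eq_0_iff parallel_iff[OF nz(1)] by blast
    then have "c \<noteq> 0" using nz(2) by auto
    then have "x \<in> proj_line p q \<longleftrightarrow> x \<in> proj_line r s" for x unfolding L c by (simp add: dot_scale)
    then show "proj_line p q = proj_line r s" by blast
  qed
  then show ?thesis by (simp add: meet_def n_def m_def)
qed

lemma proj_line_meet: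
  fixes p q r s :: "3 proj"
  defines "z \<equiv> meet (rep_proj p) (rep_proj q) (rep_proj r) (rep_proj s)"
  assumes nz: "z \<noteq> 0"
  shows "(THE x. x \<in> proj_line p q \<inter> proj_line r s) = abs_proj z"
proof -
  define n m where "n = vcross (rep_proj p) (rep_proj q)" and "m = vcross (rep_proj r) (rep_proj s)"
  have z: "z = vcross n m" by (simp add: z_def meet_def n_def m_def)
  have nm: "n \<noteq> 0" "m \<noteq> 0" using nz unfolding z by (auto simp: coord_simps)
  have L: "x \<in> proj_line p q \<inter> proj_line r s \<longleftrightarrow> dot n (rep_proj x) = 0 \<and> dot m (rep_proj x) = 0" for x
    using proj_line_iff nm unfolding n_def m_def by auto
  show ?thesis
  proof (rule the_equality)
    obtain c where "rep_proj (abs_proj z) = c *s z" using rep_abs_proj[OF nz] by blast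
    then show "abs_proj z \<in> proj_line p q \<inter> proj_line r s" unfolding L by (simp add: z dot_scale)
  next
    fix x assume "x \<in> proj_line p q \<inter> proj_line r s"
    then have "vcross z (rep_proj x) = 0" unfolding L z vcross_vcross by simp
    then have "parallel z (rep_proj x)" by (simp add: vcross_eq_0_iff)
    then show "x = abs_proj z" using abs_proj_eq_iff[OF nz, of "rep_proj x"] by simp
  qed
qed

section \<open>The form of a skew pentagram map\<close>

definition coord :: "int \<Rightarrow> 3 \<Rightarrow> 3 mpoly" where "coord i k = Var (i, k)"

definition skew_form :: "int \<Rightarrow> int \<Rightarrow> int \<Rightarrow> int \<Rightarrow> 3 \<Rightarrow> 3 mpoly" where
  "skew_form a b c d = cross (cross (coord a) (coord b)) (cross (coord c) (coord d))"

lemma eval_coord: "eval_mpoly x (coord i k) = x i $ k"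
  by (simp add: coord_def eval_mpoly_evl ring_hom_fun_id)

lemma eval_mpoly_hom:
  "eval_mpoly x (p * q) = eval_mpoly x p * eval_mpoly x q" "eval_mpoly x (p + q) = eval_mpoly x p + eval_mpoly x q"
  "eval_mpoly x (p - q) = eval_mpoly x p - eval_mpoly x q" "eval_mpoly x (- p) = - eval_mpoly x p"
  "eval_mpoly x (sum f A) = (\<Sum>a\<in>A. eval_mpoly x (f a))" "eval_mpoly x 0 = 0"
  using ring_hom_fun_diff[OF ring_hom_evl, of _ 0 p]
  by (simp_all add: eval_mpoly_evl ring_hom_funD[OF ring_hom_evl] ring_hom_fun_diff[OF ring_hom_evl] ring_hom_fun_sum[OF ring_hom_evl])

lemma form_val_skew: "form_val (skew_form a b c d) x = meet (x a) (x b) (x c) (x d)"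
  by (simp add: form_val_def skew_form_def meet_def vcross_def cross_def eval_mpoly_hom eval_coord)

lemma skew_pentagram_form_map: "skew_pentagram a b c d = form_map (skew_form a b c d)"
proof
  fix v
  let ?M = "\<lambda>i. meet (rep_proj (v (i + a))) (rep_proj (v (i + b))) (rep_proj (v (i + c))) (rep_proj (v (i + d)))"
  have e: "eval_forms (skew_form a b c d) (\<lambda>s. v (i + s)) = ?M i" for i
    by (simp add: eval_forms_form_val form_val_skew)
  have z: "vcross 0 u = 0" "vcross u 0 = 0" for u by (simp_all add: coord_simps)
  have c: "v (i + a) \<noteq> v (i + b) \<and> v (i + c) \<noteq> v (i + d) \<and>
      proj_line (v (i + a)) (v (i + b)) \<noteq> proj_line (v (i + c)) (v (i + d)) \<longleftrightarrow> ?M i \<noteq> 0" for i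
  proof (cases "v (i + a) \<noteq> v (i + b) \<and> v (i + c) \<noteq> v (i + d)")
    case True then show ?thesis using proj_line_eq_iff by simp
  next
    case False
    then have "vcross (rep_proj (v (i + a))) (rep_proj (v (i + b))) = 0 \<or> vcross (rep_proj (v (i + c))) (rep_proj (v (i + d))) = 0"
      using proj_neq_iff by blast
    then have "?M i = 0" by (auto simp: meet_def z)
    then show ?thesis using False by auto
  qed
  show "skew_pentagram a b c d v = form_map (skew_form a b c d) v"
    unfolding skew_pentagram_def form_map_def e c using proj_line_meet by auto
qed

text \<open>Put the partner of the point to be moved at one corner of the coordinate triangle and the
  other two points at the remaining corners.  When the point is moved to either of these two corners,
  the intersection of the lines is the point itself.\<close>

lemma skew_form_depends_on_each_site:
  assumes "distinct [a, b, c, d]" "s \<in> {a, b, c, d}"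
  shows "\<exists>x y. (\<forall>i. i \<noteq> s \<longrightarrow> x i = y i) \<and> \<not> parallel (form_val (skew_form a b c d) x) (form_val (skew_form a b c d) y)"
proof -
  let ?x = "\<lambda>p q r t i. if i = a then p else if i = b then q else if i = c then r else t :: complex^3"
  let ?e = "\<lambda>k::3. axis k (1::complex)"
  have v: "form_val (skew_form a b c d) (?x p q r t) = meet p q r t" for p q r t
    using assms(1) by (auto simp: form_val_skew)
  have np: "\<not> parallel (meet (?e 2) (?e 1) (?e 2) (?e 3)) (meet (?e 3) (?e 1) (?e 2) (?e 3))"
    "\<not> parallel (meet (?e 1) (?e 2) (?e 2) (?e 3)) (meet (?e 1) (?e 3) (?e 2) (?e 3))"
    "\<not> parallel (meet (?e 2) (?e 3) (?e 2) (?e 1)) (meet (?e 2) (?e 3) (?e 3) (?e 1))"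
    "\<not> parallel (meet (?e 2) (?e 3) (?e 1) (?e 2)) (meet (?e 2) (?e 3) (?e 1) (?e 3))"
    unfolding vcross_eq_0_iff[symmetric] by (simp_all add: coord_simps axis_def)
  consider "s = a" | "s = b" | "s = c" | "s = d" using assms(2) by blast
  then show ?thesis
  proof cases
    case 1 show ?thesis
      by (rule exI[of _ "?x (?e 2) (?e 1) (?e 2) (?e 3)"], rule exI[of _ "?x (?e 3) (?e 1) (?e 2) (?e 3)"], unfold v)
        (use np 1 in auto)
  next
    case 2 show ?thesis
      by (rule exI[of _ "?x (?e 1) (?e 2) (?e 2) (?e 3)"], rule exI[of _ "?x (?e 1) (?e 3) (?e 2) (?e 3)"], unfold v)
        (use np 2 in auto)
  next
    case 3 show ?thesis
      by (rule exI[of _ "?x (?e 2) (?e 3) (?e 2) (?e 1)"], rule exI[of _ "?x (?e 2) (?e 3) (?e 3) (?e 1)"], unfold v)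
        (use np 3 in auto)
  next
    case 4
    let ?y = "\<lambda>p q r t i. if i = d then t else if i = c then r else if i = b then q else p :: complex^3"
    have w: "form_val (skew_form a b c d) (?y p q r t) = meet p q r t" for p q r t
      using assms(1) by (auto simp: form_val_skew)
    show ?thesis
      by (rule exI[of _ "?y (?e 2) (?e 3) (?e 1) (?e 2)"], rule exI[of _ "?y (?e 2) (?e 3) (?e 1) (?e 3)"], unfold w)
        (use np 4 in auto)
  qed
qed

text \<open>The form has degree one at each of the four sites.  A common factor that involves a site uses
  up this degree, so the direction of the value would not depend on the vector at that site.\<close>

lemma skew_form_reduced:
  assumes dist: "distinct [a, b, c, d]" shows "reduced {a, b, c, d} (skew_form a b c d)"
proof -
  let ?F = "skew_form a b c d"
  have vars_cross: "vars (cross u w k) \<subseteq> V" if "\<And>k. vars (u k) \<subseteq> V" "\<And>k. vars (w k) \<subseteq> V" for u w :: "3 \<Rightarrow> 3 mpoly" and k V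
  proof -
    have "vars (u (k + 1) * w (k + 2)) \<subseteq> V" "vars (- (u (k + 2) * w (k + 1))) \<subseteq> V"
      using vars_mult[of "u (k + 1)" "w (k + 2)"] vars_mult[of "u (k + 2)" "w (k + 1)"] that by fastforce+
    then show ?thesis unfolding cross_def using vars_add[of "u (k + 1) * w (k + 2)" "- (u (k + 2) * w (k + 1))"] by auto
  qed
  have vars: "vars (?F k) \<subseteq> {a, b, c, d} \<times> UNIV" for k
    unfolding skew_form_def by (intro vars_cross) (auto simp: coord_def)
  have hom_cross: "homogeneous w (e + f) (cross u v k)"
    if "\<And>k. homogeneous w e (u k)" "\<And>k. homogeneous w f (v k)" for u v :: "3 \<Rightarrow> 3 mpoly" and k w e f
  proof -
    have "homogeneous w (e + f) (u (k + 1) * v (k + 2))" "homogeneous w (e + f) (u (k + 2) * v (k + 1))"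
      using that by (auto intro: homogeneous_mult)
    then have "homogeneous w (e + f) (u (k + 1) * v (k + 2) + - (u (k + 2) * v (k + 1)))"
      by (intro homogeneous_add) simp_all
    then show ?thesis by (simp add: cross_def)
  qed
  define dg where "dg i = site i (a, 1 :: 3) + site i (b, 1 :: 3) + (site i (c, 1 :: 3) + site i (d, 1 :: 3))" for i
  have coord: "homogeneous (site i) (site i (s, 1 :: 3)) (coord s k)" for i s k
    using homogeneous_Var[of "site i" "(s, k)"] by (simp add: coord_def site_def)
  have hom: "homogeneous (site i) (dg i) (?F k)" for i k
    unfolding skew_form_def dg_def by (intro hom_cross coord)
  have dg1: "dg s = 1" if "s \<in> {a, b, c, d}" for s using that dist by (auto simp: dg_def site_def)
  obtain x y where "\<not> parallel (form_val ?F x) (form_val ?F y)"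
    using skew_form_depends_on_each_site[OF dist, of a] by blast
  then have ex: "\<exists>k. ?F k \<noteq> 0"
    by (auto simp: parallel_def form_val_def eval_mpoly_hom) (metis eval_mpoly_hom(6) mult_zero_left mult_zero_right)
  have "?F \<in> forms_on {a, b, c, d}" unfolding forms_on_iff using ex vars hom by blast
  moreover have "no_common_factor ?F" unfolding no_common_factor_def
  proof (intro allI impI)
    fix g assume "\<forall>k. g dvd ?F k"
    then have "\<forall>k. \<exists>r. ?F k = g * r" unfolding dvd_def by blast
    then obtain R where R: "\<And>k. ?F k = g * R k" by metis
    obtain k0 where k0: "?F k0 \<noteq> 0" using ex by blast
    have g0: "g \<noteq> 0" using R[of k0] k0 by auto
    have "vars g \<subseteq> vars (?F k0)" using vars_factor[of g "R k0"] k0 R[of k0] by simp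
    then have vg: "vars g \<subseteq> {a, b, c, d} \<times> UNIV" using vars[of k0] by (rule order_trans)
    have "vars g = {}"
    proof (rule ccontr)
      assume "vars g \<noteq> {}"
      then obtain v where v: "v \<in> vars g" by blast
      define s where "s = fst v"
      have s: "s \<in> {a, b, c, d}" using v vg by (auto simp: s_def)
      have Rs: "u \<notin> vars (R k)" if u: "fst u = s" for u k
      proof (cases "R k = 0")
        case False
        then have "g * R k \<noteq> 0" using g0 cpoly_no_zero_divisors[of g "R k"] by blast
        then obtain e f where ef: "e + f = dg s" "homogeneous (site s) e g" "homogeneous (site s) f (R k)"
          using homogeneous_factor[of "site s" "dg s" g "R k"] hom[of s k] R[of k] by auto
        have pos: "0 < weight (site s) m" if "t \<in> keys m" "fst t = s" for t :: "int \<times> 3" and m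
        proof -
          have "site s t * lookup m t \<le> weight (site s) m"
            unfolding weight_def using that by (intro member_le_sum) auto
          then show ?thesis using that by (auto simp: site_def in_keys_iff)
        qed
        obtain m where m: "m \<in> keys g" "v \<in> keys m" using v by (auto simp: vars_def)
        have "0 < e" using pos[OF m(2)] m(1) ef(2) by (auto simp: homogeneous_def s_def)
        then have "f = 0" using ef(1) dg1[OF s] by simp
        then show ?thesis using ef(3) pos u by (fastforce simp: homogeneous_def vars_def)
      qed simp
      obtain x y where xy: "\<forall>i. i \<noteq> s \<longrightarrow> x i = y i" "\<not> parallel (form_val ?F x) (form_val ?F y)"
        using skew_form_depends_on_each_site[OF dist s] by blast
      have Rxy: "eval_mpoly x (R k) = eval_mpoly y (R k)" for k
        unfolding eval_mpoly_evl using Rs xy(1) by (intro pval_cong) metis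
      have "parallel (form_val ?F x) (form_val ?F y)"
        by (simp add: parallel_def form_val_def R eval_mpoly_hom Rxy)
      then show False using xy(2) by blast
    qed
    then have "g = Con (lookup g 0)" by (rule vars_empty_Con)
    then show "g dvd 1" using g0 Con_dvd_1 by (metis Con_eq_0_iff)
  qed
  ultimately show ?thesis by (simp add: reduced_def)
qed

section \<open>Orbits\<close>

text \<open>The values of the composed forms: homogeneous coordinates of the iterates.\<close>

primrec orbit :: "int \<Rightarrow> int \<Rightarrow> int \<Rightarrow> int \<Rightarrow> (int \<Rightarrow> complex^3) \<Rightarrow> nat \<Rightarrow> int \<Rightarrow> complex^3" where
  "orbit a b c d x 0 = x"
| "orbit a b c d x (Suc m) = (\<lambda>i. meet (orbit a b c d x m (i + a)) (orbit a b c d x m (i + b))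
     (orbit a b c d x m (i + c)) (orbit a b c d x m (i + d)))"

lemma form_val_iter_form:
  "form_val (iter_form (skew_form a b c d) m) (\<lambda>s. x (i + s)) = orbit a b c d x m i"
proof (induction m arbitrary: i)
  case 0
  show ?case by (simp add: form_val_def eval_mpoly_evl ring_hom_fun_id vector_eq_iff)
next
  case (Suc m)
  have "form_val (iter_form (skew_form a b c d) m) (\<lambda>s. x (i + (j + s))) = orbit a b c d x m (i + j)" for j
    using Suc[of "i + j"] by (simp add: add.assoc)
  then show ?case by (simp add: form_val_comp form_val_skew)
qed

definition general_position :: "complex^3 \<Rightarrow> complex^3 \<Rightarrow> complex^3 \<Rightarrow> complex^3 \<Rightarrow> bool" where
  "general_position p q r s \<longleftrightarrow> vdet q r s \<noteq> 0 \<and> vdet p r s \<noteq> 0 \<and> vdet p q s \<noteq> 0 \<and> vdet p q r \<noteq> 0"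

definition generic_orbit :: "int \<Rightarrow> int \<Rightarrow> int \<Rightarrow> int \<Rightarrow> (int \<Rightarrow> complex^3) \<Rightarrow> bool" where
  "generic_orbit a b c d x \<longleftrightarrow> (\<forall>m i. general_position (orbit a b c d x m (i + a)) (orbit a b c d x m (i + b))
     (orbit a b c d x m (i + c)) (orbit a b c d x m (i + d)))"

subsection \<open>Points on a conic\<close>

definition conic_point :: "complex \<Rightarrow> complex \<Rightarrow> complex^3" where
  "conic_point e t = (\<chi> k. if k = 1 then 1 else if k = 2 then t else t\<^sup>2 + e)"

lemma conic_nth: "conic_point e t $ 1 = 1" "conic_point e t $ 2 = t" "conic_point e t $ 3 = t\<^sup>2 + e"
  by (simp_all add: conic_point_def)

lemma vdet_conic: "vdet (conic_point e r) (conic_point e s) (conic_point e t) = (s - r) * (t - r) * (t - s)"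
  by (simp add: coord_simps conic_nth power2_eq_square algebra_simps)

lemma vdet_scale: "vdet (x *s u) (y *s v) (z *s w) = x * y * z * vdet u v w"
  by (simp add: vdet_def vcross_scale dot_scale)

text \<open>The chord of the parabola \<open>y = x\<^sup>2 + e\<close> between the parameters \<open>t + a\<close> and \<open>t + b\<close> is
  \<open>y = (2 t + a + b) x - (t + a) (t + b) + e\<close>.  Two such chords meet above \<open>x = t + s\<close>, at a
  height over the parabola that does not depend on \<open>t\<close>.\<close>

lemma meet_conic:
  fixes a b c d t e :: complex
  assumes "a + b \<noteq> c + d"
  defines "s \<equiv> (a * b - c * d) / (a + b - c - d)"
  shows "meet (conic_point e (t + a)) (conic_point e (t + b)) (conic_point e (t + c)) (conic_point e (t + d)) =
    ((b - a) * (d - c) * (c + d - a - b)) *s conic_point (e + ((a + b) * s - a * b - s\<^sup>2)) (t + s)"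
proof -
  have D: "a + b - c - d \<noteq> 0" using assms(1) by (simp add: algebra_simps)
  have s: "s * (a + b - c - d) = a * b - c * d" using D by (simp add: s_def)
  have "meet (conic_point e (t + a)) (conic_point e (t + b)) (conic_point e (t + c)) (conic_point e (t + d)) =
     ((b - a) * (d - c)) *s (\<chi> k. if k = 1 then c + d - a - b else if k = 2 then (c + d - a - b) * t - (a * b - c * d)
       else (c + d - a - b) * (e + t\<^sup>2 - a * b) - (a * b - c * d) * (a + b + 2 * t))"
    by (simp add: coord_simps conic_nth power2_eq_square algebra_simps)
  also have "\<dots> = ((b - a) * (d - c) * (c + d - a - b)) *s conic_point (e + ((a + b) * s - a * b - s\<^sup>2)) (t + s)"
    unfolding s[symmetric] by (simp add: coord_simps conic_nth power2_eq_square algebra_simps)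
  finally show ?thesis .
qed

lemma conic_orbit:
  fixes a b c d :: int
  assumes "a \<noteq> b" "c \<noteq> d" "a + b \<noteq> c + d"
  shows "\<exists>s e k. k \<noteq> 0 \<and> (\<forall>i. orbit a b c d (\<lambda>i. conic_point 0 (of_int i)) m i = k *s conic_point e (of_int i + s))"
proof (induction m)
  case 0
  show ?case by (intro exI[of _ 0] exI[of _ 1]) simp
next
  case (Suc m)
  then obtain s e k where k: "k \<noteq> 0" and
    orb: "\<And>i. orbit a b c d (\<lambda>i. conic_point 0 (of_int i)) m i = k *s conic_point e (of_int i + s)" by blast
  define a' b' c' d' where "a' = (of_int a :: complex)" and "b' = (of_int b :: complex)"
    and "c' = (of_int c :: complex)" and "d' = (of_int d :: complex)"
  have ne: "a' + b' \<noteq> c' + d'" "a' \<noteq> b'" "c' \<noteq> d'"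
    using assms by (simp_all add: a'_def b'_def c'_def d'_def flip: of_int_add)
  let ?s = "(a' * b' - c' * d') / (a' + b' - c' - d')"
  let ?K = "(k * k * (k * k)) * ((b' - a') * (d' - c') * (c' + d' - a' - b'))"
  have "orbit a b c d (\<lambda>i. conic_point 0 (of_int i)) (Suc m) i
     = ?K *s conic_point (e + ((a' + b') * ?s - a' * b' - ?s\<^sup>2)) (of_int i + (s + ?s))" for i
    using meet_conic[OF ne(1), of e "of_int i + s"]
    by (simp add: orb meet_scale a'_def[symmetric] b'_def[symmetric] c'_def[symmetric] d'_def[symmetric] ac_simps vector_smult_assoc)
  moreover have "c' + d' - a' - b' \<noteq> 0" using ne(1) by (simp add: algebra_simps)
  then have "?K \<noteq> 0" using k ne by simp
  ultimately show ?case by blast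
qed

lemma conic_orbit_generic:
  fixes a b c d :: int
  assumes "distinct [a, b, c, d]" "a + b \<noteq> c + d"
  shows "generic_orbit a b c d (\<lambda>i. conic_point 0 (of_int i))"
  unfolding generic_orbit_def
proof (intro allI)
  fix m i
  have ab: "a \<noteq> b" "c \<noteq> d" using assms(1) by auto
  obtain s e k where k: "k \<noteq> 0" and
    orb: "\<And>i. orbit a b c d (\<lambda>i. conic_point 0 (of_int i)) m i = k *s conic_point e (of_int i + s)"
    using conic_orbit[OF ab assms(2)] by blast
  show "general_position (orbit a b c d (\<lambda>i. conic_point 0 (of_int i)) m (i + a)) (orbit a b c d (\<lambda>i. conic_point 0 (of_int i)) m (i + b))
     (orbit a b c d (\<lambda>i. conic_point 0 (of_int i)) m (i + c)) (orbit a b c d (\<lambda>i. conic_point 0 (of_int i)) m (i + d))"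
    using assms(1) k unfolding general_position_def orb vdet_scale vdet_conic by auto
qed

lemma iter_form_nonzero:
  fixes a b c d :: int
  assumes "distinct [a, b, c, d]" "a + b \<noteq> c + d"
  shows "\<exists>k. iter_form (skew_form a b c d) m k \<noteq> 0"
proof (rule ccontr)
  assume "\<nexists>k. iter_form (skew_form a b c d) m k \<noteq> 0"
  then have "form_val (iter_form (skew_form a b c d) m) x = 0" for x
    by (simp add: form_val_def eval_mpoly_evl vector_eq_iff)
  then have 0: "orbit a b c d x m i = 0" for x i using form_val_iter_form[of a b c d m x i] by simp
  have "vdet 0 u w = 0" for u w by (simp add: coord_simps)
  have "vdet (orbit a b c d (\<lambda>i. conic_point 0 (of_int i)) m (0 + b)) (orbit a b c d (\<lambda>i. conic_point 0 (of_int i)) m (0 + c))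
      (orbit a b c d (\<lambda>i. conic_point 0 (of_int i)) m (0 + d)) \<noteq> 0"
    using conic_orbit_generic[OF assms] unfolding generic_orbit_def general_position_def by blast
  then show False unfolding 0 using \<open>\<And>w u. vdet 0 u w = 0\<close> by simp
qed

lemma eval_det3:
  "eval_mpoly x (det3 u v w) = vdet (\<chi> k. eval_mpoly x (u k)) (\<chi> k. eval_mpoly x (v k)) (\<chi> k. eval_mpoly x (w k))"
  by (simp add: det3_def vdet_def dot_def vcross_def cross_def eval_mpoly_hom)

text \<open>General position along an orbit is the nonvanishing of countably many polynomials, and none of
  them is zero because of the points on a conic.\<close>

lemma generic_orbit_exists:
  fixes a b c d :: int and h :: "3 mpoly"
  assumes "distinct [a, b, c, d]" "a + b \<noteq> c + d" "h \<noteq> 0"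
  shows "\<exists>x. generic_orbit a b c d x \<and> eval_mpoly x h \<noteq> 0"
proof -
  let ?p = "\<lambda>m j k. shift j (iter_form (skew_form a b c d) m k)"
  let ?dets = "\<lambda>m i. {det3 (?p m (i + b)) (?p m (i + c)) (?p m (i + d)), det3 (?p m (i + a)) (?p m (i + c)) (?p m (i + d)),
     det3 (?p m (i + a)) (?p m (i + b)) (?p m (i + d)), det3 (?p m (i + a)) (?p m (i + b)) (?p m (i + c))}"
  have p: "(\<chi> k. eval_mpoly x (?p m j k)) = orbit a b c d x m j" for x m j
    using form_val_iter_form[of a b c d m x j] by (simp add: form_val_def eval_shift)
  have gen: "generic_orbit a b c d x \<longleftrightarrow> (\<forall>m i. \<forall>q\<in>?dets m i. eval_mpoly x q \<noteq> 0)" for x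
    unfolding generic_orbit_def general_position_def by (simp add: eval_det3 p)
  let ?P = "insert h (\<Union>m. \<Union>i. ?dets m i)"
  have "countable ?P" by simp
  moreover have "0 \<notin> ?P"
  proof
    assume "0 \<in> ?P"
    then obtain m i where "0 \<in> ?dets m i" using assms(3) by blast
    then have "eval_mpoly (\<lambda>i. conic_point 0 (of_int i)) 0 \<noteq> 0"
      using conic_orbit_generic[OF assms(1,2)] unfolding gen by blast
    then show False by (simp add: eval_mpoly_hom)
  qed
  ultimately obtain x where x: "\<forall>p\<in>?P. eval_mpoly x p \<noteq> 0" using generic_vectors[of ?P] by blast
  then have "generic_orbit a b c d x" unfolding gen by blast
  then show ?thesis using x by blast
qed

section \<open>Arrays of points\<close>

lemma general_position_independent:
  assumes "general_position p q r s"
  shows "vcross p q \<noteq> 0" "vcross r s \<noteq> 0" "vcross p r \<noteq> 0" "p \<noteq> 0"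
proof -
  have "vdet p q r = dot (vcross p q) r" "vdet p q r = - dot (vcross p r) q" "vdet p q r = dot p (vcross q r)"
    "vdet q r s = dot q (vcross r s)"
    by (simp_all add: coord_simps algebra_simps)
  moreover have "vdet p q r \<noteq> 0" "vdet q r s \<noteq> 0" using assms by (auto simp: general_position_def)
  moreover have "dot 0 u = 0" "dot u 0 = 0" for u by (simp_all add: dot_def)
  ultimately show "vcross p q \<noteq> 0" "vcross r s \<noteq> 0" "vcross p r \<noteq> 0" "p \<noteq> 0" by auto
qed

text \<open>If \<open>Y 0 j k\<close> is the point at the site \<open>m a + j (c - a) + k p\<close>, the construction
  of the lattice map becomes the intersection of lines through neighbours in adjacent rows.\<close>

definition point_array :: "(nat \<Rightarrow> int \<Rightarrow> int \<Rightarrow> complex^3) \<Rightarrow> bool" where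
  "point_array Y \<longleftrightarrow> (\<forall>l j k. Y (Suc l) j k = meet (Y l j k) (Y l j (k + 1)) (Y l (j + 1) k) (Y l (j + 1) (k + 1)) \<and>
     general_position (Y l j k) (Y l j (k + 1)) (Y l (j + 1) k) (Y l (j + 1) (k + 1)))"

lemma vcross_combination:
  "vcross (a *s u + b *s w) (c *s u + d *s w) = (a * d - b * c) *s vcross u w"
  "vcross (a *s u + b *s w) w = a *s vcross u w"
  by (simp_all add: coord_simps algebra_simps)

lemma vcross_swap: "vcross u w = (- 1) *s vcross w u"
  by (simp add: coord_simps algebra_simps)

text \<open>The vectors \<open>X'\<close> are coordinates of the next level since each lies in both planes that define
  the intersection.  Two neighbours \<open>X' j k\<close> and \<open>X' (j + 1) k\<close> are combinations of the same two
  vectors, so the determinant \<open>W j k\<close> of their coefficients is nonzero.  The new relation arises by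
  expanding all four vectors in the row \<open>j + 1\<close> of \<open>X\<close>; its coefficients are chosen such that the two
  outer terms agree, and the middle terms then agree by the definition of \<open>W\<close>.\<close>

lemma array_step:
  fixes Y :: "nat \<Rightarrow> int \<Rightarrow> int \<Rightarrow> complex^3" and X :: "int \<Rightarrow> int \<Rightarrow> complex^3"
  assumes Y: "point_array Y"
    and scaled: "\<And>j k. \<exists>s. s \<noteq> 0 \<and> X j k = s *s Y l j k"
    and rel: "\<And>j k. \<alpha> j k *s X j k + \<beta> j k *s X j (k + 1) = \<gamma> j k *s X (j + 1) k + \<delta> j k *s X (j + 1) (k + 1)"
    and nz: "\<And>j k. \<alpha> j k \<noteq> 0"
  defines "X' \<equiv> \<lambda>j k. \<alpha> j k *s X j k + \<beta> j k *s X j (k + 1)"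
    and "W \<equiv> \<lambda>j k. \<alpha> (j + 1) k * \<delta> j k - \<beta> (j + 1) k * \<gamma> j k"
  shows "\<exists>s. s \<noteq> 0 \<and> X' j k = s *s Y (Suc l) j k" and "W j k \<noteq> 0"
    and "(W j (k + 1) * \<alpha> (j + 1) k) *s X' j k + (W j k * \<beta> (j + 1) (k + 1)) *s X' j (k + 1) =
      (W j (k + 1) * \<gamma> j k) *s X' (j + 1) k + (W j k * \<delta> j (k + 1)) *s X' (j + 1) (k + 1)"
proof -
  have gp: "general_position (Y l j k) (Y l j (k + 1)) (Y l (j + 1) k) (Y l (j + 1) (k + 1))"
    and Ys: "Y (Suc l) j k = meet (Y l j k) (Y l j (k + 1)) (Y l (j + 1) k) (Y l (j + 1) (k + 1))" for l j k
    using Y by (auto simp: point_array_def)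
  obtain s where s: "\<And>j k. s j k \<noteq> 0 \<and> X j k = s j k *s Y l j k" using scaled by metis
  have indep: "vcross (X j k) (X j (k + 1)) \<noteq> 0" for j k
    using general_position_independent(1)[OF gp[of l j k]] s by (simp add: vcross_scale)
  have X'_alt: "X' j k = \<gamma> j k *s X (j + 1) k + \<delta> j k *s X (j + 1) (k + 1)" for j k
    unfolding X'_def by (rule rel)
  have X'_eq: "X' j k = \<alpha> j k *s X j k + \<beta> j k *s X j (k + 1)" for j k by (simp add: X'_def)
  show scaled': "\<exists>s. s \<noteq> 0 \<and> X' j k = s *s Y (Suc l) j k" for j k
  proof -
    let ?n = "vcross (X j k) (X j (k + 1))" and ?m = "vcross (X (j + 1) k) (X (j + 1) (k + 1))"
    have "dot ?n (X' j k) = 0" by (simp add: X'_def dot_add dot_scale)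
    moreover have "dot ?m (X' j k) = 0" by (simp add: X'_alt dot_add dot_scale)
    ultimately have "vcross (vcross ?n ?m) (X' j k) = 0" by (simp add: vcross_vcross[of ?n ?m])
    moreover have "vcross ?n ?m = (s j k * s j (k + 1) * (s (j + 1) k * s (j + 1) (k + 1))) *s Y (Suc l) j k"
      using s meet_scale unfolding Ys meet_def by metis
    ultimately have "parallel ((s j k * s j (k + 1) * (s (j + 1) k * s (j + 1) (k + 1))) *s Y (Suc l) j k) (1 *s X' j k)"
      by (simp add: vcross_eq_0_iff)
    then have par: "parallel (Y (Suc l) j k) (X' j k)"
      using s by (subst (asm) parallel_scale) auto
    have Ynz: "Y (Suc l) j k \<noteq> 0" using general_position_independent(4)[OF gp] .
    obtain c where c: "X' j k = c *s Y (Suc l) j k" using par parallel_iff[OF Ynz] by blast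
    have "vcross (X' j k) (X j (k + 1)) \<noteq> 0"
      unfolding X'_def vcross_combination(2) using nz[of j k] indep[of j k] by simp
    then have "X' j k \<noteq> 0" by (auto simp: coord_simps)
    then have "c \<noteq> 0" using c by auto
    then show ?thesis using c by blast
  qed
  show "W j k \<noteq> 0"
  proof -
    obtain t where t: "\<And>j k. t j k \<noteq> 0 \<and> X' j k = t j k *s Y (Suc l) j k" using scaled' by metis
    have "vcross (X' (j + 1) k) (X' j k) = W j k *s vcross (X (j + 1) k) (X (j + 1) (k + 1))"
      unfolding X'_alt[of j k] X'_eq[of "j + 1" k] W_def vcross_combination(1) by simp
    moreover have "vcross (X' (j + 1) k) (X' j k) \<noteq> 0"
    proof -
      have "vcross (Y (Suc l) j k) (Y (Suc l) (j + 1) k) \<noteq> 0" using general_position_independent(3)[OF gp] .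
      then have "vcross (Y (Suc l) (j + 1) k) (Y (Suc l) j k) \<noteq> 0" by (subst vcross_swap) simp
      then show ?thesis using t by (simp add: vcross_scale)
    qed
    ultimately show ?thesis by auto
  qed
  show "(W j (k + 1) * \<alpha> (j + 1) k) *s X' j k + (W j k * \<beta> (j + 1) (k + 1)) *s X' j (k + 1) =
      (W j (k + 1) * \<gamma> j k) *s X' (j + 1) k + (W j k * \<delta> j (k + 1)) *s X' (j + 1) (k + 1)"
    unfolding X'_alt[of j] X'_eq[of "j + 1"] W_def
    by (simp add: vector_eq_iff algebra_simps)
qed

text \<open>Row \<open>j\<close> of \<open>q\<close> is a difference operator \<open>Q\<^sub>j\<close>, and the last hypothesis is
  \<open>Q\<^sub>j\<^sub>+\<^sub>1 A = Q\<^sub>j C\<close>.  The two equations \<open>Q\<^sub>j = R\<^sub>j A'\<close> and \<open>Q\<^sub>j\<^sub>+\<^sub>1 = R\<^sub>j C'\<close> at column \<open>k\<close> form a linear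
  system of determinant \<open>W j k\<close> for two neighbouring coefficients of \<open>R\<^sub>j\<close>, up to factors that depend on
  the column.  The hypothesis says that the two values obtained in this way for each coefficient
  agree and, at the ends of the support of \<open>q\<close>, that \<open>R\<^sub>j\<close> has one coefficient less than
  \<open>Q\<^sub>j\<close>.\<close>

lemma array_solution:
  fixes Y :: "nat \<Rightarrow> int \<Rightarrow> int \<Rightarrow> complex^3" and X :: "int \<Rightarrow> int \<Rightarrow> complex^3"
  assumes Y: "point_array Y"
    and "\<And>j k. \<exists>s. s \<noteq> 0 \<and> X j k = s *s Y l j k"
    and "\<And>j k. \<alpha> j k *s X j k + \<beta> j k *s X j (k + 1) = \<gamma> j k *s X (j + 1) k + \<delta> j k *s X (j + 1) (k + 1)"
    and "\<And>j k. \<alpha> j k \<noteq> 0 \<and> \<beta> j k \<noteq> 0 \<and> \<gamma> j k \<noteq> 0 \<and> \<delta> j k \<noteq> (0 :: complex)"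
    and "\<And>j k. \<not> (0 \<le> j \<and> j \<le> int n \<and> 0 \<le> k \<and> k \<le> int n) \<Longrightarrow> q j k = 0"
    and "\<exists>j k. q j k \<noteq> 0"
    and "\<And>j k. 0 \<le> j \<Longrightarrow> j < int n \<Longrightarrow>
      q (j + 1) k * \<alpha> (j + 1) k + q (j + 1) (k - 1) * \<beta> (j + 1) (k - 1) = q j k * \<gamma> j k + q j (k - 1) * \<delta> j (k - 1)"
  shows "\<exists>s. s \<noteq> 0 \<and> (\<Sum>k\<in>{0..int n}. q 0 k *s (\<alpha> 0 k *s X 0 k + \<beta> 0 k *s X 0 (k + 1))) = s *s Y (l + Suc n) 0 0"
  using assms(2-)
proof (induction n arbitrary: l X \<alpha> \<beta> \<gamma> \<delta> q)
  case (0 l X \<alpha> \<beta> \<gamma> \<delta> q)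
  note scaled = 0(1) and rel = 0(2) and nz = 0(3) and supp = 0(4) and qnz = 0(5)
  have "\<exists>s. s \<noteq> 0 \<and> \<alpha> 0 0 *s X 0 0 + \<beta> 0 0 *s X 0 (0 + 1) = s *s Y (Suc l) 0 0"
    by (rule array_step(1)[OF Y scaled rel]) (use nz in blast)
  then obtain s where s: "s \<noteq> 0" "\<alpha> 0 0 *s X 0 0 + \<beta> 0 0 *s X 0 (0 + 1) = s *s Y (Suc l) 0 0" by blast
  obtain j k where jk: "q j k \<noteq> 0" using qnz by blast
  then have "j = 0 \<and> k = 0" using supp[of j k] by force
  then have "q 0 0 * s \<noteq> 0" using jk s by simp
  moreover have "(\<Sum>k\<in>{0..int 0}. q 0 k *s (\<alpha> 0 k *s X 0 k + \<beta> 0 k *s X 0 (k + 1))) = (q 0 0 * s) *s Y (l + Suc 0) 0 0"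
    using s(2) by (simp add: vector_smult_assoc)
  ultimately show ?case by blast
next
  case (Suc n l X \<alpha> \<beta> \<gamma> \<delta> q)
  note scaled = Suc.prems(1) and rel = Suc.prems(2) and nz = Suc.prems(3) and supp = Suc.prems(4)
    and qnz = Suc.prems(5) and eqn = Suc.prems(6)
  have nz1: "\<alpha> j k \<noteq> 0" for j k using nz by blast
  define X' where "X' j k = \<alpha> j k *s X j k + \<beta> j k *s X j (k + 1)" for j k
  define W where "W j k = \<alpha> (j + 1) k * \<delta> j k - \<beta> (j + 1) k * \<gamma> j k" for j k
  note st = array_step[where \<alpha> = \<alpha> and \<beta> = \<beta> and \<gamma> = \<gamma> and \<delta> = \<delta>, OF Y scaled rel nz1, folded X'_def W_def]
  define \<alpha>' where "\<alpha>' j k = W j (k + 1) * \<alpha> (j + 1) k" for j k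
  define \<beta>' where "\<beta>' j k = W j k * \<beta> (j + 1) (k + 1)" for j k
  define \<gamma>' where "\<gamma>' j k = W j (k + 1) * \<gamma> j k" for j k
  define \<delta>' where "\<delta>' j k = W j k * \<delta> j (k + 1)" for j k
  have W: "W j k \<noteq> 0" for j k by (rule st(2))
  have scaled': "\<exists>s. s \<noteq> 0 \<and> X' j k = s *s Y (Suc l) j k" for j k by (rule st(1))
  have rel': "\<alpha>' j k *s X' j k + \<beta>' j k *s X' j (k + 1) = \<gamma>' j k *s X' (j + 1) k + \<delta>' j k *s X' (j + 1) (k + 1)" for j k
    unfolding \<alpha>'_def \<beta>'_def \<gamma>'_def \<delta>'_def by (rule st(3))
  have nz': "\<alpha>' j k \<noteq> 0 \<and> \<beta>' j k \<noteq> 0 \<and> \<gamma>' j k \<noteq> 0 \<and> \<delta>' j k \<noteq> 0" for j k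
    unfolding \<alpha>'_def \<beta>'_def \<gamma>'_def \<delta>'_def using W nz by simp
  define r where "r j k = (if 0 \<le> j \<and> j \<le> int n then (q j k * \<delta> j k - q (j + 1) k * \<beta> (j + 1) k) / (W j k * W j (k + 1)) else 0)" for j k
  have r1: "r j (k - 1) = (q (j + 1) k * \<alpha> (j + 1) k - q j k * \<gamma> j k) / (W j (k - 1) * W j k)" if "0 \<le> j" "j \<le> int n" for j k
  proof -
    have "q j (k - 1) * \<delta> j (k - 1) - q (j + 1) (k - 1) * \<beta> (j + 1) (k - 1) = q (j + 1) k * \<alpha> (j + 1) k - q j k * \<gamma> j k"
      using eqn[of j k] that by (simp add: algebra_simps)
    then show ?thesis using that by (simp add: r_def)
  qed
  have split: "q j k = r j k * \<alpha>' j k + r j (k - 1) * \<beta>' j (k - 1)"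
    "q (j + 1) k = r j k * \<gamma>' j k + r j (k - 1) * \<delta>' j (k - 1)" if "0 \<le> j" "j \<le> int n" for j k
  proof -
    have ra: "r j k * W j (k + 1) = (q j k * \<delta> j k - q (j + 1) k * \<beta> (j + 1) k) / W j k"
      using W that by (simp add: r_def)
    have rb: "r j (k - 1) * W j (k - 1) = (q (j + 1) k * \<alpha> (j + 1) k - q j k * \<gamma> j k) / W j k"
      using W by (simp add: r1[OF that])
    have "r j k * \<alpha>' j k + r j (k - 1) * \<beta>' j (k - 1) = (r j k * W j (k + 1)) * \<alpha> (j + 1) k + (r j (k - 1) * W j (k - 1)) * \<beta> (j + 1) k"
      by (simp add: \<alpha>'_def \<beta>'_def)
    also have "\<dots> = q j k * W j k / W j k"
      unfolding ra rb by (simp add: W_def add_divide_distrib[symmetric] algebra_simps)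
    finally show "q j k = r j k * \<alpha>' j k + r j (k - 1) * \<beta>' j (k - 1)" using W by simp
    have "r j k * \<gamma>' j k + r j (k - 1) * \<delta>' j (k - 1) = (r j k * W j (k + 1)) * \<gamma> j k + (r j (k - 1) * W j (k - 1)) * \<delta> j k"
      by (simp add: \<gamma>'_def \<delta>'_def)
    also have "\<dots> = q (j + 1) k * W j k / W j k"
      unfolding ra rb by (simp add: W_def add_divide_distrib[symmetric] algebra_simps)
    finally show "q (j + 1) k = r j k * \<gamma>' j k + r j (k - 1) * \<delta>' j (k - 1)" using W by simp
  qed
  have supp': "r j k = 0" if out: "\<not> (0 \<le> j \<and> j \<le> int n \<and> 0 \<le> k \<and> k \<le> int n)" for j k
  proof (cases "0 \<le> j \<and> j \<le> int n")
    case True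
    show ?thesis
    proof (cases "k < 0")
      case True then show ?thesis using supp[of j k] supp[of "j + 1" k] by (simp add: r_def)
    next
      case False
      \<comment> \<open>At the upper end the coefficient is computed from the next column, where \<open>q\<close> vanishes.\<close>
      then have "int (Suc n) < k + 1" using out True by auto
      then show ?thesis using supp[of j "k + 1"] supp[of "j + 1" "k + 1"] r1[of j "k + 1"] True by simp
    qed
  qed (auto simp: r_def)
  have rnz: "\<exists>j k. r j k \<noteq> 0"
  proof (rule ccontr)
    assume "\<nexists>j k. r j k \<noteq> 0"
    then have r0: "r j k = 0" for j k by blast
    obtain j k where jk: "q j k \<noteq> 0" using qnz by blast
    then have j: "0 \<le> j" "j \<le> int (Suc n)" using supp[of j k] by blast+
    show False
    proof (cases "j \<le> int n")
      case True then show ?thesis using split(1)[of j k] j jk by (simp add: r0)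
    next
      case False then show ?thesis using split(2)[of "j - 1" k] j jk by (simp add: r0)
    qed
  qed
  have eqn': "r (j + 1) k * \<alpha>' (j + 1) k + r (j + 1) (k - 1) * \<beta>' (j + 1) (k - 1) = r j k * \<gamma>' j k + r j (k - 1) * \<delta>' j (k - 1)"
    if "0 \<le> j" "j < int n" for j k
    using split(1)[of "j + 1" k] split(2)[of j k] that by simp
  obtain s where s: "s \<noteq> 0"
    "(\<Sum>k\<in>{0..int n}. r 0 k *s (\<alpha>' 0 k *s X' 0 k + \<beta>' 0 k *s X' 0 (k + 1))) = s *s Y (Suc l + Suc n) 0 0"
    using Suc.IH[of X' "Suc l" \<alpha>' \<beta>' \<gamma>' \<delta>' r, OF scaled' rel' nz' supp' rnz eqn'] by blast
  have "(\<Sum>k\<in>{0..int (Suc n)}. q 0 k *s X' 0 k)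
      = (\<Sum>k\<in>{0..int (Suc n)}. (r 0 k * \<alpha>' 0 k) *s X' 0 k) + (\<Sum>k\<in>{0..int (Suc n)}. (r 0 (k - 1) * \<beta>' 0 (k - 1)) *s X' 0 k)"
    unfolding sum.distrib[symmetric] using split(1)[of 0] by (intro sum.cong refl) (simp add: vector_sadd_rdistrib)
  also have "(\<Sum>k\<in>{0..int (Suc n)}. (r 0 k * \<alpha>' 0 k) *s X' 0 k) = (\<Sum>k\<in>{0..int n}. (r 0 k * \<alpha>' 0 k) *s X' 0 k)"
    using supp'[of 0] by (intro sum.mono_neutral_right) auto
  also have "(\<Sum>k\<in>{0..int (Suc n)}. (r 0 (k - 1) * \<beta>' 0 (k - 1)) *s X' 0 k)
      = (\<Sum>k\<in>{-1..int n}. (r 0 k * \<beta>' 0 k) *s X' 0 (k + 1))"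
    by (rule sum.reindex_bij_witness[of _ "\<lambda>k. k + 1" "\<lambda>k. k - 1"]) auto
  also have "\<dots> = (\<Sum>k\<in>{0..int n}. (r 0 k * \<beta>' 0 k) *s X' 0 (k + 1))"
    using supp'[of 0] by (intro sum.mono_neutral_right) auto
  also have "(\<Sum>k\<in>{0..int n}. (r 0 k * \<alpha>' 0 k) *s X' 0 k) + (\<Sum>k\<in>{0..int n}. (r 0 k * \<beta>' 0 k) *s X' 0 (k + 1))
      = (\<Sum>k\<in>{0..int n}. r 0 k *s (\<alpha>' 0 k *s X' 0 k + \<beta>' 0 k *s X' 0 (k + 1)))"
    by (simp add: sum.distrib vector_add_ldistrib vector_smult_assoc)
  finally have "(\<Sum>k\<in>{0..int (Suc n)}. q 0 k *s X' 0 k) = s *s Y (l + Suc (Suc n)) 0 0" using s(2) by simp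
  then show ?case using s(1) unfolding X'_def by blast
qed

lemma plane_relation:
  "vdet q r s *s p + (- vdet p r s) *s q = (- vdet p q s) *s r + vdet p q r *s s"
  by (simp add: coord_simps algebra_simps)

lemma tdeg_det3:
  fixes u v w :: "3 \<Rightarrow> 3 mpoly"
  assumes "\<And>k. tdeg (u k) \<le> 1" "\<And>k. tdeg (v k) \<le> 1" "\<And>k. tdeg (w k) \<le> 1"
  shows "tdeg (det3 u v w) \<le> 3"
proof -
  have "tdeg (cross v w k) \<le> 2" for k
  proof -
    have "tdeg (v (k + 1) * w (k + 2)) \<le> 1 + 1" "tdeg (- (v (k + 2) * w (k + 1))) \<le> 1 + 1"
      using tdeg_mult_le[OF assms(2,3)] by simp_all
    then have "tdeg (v (k + 1) * w (k + 2) + - (v (k + 2) * w (k + 1))) \<le> 1 + 1" by (rule tdeg_add_le)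
    then show ?thesis by (simp add: cross_def)
  qed
  then have "tdeg (u k * cross v w k) \<le> 1 + 2" for k using assms(1) by (intro tdeg_mult_le)
  then show ?thesis unfolding det3_def by (intro tdeg_sum_le) (simp add: numeral_3_eq_3)
qed

lemma sum_if_pair:
  fixes q :: "int \<times> int \<Rightarrow> 'a::comm_ring_1"
  assumes "finite U" "u \<notin> U \<Longrightarrow> q u = 0"
  shows "(\<Sum>v\<in>U. (if v = u then a else 0) * q v) = q u * a"
proof -
  have "(\<Sum>v\<in>U. (if v = u then a else 0) * q v) = (\<Sum>v\<in>U. if v = u then q u * a else 0)"
    by (intro sum.cong) (auto simp: mult.commute)
  then show ?thesis using assms by (auto simp: sum.delta)
qed

text \<open>The linear system of \<open>array_solution\<close> is solved over the ring of polynomials in the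
  coordinates of all points.  At a generic configuration its solution is nonzero and computes the
  iterate; proportionality at generic configurations is proportionality of polynomials.\<close>

lemma iterate_bounded_forms:
  fixes a c p :: int and n :: nat
  defines "R \<equiv> skew_form a (a + p) c (c + p)"
  assumes dist: "distinct [a, a + p, c, c + p]"
  shows "\<exists>G. (\<forall>k. tdeg (G k) \<le> 3 * (n * (n + 2)) + 4) \<and> same_ratio (iter_form R (Suc n)) G \<and> (\<exists>k. G k \<noteq> 0)"
proof -
  have ne: "a + (a + p) \<noteq> c + (c + p)" using dist by auto
  let ?m = "int (Suc n)"
  define \<sigma> where "\<sigma> j k = ?m * a + j * (c - a) + k * p" for j k
  define P where "P j k = coord (\<sigma> j k)" for j k
  define A where "A j k = det3 (P j (k + 1)) (P (j + 1) k) (P (j + 1) (k + 1))" for j k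
  define B where "B j k = - det3 (P j k) (P (j + 1) k) (P (j + 1) (k + 1))" for j k
  define \<Gamma> where "\<Gamma> j k = - det3 (P j k) (P j (k + 1)) (P (j + 1) (k + 1))" for j k
  define \<Delta> where "\<Delta> j k = det3 (P j k) (P j (k + 1)) (P (j + 1) k)" for j k
  have degP: "tdeg (P j k i) \<le> 1" for j k i by (simp add: P_def coord_def)
  have deg3: "tdeg (A j k) \<le> 3" "tdeg (B j k) \<le> 3" "tdeg (\<Gamma> j k) \<le> 3" "tdeg (\<Delta> j k) \<le> 3" for j k
    unfolding A_def B_def \<Gamma>_def \<Delta>_def tdeg_uminus by (intro tdeg_det3 degP)+
  define U where "U = {0..int n} \<times> {0..int n}"
  define E where "E = {0..<int n} \<times> {0..int n + 1}"
  \<comment> \<open>The equation at \<open>(j, k)\<close> with all terms on one side, as a row of coefficients.\<close>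
  define M where "M = (\<lambda>(j, k) u. (if u = (j + 1, k) then A (j + 1) k else 0) + (if u = (j + 1, k - 1) then B (j + 1) (k - 1) else 0)
    + (if u = (j, k) then - \<Gamma> j k else 0) + (if u = (j, k - 1) then - \<Delta> j (k - 1) else 0))"
  have cards: "card E = n * (n + 2)" "card U = (n + 1) * (n + 1)"
    by (simp_all add: E_def U_def card_cartesian_product nat_add_distrib)
  have finU: "finite U" and finE: "finite E" by (simp_all add: U_def E_def)
  have less: "card E < card U" unfolding cards by simp
  have "tdeg (M e u) \<le> 3" for e u
    unfolding M_def by (cases e) (auto intro!: tdeg_add_le simp: deg3)
  then have "\<exists>q. (\<exists>u\<in>U. q u \<noteq> 0) \<and> (\<forall>u. u \<notin> U \<longrightarrow> q u = 0) \<and>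
      (\<forall>e\<in>E. (\<Sum>u\<in>U. M e u * q u) = 0) \<and> (\<forall>u. tdeg (q u) \<le> card E * 3)"
    by (intro bounded_degree_kernel[OF finE finU less])
  then obtain q where q_all: "(\<exists>u\<in>U. q u \<noteq> 0) \<and> (\<forall>u. u \<notin> U \<longrightarrow> q u = 0) \<and>
      (\<forall>e\<in>E. (\<Sum>u\<in>U. M e u * q u) = 0) \<and> (\<forall>u. tdeg (q u) \<le> n * (n + 2) * 3)"
    unfolding cards(1) by (rule exE)
  have q: "\<exists>u\<in>U. q u \<noteq> 0" "\<And>u. u \<notin> U \<Longrightarrow> q u = 0"
    "\<And>e. e \<in> E \<Longrightarrow> (\<Sum>u\<in>U. M e u * q u) = 0" "\<And>u. tdeg (q u) \<le> n * (n + 2) * 3"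
    using q_all by blast+
  have pick: "(\<Sum>v\<in>U. (if v = u then e else 0) * q v) = q u * e" for u e
    by (rule sum_if_pair[OF finU]) (rule q(2))
  have sys: "q (j + 1, k) * A (j + 1) k + q (j + 1, k - 1) * B (j + 1) (k - 1) = q (j, k) * \<Gamma> j k + q (j, k - 1) * \<Delta> j (k - 1)"
    if j: "0 \<le> j" "j < int n" for j k
  proof (cases "0 \<le> k \<and> k \<le> int n + 1")
    case True
    then have "(\<Sum>u\<in>U. M (j, k) u * q u) = 0" using j by (intro q(3)) (simp add: E_def)
    also have "(\<Sum>u\<in>U. M (j, k) u * q u) = q (j + 1, k) * A (j + 1) k + q (j + 1, k - 1) * B (j + 1) (k - 1)
        + q (j, k) * (- \<Gamma> j k) + q (j, k - 1) * (- \<Delta> j (k - 1))"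
      unfolding M_def by (simp only: case_prod_conv distrib_right sum.distrib pick)
    finally show ?thesis by (simp add: algebra_simps)
  next
    case False
    then have "(j', k) \<notin> U" "(j', k - 1) \<notin> U" for j' by (auto simp: U_def)
    then show ?thesis using q(2) by simp
  qed
  define G where "G i = (\<Sum>k\<in>{0..int n}. q (0, k) * (A 0 k * P 0 k i + B 0 k * P 0 (k + 1) i))" for i
  have degG: "tdeg (G i) \<le> 3 * (n * (n + 2)) + 4" for i
  proof -
    have "tdeg (q (0, k) * (A 0 k * P 0 k i + B 0 k * P 0 (k + 1) i)) \<le> n * (n + 2) * 3 + (3 + 1)" for k
      by (intro tdeg_mult_le tdeg_add_le q(4) deg3 degP)
    then show ?thesis unfolding G_def by (intro tdeg_sum_le) (simp add: mult.commute)
  qed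
  obtain u0 where u0: "q u0 \<noteq> 0" using q(1) by blast
  have val: "\<exists>s. s \<noteq> 0 \<and> form_val G x = s *s form_val (iter_form R (Suc n)) x"
    if gen: "generic_orbit a (a + p) c (c + p) x" and qx: "eval_mpoly x (q u0) \<noteq> 0" for x
  proof -
    define Y where "Y l j k = orbit a (a + p) c (c + p) x l ((?m - int l) * a + j * (c - a) + k * p)" for l j k
    have pos: "(?m - int (Suc l)) * a + j * (c - a) + k * p + a = (?m - int l) * a + j * (c - a) + k * p"
      "(?m - int (Suc l)) * a + j * (c - a) + k * p + (a + p) = (?m - int l) * a + j * (c - a) + (k + 1) * p"
      "(?m - int (Suc l)) * a + j * (c - a) + k * p + c = (?m - int l) * a + (j + 1) * (c - a) + k * p"
      "(?m - int (Suc l)) * a + j * (c - a) + k * p + (c + p) = (?m - int l) * a + (j + 1) * (c - a) + (k + 1) * p" for l j k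
      by (simp_all add: algebra_simps)
    have "point_array Y" unfolding point_array_def
    proof (intro allI conjI)
      fix l j k
      show "Y (Suc l) j k = meet (Y l j k) (Y l j (k + 1)) (Y l (j + 1) k) (Y l (j + 1) (k + 1))"
        unfolding Y_def orbit.simps(2) pos ..
      have "general_position (orbit a (a + p) c (c + p) x l ((?m - int (Suc l)) * a + j * (c - a) + k * p + a))
        (orbit a (a + p) c (c + p) x l ((?m - int (Suc l)) * a + j * (c - a) + k * p + (a + p)))
        (orbit a (a + p) c (c + p) x l ((?m - int (Suc l)) * a + j * (c - a) + k * p + c))
        (orbit a (a + p) c (c + p) x l ((?m - int (Suc l)) * a + j * (c - a) + k * p + (c + p)))"
        using gen unfolding generic_orbit_def by blast
      then show "general_position (Y l j k) (Y l j (k + 1)) (Y l (j + 1) k) (Y l (j + 1) (k + 1))"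
        unfolding pos Y_def .
    qed
    note arr = this
    have Px: "(\<chi> i. eval_mpoly x (P j k i)) = Y 0 j k" for j k
      by (simp add: P_def eval_coord Y_def \<sigma>_def vector_eq_iff)
    have Px': "eval_mpoly x (P j k i) = Y 0 j k $ i" for j k i using Px[of j k, symmetric] by simp
    note ev = A_def B_def \<Gamma>_def \<Delta>_def eval_mpoly_hom(4) eval_det3 Px
    have gp: "general_position (Y 0 j k) (Y 0 j (k + 1)) (Y 0 (j + 1) k) (Y 0 (j + 1) (k + 1))" for j k
      using arr by (simp add: point_array_def)
    have "\<exists>s. s \<noteq> 0 \<and> (\<Sum>k\<in>{0..int n}. eval_mpoly x (q (0, k)) *s (eval_mpoly x (A 0 k) *s Y 0 0 k + eval_mpoly x (B 0 k) *s Y 0 0 (k + 1)))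
        = s *s Y (0 + Suc n) 0 0"
    proof (rule array_solution[OF arr, where \<alpha> = "\<lambda>j k. eval_mpoly x (A j k)" and \<beta> = "\<lambda>j k. eval_mpoly x (B j k)"
          and \<gamma> = "\<lambda>j k. eval_mpoly x (\<Gamma> j k)" and \<delta> = "\<lambda>j k. eval_mpoly x (\<Delta> j k)" and q = "\<lambda>j k. eval_mpoly x (q (j, k))"])
      show "\<exists>s. s \<noteq> 0 \<and> Y 0 j k = s *s Y 0 j k" for j k by (intro exI[of _ 1]) simp
      show "eval_mpoly x (A j k) *s Y 0 j k + eval_mpoly x (B j k) *s Y 0 j (k + 1) =
        eval_mpoly x (\<Gamma> j k) *s Y 0 (j + 1) k + eval_mpoly x (\<Delta> j k) *s Y 0 (j + 1) (k + 1)" for j k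
        unfolding ev by (rule plane_relation)
      show "eval_mpoly x (A j k) \<noteq> 0 \<and> eval_mpoly x (B j k) \<noteq> 0 \<and> eval_mpoly x (\<Gamma> j k) \<noteq> 0 \<and> eval_mpoly x (\<Delta> j k) \<noteq> 0" for j k
        using gp[of j k] unfolding ev general_position_def by simp
      show "eval_mpoly x (q (j, k)) = 0" if "\<not> (0 \<le> j \<and> j \<le> int n \<and> 0 \<le> k \<and> k \<le> int n)" for j k
        using q(2)[of "(j, k)"] that by (auto simp: U_def eval_mpoly_hom)
      show "\<exists>j k. eval_mpoly x (q (j, k)) \<noteq> 0" using qx by (cases u0) blast
      show "eval_mpoly x (q (j + 1, k)) * eval_mpoly x (A (j + 1) k) + eval_mpoly x (q (j + 1, k - 1)) * eval_mpoly x (B (j + 1) (k - 1)) =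
        eval_mpoly x (q (j, k)) * eval_mpoly x (\<Gamma> j k) + eval_mpoly x (q (j, k - 1)) * eval_mpoly x (\<Delta> j (k - 1))"
        if "0 \<le> j" "j < int n" for j k
        using arg_cong[OF sys[OF that, of k], of "eval_mpoly x"] by (simp add: eval_mpoly_hom)
    qed
    then obtain s where s: "s \<noteq> 0" "(\<Sum>k\<in>{0..int n}. eval_mpoly x (q (0, k)) *s (eval_mpoly x (A 0 k) *s Y 0 0 k + eval_mpoly x (B 0 k) *s Y 0 0 (k + 1)))
        = s *s Y (Suc n) 0 0" by auto
    have "form_val G x = s *s Y (Suc n) 0 0"
      unfolding s(2)[symmetric]
      by (simp add: form_val_def G_def eval_mpoly_hom Px' vector_eq_iff algebra_simps)
    also have "Y (Suc n) 0 0 = form_val (iter_form R (Suc n)) x"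
      using form_val_iter_form[of a "a + p" c "c + p" "Suc n" x 0] by (simp add: Y_def R_def)
    finally show ?thesis using s(1) by blast
  qed
  have iter_nz: "form_val (iter_form R (Suc n)) x \<noteq> 0" if "generic_orbit a (a + p) c (c + p) x" for x
  proof -
    have "general_position (orbit a (a + p) c (c + p) x (Suc n) (- a + a)) (orbit a (a + p) c (c + p) x (Suc n) (- a + (a + p)))
       (orbit a (a + p) c (c + p) x (Suc n) (- a + c)) (orbit a (a + p) c (c + p) x (Suc n) (- a + (c + p)))"
      using that unfolding generic_orbit_def by blast
    then have "orbit a (a + p) c (c + p) x (Suc n) (- a + a) \<noteq> 0" by (rule general_position_independent(4))
    then show ?thesis using form_val_iter_form[of a "a + p" c "c + p" "Suc n" x 0] by (simp add: R_def)
  qed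
  have "same_ratio (iter_form R (Suc n)) G"
  proof (rule ccontr)
    assume "\<not> same_ratio (iter_form R (Suc n)) G"
    then obtain i j where ij: "iter_form R (Suc n) i * G j - iter_form R (Suc n) j * G i \<noteq> 0"
      unfolding same_ratio_def by (metis eq_iff_diff_eq_0)
    let ?H = "iter_form R (Suc n) i * G j - iter_form R (Suc n) j * G i"
    \<comment> \<open>Multiplying by \<open>q u0\<close> ensures that the solution is nonzero at the chosen configuration.\<close>
    have "?H * q u0 \<noteq> 0" using ij u0 cpoly_no_zero_divisors by blast
    then obtain x where x: "generic_orbit a (a + p) c (c + p) x" "eval_mpoly x (?H * q u0) \<noteq> 0"
      using generic_orbit_exists[OF dist ne] by blast
    then have nz: "eval_mpoly x ?H \<noteq> 0" "eval_mpoly x (q u0) \<noteq> 0"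
      unfolding eval_mpoly_hom(1) by auto
    obtain s where "form_val G x = s *s form_val (iter_form R (Suc n)) x" using val[OF x(1) nz(2)] by blast
    then show False using nz(1) unfolding eval_cross by simp
  qed
  moreover have "\<exists>k. G k \<noteq> 0"
  proof (rule ccontr)
    assume 0: "\<nexists>k. G k \<noteq> 0"
    obtain x where x: "generic_orbit a (a + p) c (c + p) x" "eval_mpoly x (q u0) \<noteq> 0"
      using generic_orbit_exists[OF dist ne u0] by blast
    have "form_val G x = 0" using 0 by (simp add: form_val_def eval_mpoly_hom vector_eq_iff)
    then show False using val[OF x] iter_nz[OF x(1)] by auto
  qed
  ultimately show ?thesis using degG by blast
qed

section \<open>Degree growth\<close>

text \<open>The polynomials of quadratic degree that compute an iterate are a multiple of its reduced form,
  which bounds the degree of the form from above.  The degree is not zero, because the image of the points on a conic under an iterate does not consist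
  of one point.\<close>

lemma lattice_degree_bounds:
  fixes a c p :: int
  assumes dist: "distinct [a, a + p, c, c + p]"
  defines "T \<equiv> skew_pentagram a (a + p) c (c + p)"
  shows "1 \<le> lattice_degree (lattice_iter T m)" "1 \<le> m \<Longrightarrow> lattice_degree (lattice_iter T m) \<le> 4 * m ^ 2"
proof -
  let ?R = "skew_form a (a + p) c (c + p)"
  have ne: "a + (a + p) \<noteq> c + (c + p)" using dist by auto
  note R = skew_form_reduced[OF dist] and nz = iter_form_nonzero[OF dist ne]
  obtain X C where C: "reduced X C" "lattice_iter T m = form_map C" "same_ratio C (iter_form ?R m)"
    using lattice_iter_form_map[OF R nz] unfolding T_def skew_pentagram_form_map by blast
  obtain N where N: "\<And>k. homogeneous (\<lambda>_. 1) N (C k)" using reduced_homogeneous[OF C(1)] by blast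
  have deg: "lattice_degree (lattice_iter T m) = N" unfolding C(2) by (rule lattice_degree_form_map[OF C(1) N])
  obtain k where k: "C k \<noteq> 0" using forms_on_nonzero[OF reducedD(3)[OF C(1)]] by blast
  have "N \<noteq> 0"
  proof
    assume "N = 0"
    then have "tdeg (C j) = 0" for j using N[of j] tdeg_le_iff[of "C j" 0] by (simp add: homogeneous_def)
    then have const: "vars (C j) = {}" for j using tdeg_0_Con[of "C j"] vars_Con by metis
    have "eval_mpoly x (C j) = eval_mpoly y (C j)" for x y j
      unfolding eval_mpoly_evl by (rule pval_cong) (simp add: const)
    then have Cxy: "form_val C x = form_val C y" for x y
      unfolding form_val_def vector_eq_iff by simp
    let ?x = "\<lambda>i :: int. conic_point 0 (of_int i)"
    have ab: "a \<noteq> a + p" "c \<noteq> c + p" using dist by auto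
    obtain s e l where l: "l \<noteq> 0" "\<And>i. orbit a (a + p) c (c + p) ?x m i = l *s conic_point e (of_int i + s)"
      using conic_orbit[OF ab ne] by blast
    obtain g where g: "\<And>j. iter_form ?R m j = g * C j" using reduced_dvd[OF reducedD(4)[OF C(1)] C(3) k] by blast
    have "parallel (form_val C ?x) (l *s conic_point e (of_int i + s))" for i
      using form_val_same_ratio[OF C(3), of "\<lambda>t. ?x (i + t)"] form_val_iter_form[of a "a + p" c "c + p" m ?x i]
        Cxy[of "\<lambda>t. ?x (i + t)" ?x] l(2)[of i] by simp
    then have par: "parallel (form_val C ?x) (conic_point e (of_int i + s))" for i
      using l(1) unfolding parallel_def by (simp add: algebra_simps)
    define w where "w = form_val C ?x"
    have w: "w $ j * conic_point e (of_int i + s) $ k = w $ k * conic_point e (of_int i + s) $ j" for i j k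
      using par[of i] unfolding parallel_def w_def by blast
    \<comment> \<open>A vector parallel to two different points of the conic is zero.\<close>
  have w2: "w $ 2 = w $ 1 * (of_int i + s)" for i using w[of 2 i 1] by (simp add: conic_nth)
    have "w $ 1 = 0" using w2[of 0] w2[of 1] by (simp add: algebra_simps)
    then have "w $ 2 = 0" "w $ 3 = 0" using w2[of 0] w[of 3 0 1] by (simp_all add: conic_nth)
    then have w0: "w = 0" using \<open>w $ 1 = 0\<close> by (simp add: vector_eq_iff forall_3)
    have "eval_mpoly ?x (C k) = 0" using w0 unfolding w_def by (simp add: form_val_def vector_eq_iff)
    moreover obtain z where z: "C k = Con z" using vars_empty_Con[OF const[of k]] by blast
    ultimately show False using k by (simp add: eval_mpoly_evl)
  qed
  then show "1 \<le> lattice_degree (lattice_iter T m)" using deg by simp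
  show "lattice_degree (lattice_iter T m) \<le> 4 * m ^ 2" if m: "1 \<le> m"
  proof -
    obtain n where n: "m = Suc n" using m by (cases m) auto
    obtain G where G: "\<And>k. tdeg (G k) \<le> 3 * (n * (n + 2)) + 4" "same_ratio (iter_form ?R m) G" "\<exists>k. G k \<noteq> 0"
      using iterate_bounded_forms[OF dist, of n] unfolding n by blast
    obtain j where j: "iter_form ?R m j \<noteq> 0" using nz by blast
    have "same_ratio C G" by (rule same_ratio_trans[OF C(3) G(2) j])
    then obtain h where h: "\<And>j. G j = h * C j" using reduced_dvd[OF reducedD(4)[OF C(1)] _ k] by blast
    have "h \<noteq> 0" using h G(3) by auto
    then have "tdeg (C k) \<le> tdeg (G k)" using tdeg_mult[OF _ k, of h] h[of k] by simp
    moreover have "N \<le> tdeg (C k)"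
    proof -
      obtain t where "t \<in> keys (C k)" using k by fastforce
      then show ?thesis using weight_le_tdeg[of t "C k"] N[of k] by (auto simp: homogeneous_def)
    qed
    ultimately have "N \<le> 3 * (n * (n + 2)) + 4" using G(1)[of k] by linarith
    also have "\<dots> \<le> 4 * m ^ 2" unfolding n by (simp add: power2_eq_square algebra_simps)
    finally show ?thesis using deg by simp
  qed
qed

lemma skew_pentagram_iterable:
  fixes a c p :: int
  assumes dist: "distinct [a, a + p, c, c + p]"
  shows "iterable (skew_pentagram a (a + p) c (c + p))"
proof -
  have ne: "a + (a + p) \<noteq> c + (c + p)" using dist by auto
  show ?thesis unfolding skew_pentagram_form_map
    by (rule iterable_form_map[OF skew_form_reduced[OF dist] iter_form_nonzero[OF dist ne]])
qed

lemma root_quadratic_bound_tendsto: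
  fixes f :: "nat \<Rightarrow> nat"
  assumes "\<And>m. 1 \<le> f m" "\<And>m. 1 \<le> m \<Longrightarrow> f m \<le> 4 * m ^ 2"
  shows "(\<lambda>m. root m (real (f m))) \<longlonglongrightarrow> 1"
proof (rule tendsto_sandwich)
  show "\<forall>\<^sub>F m in sequentially. 1 \<le> root m (real (f m))"
    using assms(1) by (intro eventually_sequentiallyI[of 1]) (simp add: real_root_ge_1_iff)
  show "\<forall>\<^sub>F m in sequentially. root m (real (f m)) \<le> root m 4 * root m (real m) ^ 2"
  proof (rule eventually_sequentiallyI[of 1])
    fix m :: nat assume m: "1 \<le> m"
    have "real (f m) \<le> real (4 * m ^ 2)" using assms(2)[OF m] by (rule of_nat_mono)
    then have "root m (real (f m)) \<le> root m (4 * real m ^ 2)" using m by (simp add: real_root_le_iff)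
    also have "\<dots> = root m 4 * root m (real m) ^ 2" using m by (simp add: real_root_mult real_root_power)
    finally show "root m (real (f m)) \<le> root m 4 * root m (real m) ^ 2" .
  qed
  have "(\<lambda>m. root m 4 * root m (real m) ^ 2) \<longlonglongrightarrow> 1 * 1 ^ 2"
    by (intro tendsto_mult tendsto_power LIMSEQ_root LIMSEQ_root_const) simp
  then show "(\<lambda>m. root m 4 * root m (real m) ^ 2) \<longlonglongrightarrow> 1" by simp
qed simp

lemma skew_pentagram_swap: "skew_pentagram a b c d = skew_pentagram a b d c"
proof -
  have "proj_line p q = proj_line q p" for p q :: "3 proj" by (simp add: proj_line_def insert_commute)
  then show ?thesis by (intro ext) (simp add: skew_pentagram_def; metis)
qed

theorem theorem6p8:
  fixes a b c d :: int and T :: "3 lattice_map"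
  assumes "distinct [a, b, c, d]"
    and "\<bar>b - a\<bar> = \<bar>d - c\<bar>"
    and "T = skew_pentagram a b c d"
  shows "iterable T
    \<and> (\<exists>k::nat. (\<lambda>m. real (lattice_degree (lattice_iter T m))) \<in> O(\<lambda>m. real m ^ k))
    \<and> convergent (degree_root T)
    \<and> dynamical_degree T = 1"
proof -
  obtain c' p where T: "T = skew_pentagram a (a + p) c' (c' + p)" and dist: "distinct [a, a + p, c', c' + p]"
  proof (cases "b - a = d - c")
    case True
    then have "b = a + (b - a)" "d = c + (b - a)" by simp_all
    then show ?thesis using that[of "b - a" c] assms by simp
  next
    case False
    then have "b - a = c - d" using assms(2) by linarith
    then have "b = a + (b - a)" "c = d + (b - a)" by simp_all
    then show ?thesis using that[of "b - a" d] assms skew_pentagram_swap[of a b c d] by auto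
  qed
  let ?f = "\<lambda>m. lattice_degree (lattice_iter T m)"
  have low: "1 \<le> ?f m" for m unfolding T by (rule lattice_degree_bounds(1)[OF dist])
  have up: "?f m \<le> 4 * m ^ 2" if "1 \<le> m" for m unfolding T by (rule lattice_degree_bounds(2)[OF dist that])
  have "(\<lambda>m. real (?f m)) \<in> O(\<lambda>m. real m ^ 2)"
  proof (rule bigoI[of _ 4], rule eventually_sequentiallyI[of 1])
    fix m :: nat assume "1 \<le> m"
    from of_nat_mono[OF up[OF this], where 'a = real] show "norm (real (?f m)) \<le> 4 * norm (real m ^ 2)" by simp
  qed
  moreover have lim: "degree_root T \<longlonglongrightarrow> 1"
    unfolding degree_root_def[abs_def] by (rule root_quadratic_bound_tendsto[OF low up])
  ultimately show ?thesis
    using skew_pentagram_iterable[OF dist] limI[OF lim] unfolding T dynamical_degree_def convergent_def by blast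
qed

end
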